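(* Let $u\in H^2(\Omega)\cap H_0^1(\Omega)$ be the solution of $-\varepsilon\Delta u+\boldsymbol\beta\cdot\nabla u+\sigma u=f$ in $\Omega$, $u=0$ on $\partial\Omega$, and let $u_{hb}\in V_{hb}^0$ be any solution of the Dynamic Diffusion problem $$B(u_{hb},v_{hb})+D_h(u_{hb};u_{hb},v_{hb})=(f,v_{hb})\qquad\forall v_{hb}\in V_{hb}^0 .$$ Let $u_h:=\kappa_h(u_{hb})\in V_h^0$ and $A_h:=D_h(u_{hb};u_{hb},u_{hb})$. Then $$\|u-u_h\|_E\le(1+C_{\kappa,E})\|u-\Pi_hu\|_E+C_{\kappa,E}\|u-u_{hb}\|_E .$$ Consequently, for fixed problem data, $$\|u-u_h\|_E\le Ch\qquad\text{and}\qquad\left(\|u-u_h\|_E^2+A_h\right)^{1/2}\le Ch,$$ where $C>0$ is independent of $h$. The result holds for both $\sigma>0$ and $\sigma=0$.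
   Context: Data. $\Omega\subset\mathbb R^d$, $d\in\{2,3\}$, is a bounded polygonal ($d=2$) or polyhedral ($d=3$) domain with Lipschitz boundary; $\varepsilon>0$, $\boldsymbol\beta\in[W^{1,\infty}(\Omega)]^d$ with $\nabla\cdot\boldsymbol\beta=0$, $\sigma\ge0$ a constant, $f\in L^2(\Omega)$. $(\cdot,\cdot)$ and $(\cdot,\cdot)_T$ are the $L^2$ inner products over $\Omega$ and $T$, $\|\cdot\|_0,\|\cdot\|_{0,T}$ the corresponding norms; $|v|_1=\|\nabla v\|_0$, $\|v\|_1^2=\|v\|_0^2+|v|_1^2$, and likewise with subscript $T$. $\|\boldsymbol\beta\|_{0,\infty,T}$ is the essential supremum over $T$ of the Euclidean norm of $\boldsymbol\beta$. $$B(w,v)=\varepsilon(\nabla w,\nabla v)+(\boldsymbol\beta\cdot\nabla w,v)+\sigma(w,v),\qquad \|v\|_E^2=\varepsilon|v|_1^2+\sigma\|v\|_0^2 .$$ Discrete spaces. $\mathcal T_h$ is a conforming triangulation of $\Omega$ into simplices, from a shape-regular family; $h_T=\operatorname{diam}(T)$, $h=\max_Th_T$. $V_h^0=\{v\in H_0^1(\Omega): v|_T\in\mathbb P_1(T)\ \forall T\in\mathcal T_h\}$; $V_b=\bigoplus_T\operatorname{span}\{\psi_T\}$, where $\psi_T\in H_0^1(T)$ is the standard simplex bubble of degree $d+1$ (product of the barycentric coordinates of $T$, up to scaling), extended by zero; $V_{hb}^0=V_h^0\oplus V_b$. $\kappa_h:V_{hb}^0\to V_h^0$ is the projection $\kappa_h(v_h+v_b)=v_h$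 for $v_h\in V_h^0$, $v_b\in V_b$. It is $L^2$-stable: there is $C_\kappa>0$ independent of $h$ with $\|\kappa_h(v_{hb})\|_{0,T}\le C_\kappa\|v_{hb}\|_{0,T}$ for all $v_{hb}\in V_{hb}^0$, $T\in\mathcal T_h$. $C_{\kappa,E}:=\max\{1,C_\kappa\}$ is the energy-norm stability constant of $\kappa_h$: $\|\kappa_h(v_{hb})\|_E\le C_{\kappa,E}\|v_{hb}\|_E$ on $V_{hb}^0$. $\Pi_hu\in V_h^0$ is the finite element (nodal Lagrange) interpolant of $u$, for which $\|u-\Pi_hu\|_0\le C_Ih^2|u|_2$ and $|u-\Pi_hu|_1\le C_Ih|u|_2$, with $|\cdot|_2$ the $H^2(\Omega)$ seminorm and $C_I$ independent of $h$. Artificial diffusion. For $v_h\in V_h^0$, $R_T(v_h)=\boldsymbol\beta\cdot\nabla v_h+\sigma v_h-f$ on $T$. $Pe_T=\|\boldsymbol\beta\|_{0,\infty,T}h_T/(2\varepsilon)$; $\chi_T=1$ if $Pe_T>1$, $\chi_T=0$ if $Pe_T\le1$. Fix $\tau>0$ and numbers $\mu(h_T)>0$ with $\mu(h_T)\le C_\mu h_T$, $C_\mu$ independent of $h$. Let $\mathcal N_T(v_h)=\|v_h\|_{1,T}$ if $\sigma>0$ and $\mathcal N_T(v_h)=|v_h|_{1,T}$ if $\sigma=0$, and $$\xi_T(v_h)=\chi_T\,\mu(h_T)\frac{\|R_T(v_h)\|_{0,T}}{\mathcal N_T(v_h)+\tau},\qquad D_h(z_{hb};u_{hb},v_{hb})=\sum_{T\in\mathcal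 T_h}\xi_T(\kappa_h(z_{hb}))(\nabla u_{hb},\nabla v_{hb})_T .$$ "For fixed problem data" means that $C$ may depend on $\Omega,\varepsilon,\boldsymbol\beta,\sigma,f,\tau$ and $u$; "independent of $h$" means the same constant works for all meshes of the family. *)

theory Defs
  imports "HOL-Analysis.Analysis" "HOL-Probability.Essential_Supremum"
begin

section \<open>Domains\<close>

text \<open>Near each boundary point the set lies strictly above the graph of a Lipschitz function
  over the hyperplane orthogonal to some unit vector.\<close>

definition lipschitz_boundary :: "'a::euclidean_space set \<Rightarrow> bool" where
  "lipschitz_boundary \<Omega> \<longleftrightarrow>
     (\<forall>p\<in>frontier \<Omega>. \<exists>e r L \<gamma>. norm e = 1 \<and> r > 0 \<and> L-lipschitz_on {y. y \<bullet> e = 0} \<gamma> \<and>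
        \<Omega> \<inter> ball p r = {x \<in> ball p r. x \<bullet> e > (\<gamma> (x - (x \<bullet> e) *\<^sub>R e) :: real)})"

text \<open>Polygonal (d = 2) or polyhedral (d = 3) domain: the boundary is a finite union of flat
  pieces of dimension d - 1.  Non-convex faces are unions of several polytopes.\<close>

definition polyhedral_domain :: "'a::euclidean_space set \<Rightarrow> bool" where
  "polyhedral_domain \<Omega> \<longleftrightarrow>
     open \<Omega> \<and> connected \<Omega> \<and> \<Omega> \<noteq> {} \<and> bounded \<Omega> \<and>
     (\<exists>\<F>. finite \<F> \<and> (\<forall>F\<in>\<F>. polytope F \<and> aff_dim F = int DIM('a) - 1) \<and>
          frontier \<Omega> = \<Union>\<F>)"


section \<open>Lebesgue and Sobolev spaces\<close>

text \<open>Elements of the function spaces are everywhere-defined functions; only their values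
  almost everywhere on the relevant set matter.\<close>

definition in_L2 :: "'a::euclidean_space set \<Rightarrow> ('a \<Rightarrow> real) \<Rightarrow> bool" where
  "in_L2 S f \<longleftrightarrow> f \<in> borel_measurable (lebesgue_on S) \<and> integrable (lebesgue_on S) (\<lambda>x. (f x)\<^sup>2)"

definition in_Linf :: "'a::euclidean_space set \<Rightarrow> ('a \<Rightarrow> real) \<Rightarrow> bool" where
  "in_Linf S f \<longleftrightarrow> f \<in> borel_measurable (lebesgue_on S) \<and> (\<exists>M. AE x in lebesgue_on S. \<bar>f x\<bar> \<le> M)"

definition l2_inner ::
  "'a::euclidean_space set \<Rightarrow> ('a \<Rightarrow> 'b::real_inner) \<Rightarrow> ('a \<Rightarrow> 'b) \<Rightarrow> real" where
  "l2_inner S f g = (LINT x|lebesgue_on S. f x \<bullet> g x)"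

definition l2_norm :: "'a::euclidean_space set \<Rightarrow> ('a \<Rightarrow> 'b::real_inner) \<Rightarrow> real" where
  "l2_norm S f = sqrt (l2_inner S f f)"

definition linf_norm :: "'a::euclidean_space set \<Rightarrow> ('a \<Rightarrow> 'a) \<Rightarrow> real" where
  "linf_norm S b = real_of_ereal (esssup (lebesgue_on S) (\<lambda>x. ereal (norm (b x))))"

text \<open>k-fold continuous differentiability; the directional derivative along a basis vector
  is the corresponding partial derivative.\<close>

primrec Ck :: "nat \<Rightarrow> ('a::euclidean_space \<Rightarrow> real) \<Rightarrow> bool" where
  "Ck 0 f \<longleftrightarrow> continuous_on UNIV f"
| "Ck (Suc k) f \<longleftrightarrow>
     (\<forall>x. f differentiable (at x)) \<and> (\<forall>i\<in>Basis. Ck k (\<lambda>x. frechet_derivative f (at x) i))"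

definition test_function :: "'a::euclidean_space set \<Rightarrow> ('a \<Rightarrow> real) \<Rightarrow> bool" where
  "test_function \<Omega> \<phi> \<longleftrightarrow>
     (\<forall>k. Ck k \<phi>) \<and> compact (closure {x. \<phi> x \<noteq> 0}) \<and> closure {x. \<phi> x \<noteq> 0} \<subseteq> \<Omega>"

definition loc_integrable :: "'a::euclidean_space set \<Rightarrow> ('a \<Rightarrow> real) \<Rightarrow> bool" where
  "loc_integrable \<Omega> f \<longleftrightarrow> (\<forall>K. compact K \<and> K \<subseteq> \<Omega> \<longrightarrow> set_integrable lebesgue K f)"

definition has_weak_deriv ::
  "'a::euclidean_space set \<Rightarrow> 'a \<Rightarrow> ('a \<Rightarrow> real) \<Rightarrow> ('a \<Rightarrow> real) \<Rightarrow> bool" where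
  "has_weak_deriv \<Omega> i f g \<longleftrightarrow> loc_integrable \<Omega> f \<and> loc_integrable \<Omega> g \<and>
     (\<forall>\<phi>. test_function \<Omega> \<phi> \<longrightarrow>
        (LINT x|lebesgue_on \<Omega>. f x * frechet_derivative \<phi> (at x) i)
        = - (LINT x|lebesgue_on \<Omega>. g x * \<phi> x))"

text \<open>The choice is irrelevant: for open sets weak derivatives are unique almost everywhere.\<close>

definition weak_deriv ::
  "'a::euclidean_space set \<Rightarrow> 'a \<Rightarrow> ('a \<Rightarrow> real) \<Rightarrow> 'a \<Rightarrow> real" where
  "weak_deriv \<Omega> i f = (SOME g. has_weak_deriv \<Omega> i f g)"

definition wgrad :: "'a::euclidean_space set \<Rightarrow> ('a \<Rightarrow> real) \<Rightarrow> 'a \<Rightarrow> 'a" where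
  "wgrad \<Omega> f x = (\<Sum>i\<in>Basis. weak_deriv \<Omega> i f x *\<^sub>R i)"

definition wdiv :: "'a::euclidean_space set \<Rightarrow> ('a \<Rightarrow> 'a) \<Rightarrow> 'a \<Rightarrow> real" where
  "wdiv \<Omega> b x = (\<Sum>i\<in>Basis. weak_deriv \<Omega> i (\<lambda>y. b y \<bullet> i) x)"

definition wlaplace :: "'a::euclidean_space set \<Rightarrow> ('a \<Rightarrow> real) \<Rightarrow> 'a \<Rightarrow> real" where
  "wlaplace \<Omega> f x = (\<Sum>i\<in>Basis. weak_deriv \<Omega> i (weak_deriv \<Omega> i f) x)"

definition in_W1inf :: "'a::euclidean_space set \<Rightarrow> ('a \<Rightarrow> real) \<Rightarrow> bool" where
  "in_W1inf \<Omega> f \<longleftrightarrow> in_Linf \<Omega> f \<and> (\<forall>i\<in>Basis. \<exists>g. in_Linf \<Omega> g \<and> has_weak_deriv \<Omega> i f g)"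

definition in_H1 :: "'a::euclidean_space set \<Rightarrow> ('a \<Rightarrow> real) \<Rightarrow> bool" where
  "in_H1 \<Omega> f \<longleftrightarrow> in_L2 \<Omega> f \<and> (\<forall>i\<in>Basis. \<exists>g. in_L2 \<Omega> g \<and> has_weak_deriv \<Omega> i f g)"

definition in_H2 :: "'a::euclidean_space set \<Rightarrow> ('a \<Rightarrow> real) \<Rightarrow> bool" where
  "in_H2 \<Omega> f \<longleftrightarrow> in_H1 \<Omega> f \<and> (\<forall>i\<in>Basis. in_H1 \<Omega> (weak_deriv \<Omega> i f))"

text \<open>For a function on \<open>\<Omega>\<close>, its \<open>H\<^sup>1\<close> seminorm and norm over a subset \<open>S\<close>
  (\<open>S\<close> will be \<open>\<Omega>\<close> or a mesh element).\<close>

definition h1_seminorm :: "'a::euclidean_space set \<Rightarrow> 'a set \<Rightarrow> ('a \<Rightarrow> real) \<Rightarrow> real" where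
  "h1_seminorm \<Omega> S v = l2_norm S (wgrad \<Omega> v)"

definition h1_norm :: "'a::euclidean_space set \<Rightarrow> 'a set \<Rightarrow> ('a \<Rightarrow> real) \<Rightarrow> real" where
  "h1_norm \<Omega> S v = sqrt ((l2_norm S v)\<^sup>2 + (h1_seminorm \<Omega> S v)\<^sup>2)"

definition h2_seminorm :: "'a::euclidean_space set \<Rightarrow> ('a \<Rightarrow> real) \<Rightarrow> real" where
  "h2_seminorm \<Omega> v =
     sqrt (\<Sum>i\<in>Basis. \<Sum>j\<in>Basis. (l2_norm \<Omega> (weak_deriv \<Omega> j (weak_deriv \<Omega> i v)))\<^sup>2)"

definition in_H10 :: "'a::euclidean_space set \<Rightarrow> ('a \<Rightarrow> real) \<Rightarrow> bool" where
  "in_H10 \<Omega> v \<longleftrightarrow> in_H1 \<Omega> v \<and>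
     (\<forall>e>0. \<exists>\<phi>. test_function \<Omega> \<phi> \<and> h1_norm \<Omega> \<Omega> (\<lambda>x. v x - \<phi> x) < e)"


section \<open>Bilinear form and energy norm\<close>

definition B_form ::
  "'a::euclidean_space set \<Rightarrow> real \<Rightarrow> ('a \<Rightarrow> 'a) \<Rightarrow> real \<Rightarrow> ('a \<Rightarrow> real) \<Rightarrow> ('a \<Rightarrow> real) \<Rightarrow> real" where
  "B_form \<Omega> \<epsilon> \<beta> \<sigma> w v =
     \<epsilon> * l2_inner \<Omega> (wgrad \<Omega> w) (wgrad \<Omega> v)
     + l2_inner \<Omega> (\<lambda>x. \<beta> x \<bullet> wgrad \<Omega> w x) v + \<sigma> * l2_inner \<Omega> w v"

definition energy_norm ::
  "'a::euclidean_space set \<Rightarrow> real \<Rightarrow> real \<Rightarrow> ('a \<Rightarrow> real) \<Rightarrow> real" where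
  "energy_norm \<Omega> \<epsilon> \<sigma> v = sqrt (\<epsilon> * (h1_seminorm \<Omega> \<Omega> v)\<^sup>2 + \<sigma> * (l2_norm \<Omega> v)\<^sup>2)"


section \<open>Meshes\<close>

text \<open>Elements are closed simplices; \<^const>\<open>triangulation\<close> says that any two of them meet in a
  common (possibly empty) face.\<close>

definition conforming_mesh :: "'a::euclidean_space set \<Rightarrow> 'a set set \<Rightarrow> bool" where
  "conforming_mesh \<Omega> \<T> \<longleftrightarrow>
     triangulation \<T> \<and> (\<forall>T\<in>\<T>. int DIM('a) simplex T) \<and> \<Union>\<T> = closure \<Omega>"

definition shape_regular :: "'a::euclidean_space set set set \<Rightarrow> bool" where
  "shape_regular \<M> \<longleftrightarrow>
     (\<exists>\<rho>>0. \<forall>\<T>\<in>\<M>. \<forall>T\<in>\<T>. \<exists>x r. r > 0 \<and> cball x r \<subseteq> T \<and> diameter T \<le> \<rho> * r)"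

definition mesh_size :: "'a::euclidean_space set set \<Rightarrow> real" where
  "mesh_size \<T> = Max (diameter ` \<T>)"

definition vertices :: "'a::euclidean_space set \<Rightarrow> 'a set" where
  "vertices T = {p. p extreme_point_of T}"

text \<open>For a nondegenerate simplex \<open>T\<close> the affine coefficients of \<open>x\<close> with respect to the
  vertices exist and are unique, also for \<open>x\<close> outside \<open>T\<close>.\<close>

definition barycentric :: "'a::euclidean_space set \<Rightarrow> 'a \<Rightarrow> 'a \<Rightarrow> real" where
  "barycentric T p x =
     (THE t. \<exists>c. (\<Sum>q\<in>vertices T. c q) = 1 \<and> (\<Sum>q\<in>vertices T. c q *\<^sub>R q) = x \<and> t = c p)"

definition bubble :: "'a::euclidean_space set \<Rightarrow> 'a \<Rightarrow> real" where
  "bubble T x = (if x \<in> T then \<Prod>p\<in>vertices T. barycentric T p x else 0)"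


section \<open>Discrete spaces\<close>

text \<open>Discrete functions are represented by their continuous representative on the closure of
  the domain, extended by zero; this makes the sum of the two spaces below direct as a
  pointwise sum.\<close>

definition Vh0 :: "'a::euclidean_space set \<Rightarrow> 'a set set \<Rightarrow> ('a \<Rightarrow> real) set" where
  "Vh0 \<Omega> \<T> = {v. in_H10 \<Omega> v \<and> (\<forall>T\<in>\<T>. \<exists>a b. \<forall>x\<in>T. v x = a \<bullet> x + b) \<and>
                 (\<forall>x. x \<notin> closure \<Omega> \<longrightarrow> v x = 0)}"

definition Vb :: "'a::euclidean_space set set \<Rightarrow> ('a \<Rightarrow> real) set" where
  "Vb \<T> = {v. \<exists>c. v = (\<lambda>x. \<Sum>T\<in>\<T>. c T * bubble T x)}"

definition Vhb0 :: "'a::euclidean_space set \<Rightarrow> 'a set set \<Rightarrow> ('a \<Rightarrow> real) set" where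
  "Vhb0 \<Omega> \<T> = {v. \<exists>v1\<in>Vh0 \<Omega> \<T>. \<exists>v2\<in>Vb \<T>. v = (\<lambda>x. v1 x + v2 x)}"

definition kappa ::
  "'a::euclidean_space set \<Rightarrow> 'a set set \<Rightarrow> ('a \<Rightarrow> real) \<Rightarrow> 'a \<Rightarrow> real" where
  "kappa \<Omega> \<T> v = (THE v1. v1 \<in> Vh0 \<Omega> \<T> \<and> (\<exists>v2\<in>Vb \<T>. v = (\<lambda>x. v1 x + v2 x)))"

text \<open>\<open>w\<close> is the nodal Lagrange interpolant of \<open>u\<close>.  Nodal values are those of the continuous
  representative of \<open>u\<close> (which exists for \<open>H\<^sup>2\<close> functions in dimension at most 3).\<close>

definition nodal_interpolant ::
  "'a::euclidean_space set \<Rightarrow> 'a set set \<Rightarrow> ('a \<Rightarrow> real) \<Rightarrow> ('a \<Rightarrow> real) \<Rightarrow> bool" where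
  "nodal_interpolant \<Omega> \<T> u w \<longleftrightarrow> w \<in> Vh0 \<Omega> \<T> \<and>
     (\<exists>u'. continuous_on (closure \<Omega>) u' \<and> (AE x in lebesgue_on \<Omega>. u' x = u x) \<and>
           (\<forall>T\<in>\<T>. \<forall>p\<in>vertices T. w p = u' p))"


section \<open>Dynamic diffusion\<close>

definition residual ::
  "'a::euclidean_space set \<Rightarrow> ('a \<Rightarrow> 'a) \<Rightarrow> real \<Rightarrow> ('a \<Rightarrow> real) \<Rightarrow> ('a \<Rightarrow> real) \<Rightarrow> 'a \<Rightarrow> real" where
  "residual \<Omega> \<beta> \<sigma> f v x = \<beta> x \<bullet> wgrad \<Omega> v x + \<sigma> * v x - f x"

definition peclet :: "real \<Rightarrow> ('a::euclidean_space \<Rightarrow> 'a) \<Rightarrow> 'a set \<Rightarrow> real" where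
  "peclet \<epsilon> \<beta> T = linf_norm T \<beta> * diameter T / (2 * \<epsilon>)"

definition chi :: "real \<Rightarrow> ('a::euclidean_space \<Rightarrow> 'a) \<Rightarrow> 'a set \<Rightarrow> real" where
  "chi \<epsilon> \<beta> T = (if peclet \<epsilon> \<beta> T > 1 then 1 else 0)"

definition N_loc :: "'a::euclidean_space set \<Rightarrow> real \<Rightarrow> 'a set \<Rightarrow> ('a \<Rightarrow> real) \<Rightarrow> real" where
  "N_loc \<Omega> \<sigma> T v = (if \<sigma> > 0 then h1_norm \<Omega> T v else h1_seminorm \<Omega> T v)"

definition xi ::
  "'a::euclidean_space set \<Rightarrow> real \<Rightarrow> ('a \<Rightarrow> 'a) \<Rightarrow> real \<Rightarrow> ('a \<Rightarrow> real) \<Rightarrow> real \<Rightarrow> (real \<Rightarrow> real) \<Rightarrow>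
   'a set \<Rightarrow> ('a \<Rightarrow> real) \<Rightarrow> real" where
  "xi \<Omega> \<epsilon> \<beta> \<sigma> f \<tau> \<mu> T v =
     chi \<epsilon> \<beta> T * \<mu> (diameter T) * (l2_norm T (residual \<Omega> \<beta> \<sigma> f v) / (N_loc \<Omega> \<sigma> T v + \<tau>))"

definition D_form ::
  "'a::euclidean_space set \<Rightarrow> real \<Rightarrow> ('a \<Rightarrow> 'a) \<Rightarrow> real \<Rightarrow> ('a \<Rightarrow> real) \<Rightarrow> real \<Rightarrow> (real \<Rightarrow> real) \<Rightarrow>
   'a set set \<Rightarrow> ('a \<Rightarrow> real) \<Rightarrow> ('a \<Rightarrow> real) \<Rightarrow> ('a \<Rightarrow> real) \<Rightarrow> real" where
  "D_form \<Omega> \<epsilon> \<beta> \<sigma> f \<tau> \<mu> \<T> z u v =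
     (\<Sum>T\<in>\<T>. xi \<Omega> \<epsilon> \<beta> \<sigma> f \<tau> \<mu> T (kappa \<Omega> \<T> z) * l2_inner T (wgrad \<Omega> u) (wgrad \<Omega> v))"

definition dd_solution ::
  "'a::euclidean_space set \<Rightarrow> real \<Rightarrow> ('a \<Rightarrow> 'a) \<Rightarrow> real \<Rightarrow> ('a \<Rightarrow> real) \<Rightarrow> real \<Rightarrow> (real \<Rightarrow> real) \<Rightarrow>
   'a set set \<Rightarrow> ('a \<Rightarrow> real) \<Rightarrow> bool" where
  "dd_solution \<Omega> \<epsilon> \<beta> \<sigma> f \<tau> \<mu> \<T> u \<longleftrightarrow> u \<in> Vhb0 \<Omega> \<T> \<and>
     (\<forall>v\<in>Vhb0 \<Omega> \<T>. B_form \<Omega> \<epsilon> \<beta> \<sigma> u v + D_form \<Omega> \<epsilon> \<beta> \<sigma> f \<tau> \<mu> \<T> u u v = l2_inner \<Omega> f v)"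

end

theory Submission
  imports Defs
begin

text \<open>
The argument rests on two observations.

First, \<open>\<kappa>\<^sub>h\<close> is stable in the energy norm. On an element \<open>T\<close> a piecewise affine function has a
constant gradient, and the gradient of a bubble integrates to zero because the bubble vanishes on
the boundary of \<open>T\<close>. The gradients of the two components are therefore orthogonal in \<open>L\<^sup>2(\<Omega>)\<close>, and
removing the bubble component can only decrease the \<open>H\<^sup>1\<close> seminorm; the \<open>L\<^sup>2\<close> part of the energy norm is
controlled by the assumed local stability, summed over the elements. Since \<open>\<kappa>\<^sub>h\<close> reproduces the
interpolant, \<open>u - u\<^sub>h = (u - \<Pi>\<^sub>h u) - \<kappa>\<^sub>h (u\<^sub>h\<^sub>b - \<Pi>\<^sub>h u)\<close>, and the first inequality follows from the
triangle inequality (\<open>kappa_error_le\<close>).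

Secondly, the artificial diffusion is of second order in \<open>h\<close> for fixed data. It is switched on only
where the local Peclet number exceeds one, so the switch is bounded by that number, which is itself
of order \<open>h\<^sub>T\<close>; together with \<open>\<mu>(h\<^sub>T) \<le> C\<^sub>\<mu> h\<^sub>T\<close> and the uniform bound on the normalised residual this
gives \<open>\<xi>\<^sub>T \<le> X h\<^sub>T\<^sup>2\<close> (\<open>xi_bounds\<close>). The rest is an energy argument: with \<open>e = u\<^sub>h\<^sub>b - \<Pi>\<^sub>h u\<close> and
\<open>\<eta> = u - \<Pi>\<^sub>h u\<close>, coercivity and the two problems give
\<open>\<parallel>e\<parallel>\<^sub>E\<^sup>2 + D\<^sub>h(u\<^sub>h\<^sub>b; u\<^sub>h\<^sub>b, e) = B(\<eta>, e)\<close>. Young's inequality bounds the diffusion term from below by half of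
\<open>A\<^sub>h\<close> minus a term of size \<open>X h\<^sup>2 |\<Pi>\<^sub>h u|\<^sub>1\<^sup>2\<close>, and the convection term in \<open>B(\<eta>, e)\<close> is moved onto \<open>e\<close>, so that
it is bounded by \<open>\<parallel>\<eta>\<parallel>\<^sub>0 |e|\<^sub>1\<close>, whose second factor the diffusive part of the energy norm absorbs. The outcome is
\<open>\<parallel>e\<parallel>\<^sub>E\<^sup>2 + A\<^sub>h \<le> K h\<^sup>2\<close> (\<open>dd_energy_estimate\<close>), from which both rates follow.

Underneath lies some Sobolev theory. Weak derivatives are chosen by Hilbert's operator, so all
calculus with them needs their uniqueness almost everywhere; this is the fundamental lemma of the
calculus of variations, proved with explicit smooth bumps built from \<open>exp (- 1 / t)\<close>. Integration by
parts for smooth functions of compact support comes from translation invariance of Lebesgue measure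
and dominated convergence, and it passes to \<open>H\<^sub>0\<^sup>1\<close> by density. Bubbles lie in \<open>H\<^sub>0\<^sup>1\<close> because cutting off
each barycentric coordinate smoothly near zero yields test functions in the interior of the element
that converge to the bubble in \<open>H\<^sup>1\<close>. That these interiors lie in \<open>\<Omega>\<close>, and not merely in its closure, is
where the Lipschitz boundary enters.
\<close>

section \<open>Smooth functions and test functions\<close>

lemma Ck_Suc_imp: "Ck (Suc k) f \<Longrightarrow> Ck k f"
proof (induction k arbitrary: f)
  case 0
  then show ?case
    by (auto intro!: differentiable_imp_continuous_within simp: continuous_on_eq_continuous_within)
qed auto

lemma Ck_const: "Ck k (\<lambda>x::'a::euclidean_space. c)"
proof (induction k arbitrary: c)
  case (Suc k)
  have "frechet_derivative (\<lambda>x::'a. c) (at x) = (\<lambda>h. 0)" for x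
    by (rule frechet_derivative_at[symmetric]) (rule has_derivative_const)
  then show ?case using Suc by simp
qed auto

lemma Ck_inner: "Ck k (\<lambda>x::'a::euclidean_space. a \<bullet> x)"
proof (cases k)
  case (Suc n)
  have "frechet_derivative ((\<bullet>) a) (at x) = (\<lambda>h. a \<bullet> h)" for x
    by (rule frechet_derivative_at[symmetric]) (rule bounded_linear_imp_has_derivative[OF bounded_linear_inner_right])
  then show ?thesis using Suc by (simp add: Ck_const)
qed (auto intro!: continuous_intros)

lemma Ck_add:
  "Ck k f \<Longrightarrow> Ck k g \<Longrightarrow> Ck k (\<lambda>x::'a::euclidean_space. f x + g x)"
proof (induction k arbitrary: f g)
  case (Suc k)
  have "frechet_derivative (\<lambda>x. f x + g x) (at x)
      = (\<lambda>h. frechet_derivative f (at x) h + frechet_derivative g (at x) h)" for x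
    using Suc.prems
    by (intro frechet_derivative_at[symmetric] has_derivative_add)
       (auto simp: frechet_derivative_works[symmetric])
  then show ?case using Suc by auto
qed (auto intro!: continuous_intros)

lemma frechet_derivative_mult:
  fixes f g :: "'a::euclidean_space \<Rightarrow> real"
  assumes "f differentiable at x" "g differentiable at x"
  shows "frechet_derivative (\<lambda>x. f x * g x) (at x) h
       = f x * frechet_derivative g (at x) h + frechet_derivative f (at x) h * g x"
proof -
  have "((\<lambda>x. f x * g x) has_derivative
      (\<lambda>h. f x * frechet_derivative g (at x) h + frechet_derivative f (at x) h * g x)) (at x)"
    using assms by (intro has_derivative_mult) (auto simp: frechet_derivative_works[symmetric])
  from frechet_derivative_at[OF this] show ?thesis by metis
qed

lemma Ck_mult:
  "Ck k f \<Longrightarrow> Ck k g \<Longrightarrow> Ck k (\<lambda>x::'a::euclidean_space. f x * g x)"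
proof (induction k arbitrary: f g)
  case (Suc k)
  have "Ck k f" "Ck k g" using Suc.prems Ck_Suc_imp by auto
  then show ?case using Suc
    by (auto simp: frechet_derivative_mult intro!: Ck_add)
qed (auto intro!: continuous_intros)

lemma Ck_prod:
  "(\<And>i. i \<in> A \<Longrightarrow> Ck k (f i)) \<Longrightarrow> Ck k (\<lambda>x::'a::euclidean_space. \<Prod>i\<in>A. f i x)"
  by (induction A rule: infinite_finite_induct) (auto intro: Ck_mult Ck_const)

text \<open>Composition with a smooth function of one variable. The sequence \<open>H\<close> lists all its derivatives, so
that the induction on \<open>k\<close> may pass from \<open>H n\<close> to \<open>H (Suc n)\<close>.\<close>

lemma Ck_compose:
  assumes H: "\<And>n t. (H n has_real_derivative H (Suc n) t) (at t)"
  shows "Ck k f \<Longrightarrow> Ck k (\<lambda>x::'a::euclidean_space. H n (f x))"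
proof (induction k arbitrary: n)
  case 0
  have "continuous_on UNIV (H n)"
    using H by (meson DERIV_isCont continuous_at_imp_continuous_on)
  then show ?case using 0 by (auto intro: continuous_on_compose2)
next
  case (Suc k)
  have d: "((\<lambda>x. H n (f x)) has_derivative (\<lambda>h. H (Suc n) (f x) * frechet_derivative f (at x) h)) (at x)"
    for x
  proof -
    have "f differentiable at x" using Suc.prems by auto
    then have "(f has_derivative frechet_derivative f (at x)) (at x)"
      by (simp add: frechet_derivative_works[symmetric])
    from has_derivative_compose[OF this H[THEN has_field_derivative_imp_has_derivative]]
    show ?thesis .
  qed
  have "frechet_derivative (\<lambda>x. H n (f x)) (at x)
      = (\<lambda>h. H (Suc n) (f x) * frechet_derivative f (at x) h)" for x
    by (rule frechet_derivative_at[OF d, symmetric])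
  moreover have "Ck k f" using Suc.prems Ck_Suc_imp by auto
  ultimately show ?case using Suc d
    by (auto simp: differentiable_def intro!: Ck_mult)
qed

text \<open>The function \<open>exp (- 1 / t)\<close> for \<open>t > 0\<close>, extended by zero, is smooth but not analytic at the origin.
On the positive axis its \<open>n\<close>-th derivative is a polynomial in \<open>1 / t\<close> times \<open>exp (- 1 / t)\<close>;
the recursion is the chain rule applied to that form, and \<open>flat_exp n\<close> is the derivative itself.\<close>

primrec flat_exp_poly :: "nat \<Rightarrow> real poly" where
  "flat_exp_poly 0 = 1"
| "flat_exp_poly (Suc n) = [:0, 0, 1:] * (flat_exp_poly n - pderiv (flat_exp_poly n))"

definition flat_exp :: "nat \<Rightarrow> real \<Rightarrow> real" where
  "flat_exp n t = (if t > 0 then poly (flat_exp_poly n) (1 / t) * exp (- (1 / t)) else 0)"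

lemma poly_exp_decay: "((\<lambda>y. poly (p :: real poly) y * exp (- y)) \<longlongrightarrow> 0) at_top"
proof (induction p)
  case (pCons a p)
  have e: "((\<lambda>y::real. exp (- y)) \<longlongrightarrow> 0) at_top"
    by (rule filterlim_compose[OF exp_at_bot filterlim_uminus_at_bot_at_top])
  have *: "((\<lambda>y. poly p y * y * exp (- y)) \<longlongrightarrow> 0) at_top"
  proof -
    have "((\<lambda>y::real. \<Sum>i\<le>degree p. coeff p i * (y ^ Suc i / exp y)) \<longlongrightarrow> (\<Sum>i\<le>degree p. coeff p i * 0)) at_top"
      by (intro tendsto_intros tendsto_power_div_exp_0)
    moreover have "(\<Sum>i\<le>degree p. coeff p i * (y ^ Suc i / exp y)) = poly p y * y * exp (- y)" for y :: real
      unfolding poly_altdef sum_distrib_right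
      by (intro sum.cong refl) (simp add: exp_minus field_simps)
    ultimately show ?thesis by simp
  qed
  have "((\<lambda>y. a * exp (- y) + poly p y * y * exp (- y)) \<longlongrightarrow> a * 0 + 0) at_top"
    by (intro tendsto_intros e *)
  then show ?case by (simp add: algebra_simps)
qed simp

lemma poly_exp_decay_at_0:
  "((\<lambda>t. poly (p :: real poly) (1 / t) * exp (- (1 / t))) \<longlongrightarrow> 0) (at_right 0)"
  using filterlim_compose[OF poly_exp_decay filterlim_inverse_at_top_right] by (simp add: inverse_eq_divide)

lemma flat_exp_deriv: "(flat_exp n has_real_derivative flat_exp (Suc n) t) (at t)"
proof -
  consider "t < 0" | "t = 0" | "t > 0" by linarith
  then show ?thesis
  proof cases
    case 1
    have "((\<lambda>_. 0) has_real_derivative 0) (at t)" by simp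
    then have "(flat_exp n has_real_derivative 0) (at t)"
      by (rule has_field_derivative_transform_within_open[of _ _ _ "{..<0}"])
         (use 1 in \<open>auto simp: flat_exp_def\<close>)
    then show ?thesis using 1 by (simp add: flat_exp_def)
  next
    case 2
    have "((\<lambda>h. flat_exp n h / h) \<longlongrightarrow> 0) (at 0)"
    proof (rule filterlim_split_at)
      show "((\<lambda>h. flat_exp n h / h) \<longlongrightarrow> 0) (at_left 0)"
        by (rule tendsto_eventually) (auto simp: flat_exp_def eventually_at_filter)
      have "((\<lambda>h. poly ([:0, 1:] * flat_exp_poly n) (1 / h) * exp (- (1 / h))) \<longlongrightarrow> 0) (at_right 0)"
        by (rule poly_exp_decay_at_0)
      then show "((\<lambda>h. flat_exp n h / h) \<longlongrightarrow> 0) (at_right 0)"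
        by (rule tendsto_cong[THEN iffD1, rotated])
           (auto simp: flat_exp_def eventually_at_filter)
    qed
    then show ?thesis using 2 by (simp add: DERIV_def flat_exp_def)
  next
    case 3
    have "((\<lambda>t. poly (flat_exp_poly n) (1 / t) * exp (- (1 / t))) has_real_derivative
        poly (flat_exp_poly (Suc n)) (1 / t) * exp (- (1 / t))) (at t)"
    proof -
      have i: "((\<lambda>t. 1 / t) has_real_derivative - ((1 / t) ^ 2)) (at t)"
        using 3 by (auto intro!: derivative_eq_intros simp: power2_eq_square)
      have "((\<lambda>t. poly (flat_exp_poly n) (1 / t)) has_real_derivative
          poly (pderiv (flat_exp_poly n)) (1 / t) * (- ((1 / t) ^ 2))) (at t)"
        by (rule DERIV_chain2[OF poly_DERIV i])
      then have "((\<lambda>t. poly (flat_exp_poly n) (1 / t) * exp (- (1 / t))) has_real_derivative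
         poly (pderiv (flat_exp_poly n)) (1 / t) * (- ((1 / t) ^ 2)) * exp (- (1 / t))
         + exp (- (1 / t)) * (1 / t) ^ 2 * poly (flat_exp_poly n) (1 / t)) (at t)"
        by (rule DERIV_mult) (rule derivative_eq_intros i refl | simp)+
      then show ?thesis by (simp add: algebra_simps power2_eq_square)
    qed
    then have "(flat_exp n has_real_derivative poly (flat_exp_poly (Suc n)) (1 / t) * exp (- (1 / t))) (at t)"
      by (rule has_field_derivative_transform_within_open[of _ _ _ "{0<..}"])
         (use 3 in \<open>auto simp: flat_exp_def\<close>)
    then show ?thesis using 3 by (simp add: flat_exp_def)
  qed
qed

lemma Ck_flat_exp: "Ck k f \<Longrightarrow> Ck k (\<lambda>x::'a::euclidean_space. flat_exp n (f x))"
  by (rule Ck_compose[of flat_exp]) (rule flat_exp_deriv)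

lemma test_functionD:
  assumes "test_function \<Omega> \<phi>"
  shows "\<phi> differentiable at x" "i \<in> Basis \<Longrightarrow> Ck k (\<lambda>x. frechet_derivative \<phi> (at x) i)"
    "continuous_on UNIV \<phi>" "i \<in> Basis \<Longrightarrow> continuous_on UNIV (\<lambda>x. frechet_derivative \<phi> (at x) i)"
proof -
  have k: "Ck k \<phi>" for k using assms by (simp add: test_function_def)
  from k[of 1] show "\<phi> differentiable at x" by simp
  show c: "i \<in> Basis \<Longrightarrow> Ck k (\<lambda>x. frechet_derivative \<phi> (at x) i)" for i k using k[of "Suc k"] by simp
  show "continuous_on UNIV \<phi>" using k[of 0] by simp
  show "i \<in> Basis \<Longrightarrow> continuous_on UNIV (\<lambda>x. frechet_derivative \<phi> (at x) i)" using c[of i 0] by simp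
qed

text \<open>The support in the definition of a test function is a closure; in applications a compact set
outside of which the function vanishes is at hand instead.\<close>

lemma test_function_zero_outside:
  assumes "\<And>x. x \<notin> S \<Longrightarrow> \<phi> x = (0::real)" "compact S" "S \<subseteq> \<Omega>" "\<And>k. Ck k \<phi>"
  shows "test_function \<Omega> \<phi>"
proof -
  have "closure {x. \<phi> x \<noteq> 0} \<subseteq> S"
    using assms by (intro closure_minimal) (auto intro: compact_imp_closed)
  moreover from this have "compact (closure {x. \<phi> x \<noteq> 0})"
    using compact_Int_closed[OF assms(2) closed_closure[of "{x. \<phi> x \<noteq> 0}"]] by (simp add: Int_absorb1)
  ultimately show ?thesis using assms by (auto simp: test_function_def)
qed

lemma test_function_support:
  assumes "test_function \<Omega> \<phi>"
  obtains K where "compact K" "K \<subseteq> \<Omega>" "\<And>x. x \<notin> K \<Longrightarrow> \<phi> x = 0"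
    "\<And>x h. x \<notin> K \<Longrightarrow> frechet_derivative \<phi> (at x) h = 0"
proof -
  define K where "K = closure {x. \<phi> x \<noteq> 0}"
  have K: "compact K" "K \<subseteq> \<Omega>" using assms by (auto simp: test_function_def K_def)
  have z: "\<phi> x = 0" if "x \<notin> K" for x
  proof (rule ccontr)
    assume "\<phi> x \<noteq> 0"
    then have "x \<in> K" unfolding K_def by (intro subsetD[OF closure_subset]) simp
    with that show False ..
  qed
  have "frechet_derivative \<phi> (at x) h = 0" if "x \<notin> K" for x h
  proof -
    have "((\<lambda>_. 0) has_derivative (\<lambda>h. 0)) (at x)" by (rule has_derivative_const)
    then have "(\<phi> has_derivative (\<lambda>h. 0)) (at x)"
    proof (rule has_derivative_transform_within_open)
      show "open (- K)" "x \<in> - K" using that K by (auto intro: compact_imp_closed)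
    qed (simp add: z)
    from frechet_derivative_at[OF this] show ?thesis by metis
  qed
  from that[OF K z this] show thesis .
qed

lemma test_function_mult:
  assumes "test_function \<Omega> \<phi>" "test_function \<Omega> \<psi>"
  shows "test_function \<Omega> (\<lambda>x. \<phi> x * \<psi> x)"
proof -
  obtain K where "compact K" "K \<subseteq> \<Omega>" "\<And>x. x \<notin> K \<Longrightarrow> \<phi> x = 0"
    "\<And>x h. x \<notin> K \<Longrightarrow> frechet_derivative \<phi> (at x) h = 0"
    by (rule test_function_support[OF assms(1)]) (rule that)
  then show ?thesis using assms
    by (intro test_function_zero_outside[of K]) (auto simp: test_function_def intro: Ck_mult)
qed

lemma test_function_deriv:
  assumes "test_function \<Omega> \<phi>" "i \<in> Basis"
  shows "test_function \<Omega> (\<lambda>x. frechet_derivative \<phi> (at x) i)"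
proof -
  obtain K where "compact K" "K \<subseteq> \<Omega>" "\<And>x. x \<notin> K \<Longrightarrow> \<phi> x = 0"
    "\<And>x h. x \<notin> K \<Longrightarrow> frechet_derivative \<phi> (at x) h = 0"
    by (rule test_function_support[OF assms(1)]) (rule that)
  then show ?thesis using test_functionD(2)[OF assms]
    by (intro test_function_zero_outside[of K]) auto
qed

lemma test_function_lincomb:
  assumes "test_function \<Omega> \<phi>" "test_function \<Omega> \<psi>"
  shows "test_function \<Omega> (\<lambda>x. a * \<phi> x + b * \<psi> x)"
proof -
  obtain K where K: "compact K" "K \<subseteq> \<Omega>" "\<And>x. x \<notin> K \<Longrightarrow> \<phi> x = 0"
    "\<And>x h. x \<notin> K \<Longrightarrow> frechet_derivative \<phi> (at x) h = 0"
    by (rule test_function_support[OF assms(1)]) (rule that)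
  obtain L where L: "compact L" "L \<subseteq> \<Omega>" "\<And>x. x \<notin> L \<Longrightarrow> \<psi> x = 0"
    "\<And>x h. x \<notin> L \<Longrightarrow> frechet_derivative \<psi> (at x) h = 0"
    by (rule test_function_support[OF assms(2)]) (rule that)
  from K L show ?thesis using assms
    by (intro test_function_zero_outside[of "K \<union> L"])
       (auto simp: test_function_def intro!: Ck_add Ck_mult Ck_const)
qed

lemma test_function_mono: "test_function S \<phi> \<Longrightarrow> S \<subseteq> \<Omega> \<Longrightarrow> test_function \<Omega> \<phi>"
  by (auto simp: test_function_def)


section \<open>Square-integrable functions\<close>

text \<open>One notion for scalar functions and for gradients, so that Cauchy-Schwarz and Minkowski are proved
only once.\<close>

definition square_integrable :: "'a::euclidean_space set \<Rightarrow> ('a \<Rightarrow> 'b::euclidean_space) \<Rightarrow> bool" where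
  "square_integrable S f \<longleftrightarrow>
     f \<in> borel_measurable (lebesgue_on S) \<and> integrable (lebesgue_on S) (\<lambda>x. (norm (f x))\<^sup>2)"

lemma in_L2_iff: "in_L2 S f \<longleftrightarrow> square_integrable S f"
  by (simp add: in_L2_def square_integrable_def)

lemma square_integrable_measurable [measurable_dest]:
  "square_integrable S f \<Longrightarrow> f \<in> borel_measurable (lebesgue_on S)"
  by (simp add: square_integrable_def)

lemma square_integrable_bound:
  fixes f :: "'a::euclidean_space \<Rightarrow> 'b::euclidean_space" and g :: "'a \<Rightarrow> 'c::euclidean_space"
  assumes "square_integrable S g" "f \<in> borel_measurable (lebesgue_on S)"
    and "AE x in lebesgue_on S. norm (f x) \<le> c * norm (g x)"
  shows "square_integrable S f"
  unfolding square_integrable_def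
proof
  have "integrable (lebesgue_on S) (\<lambda>x. c\<^sup>2 * (norm (g x))\<^sup>2)"
    using assms(1) by (simp add: square_integrable_def)
  then show "integrable (lebesgue_on S) (\<lambda>x. (norm (f x))\<^sup>2)"
  proof (rule Bochner_Integration.integrable_bound)
    show "AE x in lebesgue_on S. norm ((norm (f x))\<^sup>2) \<le> norm (c\<^sup>2 * (norm (g x))\<^sup>2)"
      using assms(3)
    proof eventually_elim
      case (elim x)
      from power_mono[OF elim, of 2] show ?case by (simp add: power_mult_distrib)
    qed
  qed (use assms(2) in measurable)
qed (rule assms)

lemma square_integrable_inner:
  fixes f g :: "'a::euclidean_space \<Rightarrow> 'b::euclidean_space"
  assumes "square_integrable S f" "square_integrable S g"
  shows "integrable (lebesgue_on S) (\<lambda>x. f x \<bullet> g x)"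
proof (rule Bochner_Integration.integrable_bound)
  show "integrable (lebesgue_on S) (\<lambda>x. (norm (f x))\<^sup>2 + (norm (g x))\<^sup>2)"
    using assms by (simp add: square_integrable_def)
  show "(\<lambda>x. f x \<bullet> g x) \<in> borel_measurable (lebesgue_on S)"
    using assms by (auto simp: square_integrable_def)
  show "AE x in lebesgue_on S. norm (f x \<bullet> g x) \<le> norm ((norm (f x))\<^sup>2 + (norm (g x))\<^sup>2)"
  proof (rule AE_I2)
    fix x
    have "\<bar>f x \<bullet> g x\<bar> \<le> norm (f x) * norm (g x)" by (rule Cauchy_Schwarz_ineq2)
    also have "\<dots> \<le> (norm (f x))\<^sup>2 + (norm (g x))\<^sup>2"
    proof -
      have "0 \<le> (norm (f x) - norm (g x))\<^sup>2" "0 \<le> norm (f x) * norm (g x)" by auto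
      then show ?thesis unfolding power2_diff by linarith
    qed
    finally show "norm (f x \<bullet> g x) \<le> norm ((norm (f x))\<^sup>2 + (norm (g x))\<^sup>2)" by simp
  qed
qed

lemma square_integrable_mult:
  fixes f g :: "'a::euclidean_space \<Rightarrow> real"
  assumes "square_integrable S f" "square_integrable S g"
  shows "integrable (lebesgue_on S) (\<lambda>x. f x * g x)"
  using square_integrable_inner[OF assms] by simp

lemma square_integrable_iff_self_inner:
  fixes f :: "'a::euclidean_space \<Rightarrow> 'b::euclidean_space"
  shows "square_integrable S f \<longleftrightarrow> f \<in> borel_measurable (lebesgue_on S)
    \<and> integrable (lebesgue_on S) (\<lambda>x. f x \<bullet> f x)"
  by (simp add: square_integrable_def power2_norm_eq_inner)

lemma square_integrable_lincomb:
  fixes f g :: "'a::euclidean_space \<Rightarrow> 'b::euclidean_space"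
  assumes "square_integrable S f" "square_integrable S g"
  shows "square_integrable S (\<lambda>x. a *\<^sub>R f x + b *\<^sub>R g x)"
  unfolding square_integrable_iff_self_inner
proof
  show "(\<lambda>x. a *\<^sub>R f x + b *\<^sub>R g x) \<in> borel_measurable (lebesgue_on S)"
    using assms by measurable
  have "integrable (lebesgue_on S) (\<lambda>x. a\<^sup>2 * (f x \<bullet> f x) + 2 * a * b * (f x \<bullet> g x) + b\<^sup>2 * (g x \<bullet> g x))"
    using assms by (intro Bochner_Integration.integrable_add integrable_mult_right square_integrable_inner)
  then show "integrable (lebesgue_on S) (\<lambda>x. (a *\<^sub>R f x + b *\<^sub>R g x) \<bullet> (a *\<^sub>R f x + b *\<^sub>R g x))"
    by (simp add: algebra_simps inner_commute power2_eq_square)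
qed

lemma square_integrable_diff:
  fixes f g :: "'a::euclidean_space \<Rightarrow> 'b::euclidean_space"
  shows "square_integrable S f \<Longrightarrow> square_integrable S g \<Longrightarrow> square_integrable S (\<lambda>x. f x - g x)"
  using square_integrable_lincomb[of S f g 1 "-1"] by simp

lemma square_integrable_scaleR:
  fixes f :: "'a::euclidean_space \<Rightarrow> 'b::euclidean_space"
  shows "square_integrable S f \<Longrightarrow> square_integrable S (\<lambda>x. c *\<^sub>R f x)"
  using square_integrable_lincomb[of S f f c 0] by simp

lemma square_integrable_cong_AE:
  fixes f g :: "'a::euclidean_space \<Rightarrow> 'b::euclidean_space"
  assumes "square_integrable S g" "f \<in> borel_measurable (lebesgue_on S)" "AE x in lebesgue_on S. f x = g x"
  shows "square_integrable S f"
  by (rule square_integrable_bound[OF assms(1,2), of 1]) (use assms(3) in auto)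

lemma square_integrable_components:
  fixes F :: "'a::euclidean_space \<Rightarrow> 'b::euclidean_space"
  shows "square_integrable S F \<longleftrightarrow> (\<forall>i\<in>Basis. square_integrable S (\<lambda>x. F x \<bullet> i))" (is "?L \<longleftrightarrow> ?R")
proof
  assume L: ?L
  show ?R
  proof
    fix i :: 'b assume "i \<in> Basis"
    then show "square_integrable S (\<lambda>x. F x \<bullet> i)"
      by (intro square_integrable_bound[OF L, of _ 1])
         (use L Basis_le_norm[OF \<open>i \<in> Basis\<close>] in auto)
  qed
next
  assume R: ?R
  have "F \<in> borel_measurable (lebesgue_on S)"
    using R by (subst borel_measurable_euclidean_space) auto
  moreover have "integrable (lebesgue_on S) (\<lambda>x. \<Sum>i\<in>Basis. (F x \<bullet> i) * (F x \<bullet> i))"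
    using R by (intro Bochner_Integration.integrable_sum square_integrable_mult) auto
  ultimately show ?L
    unfolding square_integrable_iff_self_inner by (subst euclidean_inner) auto
qed

lemma l2_inner_commute: "l2_inner S f g = l2_inner S g f"
  by (simp add: l2_inner_def inner_commute)

lemma l2_inner_self_nonneg: "0 \<le> l2_inner S f f"
  by (simp add: l2_inner_def)

lemma l2_norm_nonneg: "0 \<le> l2_norm S f"
  by (simp add: l2_norm_def l2_inner_self_nonneg)

lemma l2_norm_power2: "(l2_norm S f)\<^sup>2 = l2_inner S f f"
  by (simp add: l2_norm_def l2_inner_self_nonneg)

lemma l2_inner_lincomb_left:
  fixes f g h :: "'a::euclidean_space \<Rightarrow> 'b::euclidean_space"
  assumes "square_integrable S f" "square_integrable S g" "square_integrable S h"
  shows "l2_inner S (\<lambda>x. a *\<^sub>R f x + b *\<^sub>R g x) h = a * l2_inner S f h + b * l2_inner S g h"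
  using square_integrable_inner[OF assms(1,3)] square_integrable_inner[OF assms(2,3)]
  by (simp add: l2_inner_def inner_add_left)

lemma l2_inner_lincomb_right:
  fixes f g h :: "'a::euclidean_space \<Rightarrow> 'b::euclidean_space"
  assumes "square_integrable S f" "square_integrable S g" "square_integrable S h"
  shows "l2_inner S h (\<lambda>x. a *\<^sub>R f x + b *\<^sub>R g x) = a * l2_inner S h f + b * l2_inner S h g"
  using l2_inner_lincomb_left[OF assms] by (simp add: l2_inner_commute)

lemma l2_norm_lincomb:
  fixes f g :: "'a::euclidean_space \<Rightarrow> 'b::euclidean_space"
  assumes "square_integrable S f" "square_integrable S g"
  shows "(l2_norm S (\<lambda>x. a *\<^sub>R f x + b *\<^sub>R g x))\<^sup>2
    = a\<^sup>2 * (l2_norm S f)\<^sup>2 + 2 * a * b * l2_inner S f g + b\<^sup>2 * (l2_norm S g)\<^sup>2"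
  using assms unfolding l2_norm_power2
  by (simp add: l2_inner_lincomb_left l2_inner_lincomb_right square_integrable_lincomb
      l2_inner_commute[of S g f] algebra_simps power2_eq_square)

text \<open>The quadratic form \<open>\<parallel>s f + t g\<parallel>\<^sup>2\<close> in \<open>(s, t)\<close> is nonnegative, hence its discriminant has a sign.\<close>

lemma l2_Cauchy_Schwarz:
  fixes f g :: "'a::euclidean_space \<Rightarrow> 'b::euclidean_space"
  assumes "square_integrable S f" "square_integrable S g"
  shows "\<bar>l2_inner S f g\<bar> \<le> l2_norm S f * l2_norm S g"
proof -
  define A B C where "A = (l2_norm S f)\<^sup>2" and "B = l2_inner S f g" and "C = (l2_norm S g)\<^sup>2"
  \<comment> \<open>evaluated at \<open>(C, - B)\<close> if \<open>C \<noteq> 0\<close>; if \<open>C = 0\<close>, it is linear in \<open>t\<close>, which forces \<open>B = 0\<close>\<close>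
  have q: "0 \<le> s\<^sup>2 * A + 2 * s * t * B + t\<^sup>2 * C" for s t
    using l2_norm_lincomb[OF assms, of s t] unfolding A_def B_def C_def by (metis zero_le_power2)
  have "B\<^sup>2 \<le> A * C"
  proof (cases "C = 0")
    case True
    have "B = 0"
    proof (rule ccontr)
      assume "B \<noteq> 0"
      have "2 * 1 * (- (A + 1) / (2 * B)) * B = - (A + 1)" using \<open>B \<noteq> 0\<close> by (simp add: field_simps)
      with q[of 1 "- (A + 1) / (2 * B)"] True show False by simp
    qed
    then show ?thesis using True by simp
  next
    case False
    then have "C > 0" unfolding C_def by simp
    have "0 \<le> C * (A * C - B\<^sup>2)"
      using q[of C "- B"] by (simp add: algebra_simps power2_eq_square)
    then show ?thesis using \<open>C > 0\<close> by (simp add: zero_le_mult_iff)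
  qed
  then have "B\<^sup>2 \<le> (l2_norm S f * l2_norm S g)\<^sup>2" by (simp add: A_def C_def power_mult_distrib)
  then show ?thesis
    unfolding B_def using abs_le_square_iff[of "l2_inner S f g" "l2_norm S f * l2_norm S g"]
    by (simp add: l2_norm_nonneg abs_mult)
qed

lemma l2_triangle:
  fixes f g :: "'a::euclidean_space \<Rightarrow> 'b::euclidean_space"
  assumes "square_integrable S f" "square_integrable S g"
  shows "l2_norm S (\<lambda>x. f x + g x) \<le> l2_norm S f + l2_norm S g"
proof (rule power2_le_imp_le)
  have "(l2_norm S (\<lambda>x. f x + g x))\<^sup>2 = (l2_norm S f)\<^sup>2 + 2 * l2_inner S f g + (l2_norm S g)\<^sup>2"
    using l2_norm_lincomb[OF assms, of 1 1] by simp
  also have "\<dots> \<le> (l2_norm S f)\<^sup>2 + 2 * (l2_norm S f * l2_norm S g) + (l2_norm S g)\<^sup>2"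
    using l2_Cauchy_Schwarz[OF assms] by simp
  also have "\<dots> = (l2_norm S f + l2_norm S g)\<^sup>2" by (simp add: power2_sum)
  finally show "(l2_norm S (\<lambda>x. f x + g x))\<^sup>2 \<le> (l2_norm S f + l2_norm S g)\<^sup>2" .
qed (simp add: l2_norm_nonneg)

lemma l2_norm_scaleR:
  fixes f :: "'a::euclidean_space \<Rightarrow> 'b::euclidean_space"
  shows "l2_norm S (\<lambda>x. c *\<^sub>R f x) = \<bar>c\<bar> * l2_norm S f"
proof -
  have "l2_inner S (\<lambda>x. c *\<^sub>R f x) (\<lambda>x. c *\<^sub>R f x) = c\<^sup>2 * l2_inner S f f"
    by (simp add: l2_inner_def power2_eq_square mult.assoc)
  then show ?thesis by (simp add: l2_norm_def real_sqrt_mult)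
qed

lemma l2_inner_cong_AE:
  fixes f g :: "'a::euclidean_space \<Rightarrow> 'b::euclidean_space"
  assumes "f \<in> borel_measurable (lebesgue_on S)" "f' \<in> borel_measurable (lebesgue_on S)"
    "g \<in> borel_measurable (lebesgue_on S)" "g' \<in> borel_measurable (lebesgue_on S)"
    "AE x in lebesgue_on S. f x = f' x" "AE x in lebesgue_on S. g x = g' x"
  shows "l2_inner S f g = l2_inner S f' g'"
  unfolding l2_inner_def
  by (rule integral_cong_AE) (use assms in \<open>auto elim: AE_mp\<close>)

lemma l2_norm_cong_AE:
  fixes f f' :: "'a::euclidean_space \<Rightarrow> 'b::euclidean_space"
  assumes "f \<in> borel_measurable (lebesgue_on S)" "f' \<in> borel_measurable (lebesgue_on S)"
    "AE x in lebesgue_on S. f x = f' x"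
  shows "l2_norm S f = l2_norm S f'"
  unfolding l2_norm_def using l2_inner_cong_AE[OF assms(1,2) assms(1,2) assms(3,3)] by simp

lemma l2_norm_bound:
  fixes f :: "'a::euclidean_space \<Rightarrow> 'b::euclidean_space" and g :: "'a \<Rightarrow> 'c::euclidean_space"
  assumes "square_integrable S g" "f \<in> borel_measurable (lebesgue_on S)" "0 \<le> c"
    and ae: "AE x in lebesgue_on S. norm (f x) \<le> c * norm (g x)"
  shows "l2_norm S f \<le> c * l2_norm S g"
proof (rule power2_le_imp_le)
  have f: "square_integrable S f" by (rule square_integrable_bound[OF assms(1,2) ae])
  have "l2_inner S f f \<le> (LINT x|lebesgue_on S. c\<^sup>2 * (g x \<bullet> g x))"
    unfolding l2_inner_def
  proof (rule integral_mono_AE)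
    show "AE x in lebesgue_on S. f x \<bullet> f x \<le> c\<^sup>2 * (g x \<bullet> g x)"
      using ae
    proof eventually_elim
      case (elim x)
      from power_mono[OF elim, of 2] show ?case
        by (simp add: power_mult_distrib flip: power2_norm_eq_inner)
    qed
  qed (use f assms(1) in \<open>auto intro!: square_integrable_inner integrable_mult_right\<close>)
  then show "(l2_norm S f)\<^sup>2 \<le> (c * l2_norm S g)\<^sup>2"
    by (simp add: power_mult_distrib l2_norm_power2 l2_inner_def)
qed (simp add: assms l2_norm_nonneg)

text \<open>The means by which identities pass from test functions to \<open>H\<^sub>0\<^sup>1\<close>.\<close>

lemma l2_inner_tendsto:
  fixes f :: "nat \<Rightarrow> 'a::euclidean_space \<Rightarrow> 'b::euclidean_space"
  assumes "\<And>n. square_integrable S (f n)" "square_integrable S f'" "square_integrable S g"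
    and lim: "(\<lambda>n. l2_norm S (\<lambda>x. f' x - f n x)) \<longlonglongrightarrow> 0"
  shows "(\<lambda>n. l2_inner S (f n) g) \<longlonglongrightarrow> l2_inner S f' g"
proof -
  have "(\<lambda>n. l2_inner S f' g - l2_inner S (f n) g) \<longlonglongrightarrow> 0"
  proof (rule Lim_null_comparison)
    show "(\<lambda>n. l2_norm S (\<lambda>x. f' x - f n x) * l2_norm S g) \<longlonglongrightarrow> 0"
      using tendsto_mult_right[OF lim, of "l2_norm S g"] by simp
    have "l2_inner S f' g - l2_inner S (f n) g = l2_inner S (\<lambda>x. f' x - f n x) g" for n
      using l2_inner_lincomb_left[of S f' "f n" g 1 "-1"] assms by simp
    then show "\<forall>\<^sub>F n in sequentially. norm (l2_inner S f' g - l2_inner S (f n) g)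
        \<le> l2_norm S (\<lambda>x. f' x - f n x) * l2_norm S g"
      using assms by (auto intro!: always_eventually l2_Cauchy_Schwarz square_integrable_diff)
  qed
  from tendsto_diff[OF tendsto_const[of "l2_inner S f' g"] this] show ?thesis by simp
qed

lemma l2_inner_components:
  fixes F G :: "'a::euclidean_space \<Rightarrow> 'b::euclidean_space"
  assumes "square_integrable S F" "square_integrable S G"
  shows "l2_inner S F G = (\<Sum>i\<in>Basis. l2_inner S (\<lambda>x. F x \<bullet> i) (\<lambda>x. G x \<bullet> i))"
proof -
  have "l2_inner S F G = (LINT x|lebesgue_on S. (\<Sum>i\<in>Basis. (F x \<bullet> i) * (G x \<bullet> i)))"
    unfolding l2_inner_def by (subst euclidean_inner) simp
  also have "\<dots> = (\<Sum>i\<in>Basis. (LINT x|lebesgue_on S. (F x \<bullet> i) * (G x \<bullet> i)))"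
    using assms by (intro Bochner_Integration.integral_sum square_integrable_mult)
      (auto simp: square_integrable_components[of S F] square_integrable_components[of S G])
  finally show ?thesis by (simp add: l2_inner_def)
qed

lemma l2_norm_component_le:
  fixes F :: "'a::euclidean_space \<Rightarrow> 'b::euclidean_space"
  assumes "square_integrable S F" "i \<in> Basis"
  shows "l2_norm S (\<lambda>x. F x \<bullet> i) \<le> l2_norm S F"
  using l2_norm_bound[OF assms(1), of "\<lambda>x. F x \<bullet> i" 1] assms Basis_le_norm[OF assms(2)] by auto


section \<open>The fundamental lemma of the calculus of variations\<close>

lemma continuous_compact_support_integrable:
  fixes g :: "'a::euclidean_space \<Rightarrow> real"
  assumes "continuous_on UNIV g" "compact K" "\<And>x. x \<notin> K \<Longrightarrow> g x = 0"
  shows "integrable lborel g"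
proof -
  have "integrable lborel (\<lambda>x. indicator K x *\<^sub>R g x)"
    using assms by (intro borel_integrable_compact) (auto intro: continuous_on_subset)
  moreover have "(\<lambda>x. indicator K x *\<^sub>R g x) = g"
    using assms(3) by (auto simp: fun_eq_iff indicator_def)
  ultimately show ?thesis by simp
qed

lemma continuous_compact_support_bounded:
  fixes g :: "'a::euclidean_space \<Rightarrow> real"
  assumes "continuous_on UNIV g" "compact K" "\<And>x. x \<notin> K \<Longrightarrow> g x = 0"
  obtains B where "B \<ge> 0" "\<And>x. \<bar>g x\<bar> \<le> B"
proof -
  have "compact (g ` K)" using assms by (intro compact_continuous_image) (auto intro: continuous_on_subset)
  then obtain B where B: "\<And>x. x \<in> K \<Longrightarrow> \<bar>g x\<bar> \<le> B"
    using compact_imp_bounded[of "g ` K"] by (force simp: bounded_iff)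
  have "\<bar>g x\<bar> \<le> max B 0" for x using B[of x] assms(3)[of x] by (cases "x \<in> K") auto
  then show thesis by (rule that[rotated]) simp
qed

text \<open>Difference quotients have integral zero by translation invariance of Lebesgue measure. They are
bounded by the maximum of the derivative (mean value theorem) and supported in a fixed ball, so
dominated convergence carries this over to the derivative.\<close>

lemma integral_directional_derivative_zero:
  fixes F :: "'a::euclidean_space \<Rightarrow> real"
  assumes diff: "\<And>x. F differentiable (at x)"
    and cont: "continuous_on UNIV (\<lambda>x. frechet_derivative F (at x) i)"
    and K: "compact K" "\<And>x. x \<notin> K \<Longrightarrow> F x = 0" "\<And>x. x \<notin> K \<Longrightarrow> frechet_derivative F (at x) i = 0"
  shows "(LINT x|lebesgue. frechet_derivative F (at x) i) = 0"
proof -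
  define D where "D x = frechet_derivative F (at x) i" for x
  obtain B where B: "B \<ge> 0" "\<And>x. \<bar>D x\<bar> \<le> B"
    unfolding D_def by (rule continuous_compact_support_bounded[OF cont K(1,3)]) auto
  have cF: "continuous_on UNIV F"
    using diff by (auto intro!: differentiable_imp_continuous_within simp: continuous_on_eq_continuous_within)
  have [measurable]: "F \<in> borel_measurable borel" "D \<in> borel_measurable borel"
    using cF cont by (auto intro: borel_measurable_continuous_onI simp: D_def)
  have intF: "integrable lborel F"
    by (rule continuous_compact_support_integrable[OF cF K(1,2)])
  obtain R where R: "\<And>x. x \<in> K \<Longrightarrow> norm x \<le> R"
    using compact_imp_bounded[OF K(1)] by (auto simp: bounded_iff)
  define S where "S = cball (0::'a) (R + norm i)"
  define Q where "Q n x = (F (x + (1 / real (Suc n)) *\<^sub>R i) - F x) * real (Suc n)" for n x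
  have line: "((\<lambda>t. F (x + t *\<^sub>R i)) has_real_derivative D (x + t *\<^sub>R i)) (at t)" for x t
  proof -
    have 1: "(F has_derivative frechet_derivative F (at (x + t *\<^sub>R i))) (at (x + t *\<^sub>R i))"
      using diff by (simp add: frechet_derivative_works[symmetric])
    have 2: "((\<lambda>t. x + t *\<^sub>R i) has_derivative (\<lambda>s. s *\<^sub>R i)) (at t)"
      by (auto intro!: derivative_eq_intros)
    have "((\<lambda>t. F (x + t *\<^sub>R i)) has_derivative (\<lambda>s. frechet_derivative F (at (x + t *\<^sub>R i)) (s *\<^sub>R i))) (at t)"
      by (rule has_derivative_compose[OF 2 1])
    moreover have "linear (frechet_derivative F (at (x + t *\<^sub>R i)))"
      using diff by (rule linear_frechet_derivative)
    ultimately show ?thesis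
      by (auto simp: has_field_derivative_def D_def linear_cmul mult.commute elim!: has_derivative_eq_rhs)
  qed
  have "(\<lambda>n. LINT x|lborel. Q n x) \<longlonglongrightarrow> (LINT x|lborel. D x)"
  proof (rule integral_dominated_convergence)
    show "D \<in> borel_measurable lborel" "\<And>n. Q n \<in> borel_measurable lborel"
      unfolding Q_def by measurable
    show "integrable lborel (\<lambda>x. B * indicator S x)"
      unfolding S_def
      by (intro integrable_mult_right integrable_real_indicator emeasure_bounded_finite) auto
    show "AE x in lborel. (\<lambda>n. Q n x) \<longlonglongrightarrow> D x"
    proof (rule AE_I2)
      fix x
      have "((\<lambda>h. (F (x + h *\<^sub>R i) - F x) / h) \<longlongrightarrow> D x) (at 0)"
        using line[of x 0] by (simp add: DERIV_def)
      moreover have "filterlim (\<lambda>n. 1 / real (Suc n)) (at 0) sequentially"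
        using lim_1_over_n LIMSEQ_Suc by (fastforce simp: filterlim_at)
      ultimately have "(\<lambda>n. (F (x + (1 / real (Suc n)) *\<^sub>R i) - F x) / (1 / real (Suc n))) \<longlonglongrightarrow> D x"
        by (rule filterlim_compose)
      then show "(\<lambda>n. Q n x) \<longlonglongrightarrow> D x" by (simp add: Q_def)
    qed
    show "AE x in lborel. norm (Q n x) \<le> B * indicator S x" for n
    proof (rule AE_I2)
      fix x
      have pos: "0 < 1 / real (Suc n)" and le1: "1 / real (Suc n) \<le> 1" by auto
      show "norm (Q n x) \<le> B * indicator S x"
      proof (cases "x \<in> S")
        case False
        then have n: "norm x > R + norm i" by (simp add: S_def)
        have "norm ((1 / real (Suc n)) *\<^sub>R i) \<le> norm i"
          using mult_right_mono[OF le1, of "norm i"] by simp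
        then have "norm (x + (1 / real (Suc n)) *\<^sub>R i) > R"
          using n norm_diff_ineq[of x "(1 / real (Suc n)) *\<^sub>R i"] by linarith
        moreover have "norm x > R" using n norm_ge_zero[of i] by linarith
        ultimately have "x \<notin> K" "x + (1 / real (Suc n)) *\<^sub>R i \<notin> K" using R by (meson not_le)+
        then show ?thesis by (simp add: Q_def K(2) False)
      next
        case True
        obtain z where z: "F (x + (1 / real (Suc n)) *\<^sub>R i) - F (x + 0 *\<^sub>R i)
            = (1 / real (Suc n) - 0) * D (x + z *\<^sub>R i)"
          using MVT2[OF pos, of "\<lambda>t. F (x + t *\<^sub>R i)" "\<lambda>t. D (x + t *\<^sub>R i)"] line by blast
        then have "Q n x = D (x + z *\<^sub>R i)" unfolding Q_def by (simp add: field_simps)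
        then show ?thesis using B True by simp
      qed
    qed
  qed
  moreover have "(LINT x|lborel. Q n x) = 0" for n
  proof -
    define c where "c = (1 / real (Suc n)) *\<^sub>R i"
    have t: "integrable lborel (\<lambda>x. F (c + x))" "(LINT x|lborel. F (c + x)) = (LINT x|lborel. F x)"
      using integrable_distr_eq[of "(+) c" lborel borel F] integral_distr[of "(+) c" lborel borel F] intF
      by (simp_all add: lborel_distr_plus)
    have "(LINT x|lborel. Q n x) = (LINT x|lborel. (F (c + x) - F x) * real (Suc n))"
      by (simp add: Q_def c_def add.commute)
    also have "\<dots> = 0" using t intF by simp
    finally show ?thesis .
  qed
  ultimately have "(LINT x|lborel. D x) = 0"
    by (simp add: LIMSEQ_const_iff)
  then show ?thesis by (simp add: D_def[symmetric] integral_completion)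
qed

lemma lebesgue_on_eq_lebesgue:
  fixes g :: "'a::euclidean_space \<Rightarrow> real"
  assumes "S \<in> sets lebesgue" "\<And>x. x \<notin> S \<Longrightarrow> g x = 0"
  shows "(LINT x|lebesgue_on S. g x) = (LINT x|lebesgue. g x)"
    "integrable (lebesgue_on S) g \<longleftrightarrow> integrable lebesgue g"
proof -
  have "(\<lambda>x. indicator S x *\<^sub>R g x) = g" using assms(2) by (auto simp: fun_eq_iff indicator_def)
  then show "(LINT x|lebesgue_on S. g x) = (LINT x|lebesgue. g x)"
    "integrable (lebesgue_on S) g \<longleftrightarrow> integrable lebesgue g"
    using assms(1) by (simp_all add: integral_restrict_space integrable_restrict_space)
qed

lemma borel_measurable_lebesgue_on_continuous:
  fixes g :: "'a::euclidean_space \<Rightarrow> real"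
  shows "continuous_on UNIV g \<Longrightarrow> g \<in> borel_measurable (lebesgue_on S)"
  by (intro measurable_restrict_space1 measurable_completion) (simp add: borel_measurable_continuous_onI)

lemma loc_integrable_mult_integrable:
  fixes \<phi> f :: "'a::euclidean_space \<Rightarrow> real"
  assumes S: "S \<in> sets lebesgue" and f: "loc_integrable S f" and c: "continuous_on UNIV \<phi>"
    and K: "compact K" "K \<subseteq> S" "\<And>x. x \<notin> K \<Longrightarrow> \<phi> x = 0"
  shows "integrable (lebesgue_on S) (\<lambda>x. f x * \<phi> x)"
proof -
  obtain B where B: "B \<ge> 0" "\<And>x. \<bar>\<phi> x\<bar> \<le> B"
    by (rule continuous_compact_support_bounded[OF c K(1,3)]) auto
  have f: "integrable lebesgue (\<lambda>x. indicator K x *\<^sub>R f x)"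
    using f K by (auto simp: loc_integrable_def set_integrable_def)
  have eq: "(\<lambda>x. f x * \<phi> x) = (\<lambda>x. (indicator K x *\<^sub>R f x) * \<phi> x)"
    using K(3) by (auto simp: fun_eq_iff indicator_def)
  have "integrable lebesgue (\<lambda>x. (indicator K x *\<^sub>R f x) * \<phi> x)"
  proof (rule Bochner_Integration.integrable_bound)
    show "integrable lebesgue (\<lambda>x. B * (indicator K x *\<^sub>R f x))" using f by (rule integrable_mult_right)
    have "\<phi> \<in> borel_measurable lebesgue"
      using borel_measurable_lebesgue_on_continuous[OF c, of UNIV] by (simp add: lebesgue_on_UNIV_eq)
    then show "(\<lambda>x. (indicator K x *\<^sub>R f x) * \<phi> x) \<in> borel_measurable lebesgue"
      using f by (intro borel_measurable_times) auto
    show "AE x in lebesgue. norm ((indicator K x *\<^sub>R f x) * \<phi> x) \<le> norm (B * (indicator K x *\<^sub>R f x))"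
    proof (rule AE_I2)
      fix x
      have "\<bar>indicator K x *\<^sub>R f x\<bar> * \<bar>\<phi> x\<bar> \<le> \<bar>indicator K x *\<^sub>R f x\<bar> * B"
        using B by (intro mult_left_mono) auto
      then show "norm ((indicator K x *\<^sub>R f x) * \<phi> x) \<le> norm (B * (indicator K x *\<^sub>R f x))"
        using B(1) by (simp add: abs_mult mult.commute)
    qed
  qed
  then show ?thesis
    using lebesgue_on_eq_lebesgue(2)[OF S, of "\<lambda>x. f x * \<phi> x"] K by (auto simp: eq)
qed

lemma square_integrable_loc_integrable:
  fixes f :: "'a::euclidean_space \<Rightarrow> real"
  assumes S: "S \<in> sets lebesgue" and f: "square_integrable S f"
  shows "loc_integrable S f"
  unfolding loc_integrable_def
proof (intro allI impI)
  fix K assume K: "compact K \<and> K \<subseteq> S"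
  then have mK: "K \<in> lmeasurable" by (simp add: lmeasurable_compact)
  have "square_integrable S (\<lambda>x. indicator K x :: real)"
  proof -
    have "integrable lebesgue (indicator K :: 'a \<Rightarrow> real)" using mK lmeasurable_iff_integrable by blast
    then have "integrable (lebesgue_on S) (indicator K :: 'a \<Rightarrow> real)"
      using lebesgue_on_eq_lebesgue(2)[OF S, of "indicator K"] K by (auto simp: indicator_def)
    moreover have "(\<lambda>x. (norm (indicator K x :: real))\<^sup>2) = (indicator K :: 'a \<Rightarrow> real)"
      by (auto simp: indicator_def)
    ultimately show ?thesis unfolding square_integrable_def by auto
  qed
  from square_integrable_mult[OF this f] have "integrable lebesgue (\<lambda>x. indicator K x * f x)"
    using lebesgue_on_eq_lebesgue(2)[OF S, of "\<lambda>x. indicator K x * f x"] K by (auto simp: indicator_def)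
  then show "set_integrable lebesgue K f" by (simp add: set_integrable_def)
qed

text \<open>For \<open>n \<rightarrow> \<infinity>\<close> these bumps increase to the indicator function of the open box.\<close>

definition box_bump :: "'a::euclidean_space \<Rightarrow> 'a \<Rightarrow> nat \<Rightarrow> 'a \<Rightarrow> real" where
  "box_bump a b n x = (\<Prod>i\<in>Basis. flat_exp 0 (real n * (i \<bullet> x - a \<bullet> i)) * flat_exp 0 (real n * (b \<bullet> i - i \<bullet> x)))"

lemma flat_exp_bounds: "0 \<le> flat_exp 0 t" "flat_exp 0 t \<le> 1" "t \<le> 0 \<Longrightarrow> flat_exp n t = 0"
  by (auto simp: flat_exp_def)

lemma flat_exp_tendsto_one: "t > 0 \<Longrightarrow> (\<lambda>n. flat_exp 0 (real n * t)) \<longlonglongrightarrow> 1"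
proof -
  assume t: "t > 0"
  have "(\<lambda>n. 1 / real n / t) \<longlonglongrightarrow> 0 / t"
    by (intro tendsto_divide lim_1_over_n tendsto_const) (use t in auto)
  then have "(\<lambda>n. exp (- (1 / real n / t))) \<longlonglongrightarrow> exp (- 0)" by (intro tendsto_intros) simp
  moreover have "\<forall>\<^sub>F n in sequentially. exp (- (1 / real n / t)) = flat_exp 0 (real n * t)"
    by (rule eventually_sequentiallyI[of 1]) (use t in \<open>auto simp: flat_exp_def field_simps\<close>)
  ultimately show ?thesis using Lim_transform_eventually by fastforce
qed

lemma box_bump_outside:
  assumes "x \<notin> box a b" shows "box_bump a b n x = 0"
proof -
  obtain i where i: "i \<in> Basis" "i \<bullet> x - a \<bullet> i \<le> 0 \<or> b \<bullet> i - i \<bullet> x \<le> 0"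
    using assms by (auto simp: mem_box inner_commute not_less)
  then have "real n * (i \<bullet> x - a \<bullet> i) \<le> 0 \<or> real n * (b \<bullet> i - i \<bullet> x) \<le> 0"
    by (auto simp: mult_nonneg_nonpos)
  then show ?thesis unfolding box_bump_def
    using i(1) by (intro prod_zero) (auto intro!: bexI[of _ i] simp: flat_exp_bounds)
qed

lemma box_bump_le_1: "\<bar>box_bump a b n x\<bar> \<le> 1"
  unfolding box_bump_def abs_prod
  by (intro prod_le_1) (auto simp: abs_mult flat_exp_bounds intro!: mult_le_one)

lemma box_bump_tendsto: "(\<lambda>n. box_bump a b n x) \<longlonglongrightarrow> indicator (box a b) x"
proof (cases "x \<in> box a b")
  case True
  then have "(\<lambda>n. box_bump a b n x) \<longlonglongrightarrow> (\<Prod>i\<in>(Basis::'a set). 1 * 1)"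
    unfolding box_bump_def
    by (intro tendsto_prod tendsto_mult flat_exp_tendsto_one) (auto simp: mem_box inner_commute)
  then show ?thesis using True by simp
qed (simp add: box_bump_outside)

lemma test_function_box_bump:
  assumes "cbox a b \<subseteq> \<Omega>" shows "test_function \<Omega> (box_bump a b n)"
proof (rule test_function_zero_outside[OF _ _ assms])
  show "box_bump a b n x = 0" if "x \<notin> cbox a b" for x
    using that box_subset_cbox by (intro box_bump_outside) auto
  have aff: "Ck k (\<lambda>x. c * (i \<bullet> x) + d)" for c d k and i :: 'a
    by (intro Ck_add Ck_mult Ck_const Ck_inner)
  have l: "Ck k (\<lambda>x. real n * (i \<bullet> x - a \<bullet> i))" for k i
    using aff[of k "real n" i "- real n * (a \<bullet> i)"] by (simp add: algebra_simps)
  have u: "Ck k (\<lambda>x. real n * (b \<bullet> i - i \<bullet> x))" for k i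
    using aff[of k "- real n" i "real n * (b \<bullet> i)"] by (simp add: algebra_simps)
  show "Ck k (box_bump a b n)" for k
    unfolding box_bump_def by (intro Ck_prod Ck_mult Ck_flat_exp l u)
qed simp

text \<open>Testing with bumps shows that the integral over every box contained in \<open>\<Omega>\<close> vanishes. By Lebesgue's
differentiation theorem the function is then zero almost everywhere in each such box, and countably
many boxes cover \<open>\<Omega>\<close>.\<close>

lemma AE_zero_if_orthogonal_to_test_functions:
  fixes d :: "'a::euclidean_space \<Rightarrow> real"
  assumes op: "open \<Omega>" and loc: "loc_integrable \<Omega> d"
    and orth: "\<And>\<phi>. test_function \<Omega> \<phi> \<Longrightarrow> (LINT x|lebesgue_on \<Omega>. d x * \<phi> x) = 0"
  shows "AE x in lebesgue_on \<Omega>. d x = 0"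
proof -
  have mO: "\<Omega> \<in> sets lebesgue" using op by simp
  have box0: "integral (cbox a b) d = 0" if ab: "cbox a b \<subseteq> \<Omega>" for a b
  proof -
    have int: "integrable lebesgue (\<lambda>x. indicator (cbox a b) x *\<^sub>R d x)"
      using loc ab by (auto simp: loc_integrable_def set_integrable_def)
    have "(\<lambda>n. LINT x|lebesgue. (indicator (cbox a b) x *\<^sub>R d x) * box_bump a b n x) \<longlonglongrightarrow>
        (LINT x|lebesgue. (indicator (cbox a b) x *\<^sub>R d x) * indicator (box a b) x)"
    proof (rule integral_dominated_convergence)
      show "integrable lebesgue (\<lambda>x. norm (indicator (cbox a b) x *\<^sub>R d x))" using int by (rule integrable_norm)
      show "AE x in lebesgue. (\<lambda>n. (indicator (cbox a b) x *\<^sub>R d x) * box_bump a b n x) \<longlonglongrightarrow>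
          (indicator (cbox a b) x *\<^sub>R d x) * indicator (box a b) x"
        by (intro AE_I2 tendsto_mult tendsto_const box_bump_tendsto)
      show "AE x in lebesgue. norm ((indicator (cbox a b) x *\<^sub>R d x) * box_bump a b n x)
          \<le> norm (indicator (cbox a b) x *\<^sub>R d x)" for n
        unfolding norm_mult by (intro AE_I2 mult_left_le) (use box_bump_le_1 in auto)
      show "(\<lambda>x. (indicator (cbox a b) x *\<^sub>R d x) * indicator (box a b) x) \<in> borel_measurable lebesgue"
        using int by (intro borel_measurable_times borel_measurable_indicator) auto
      have "box_bump a b n \<in> borel_measurable lebesgue" for n
        using borel_measurable_lebesgue_on_continuous[OF test_functionD(3)[OF test_function_box_bump[OF ab]], where S=UNIV]
        by (simp add: lebesgue_on_UNIV_eq)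
      then show "(\<lambda>x. (indicator (cbox a b) x *\<^sub>R d x) * box_bump a b n x) \<in> borel_measurable lebesgue" for n
        using int by (intro borel_measurable_times) auto
    qed
    moreover have "(LINT x|lebesgue. (indicator (cbox a b) x *\<^sub>R d x) * box_bump a b n x) = 0" for n
    proof -
      have out: "box_bump a b n x = 0" if "x \<notin> cbox a b" for x
        using that box_subset_cbox[of a b] by (intro box_bump_outside) auto
      have "(LINT x|lebesgue. (indicator (cbox a b) x *\<^sub>R d x) * box_bump a b n x)
          = (LINT x|lebesgue. d x * box_bump a b n x)"
        by (rule arg_cong[of _ _ "integral\<^sup>L lebesgue"])
           (use out in \<open>auto simp: fun_eq_iff indicator_def\<close>)
      also have "\<dots> = (LINT x|lebesgue_on \<Omega>. d x * box_bump a b n x)"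
        using ab out by (intro lebesgue_on_eq_lebesgue(1)[OF mO, symmetric]) auto
      finally show ?thesis using orth[OF test_function_box_bump[OF ab]] by simp
    qed
    ultimately have "(LINT x|lebesgue. (indicator (cbox a b) x *\<^sub>R d x) * indicator (box a b) x) = 0"
      by (simp add: LIMSEQ_const_iff)
    moreover have "(\<lambda>x. (indicator (cbox a b) x *\<^sub>R d x) * indicator (box a b) x) = (\<lambda>x. indicator (box a b) x *\<^sub>R d x)"
      using box_subset_cbox[of a b] by (auto simp: fun_eq_iff indicator_def)
    ultimately have z: "(LINT x:box a b|lebesgue. d x) = 0"
      by (simp add: set_lebesgue_integral_def)
    have "set_integrable lebesgue (box a b) d"
      using int box_subset_cbox[of a b] set_integrable_subset[of lebesgue "cbox a b" d "box a b"]
      by (auto simp: set_integrable_def)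
    from set_lebesgue_integral_eq_integral(2)[OF this] z have "integral (box a b) d = 0" by simp
    then show ?thesis by (simp add: integral_open_interval)
  qed
  have local: "negligible {x \<in> cbox a b. d x \<noteq> 0}" if ab: "cbox a b \<subseteq> \<Omega>" for a b
  proof -
    define e where "e x = (if x \<in> cbox a b then d x else 0)" for x
    have "set_integrable lebesgue (cbox a b) d" using loc ab by (auto simp: loc_integrable_def)
    then have "d integrable_on cbox a b" by (rule set_lebesgue_integral_eq_integral(1))
    then have "e integrable_on UNIV" unfolding e_def by (simp add: integrable_restrict_UNIV)
    then have "e integrable_on cbox u v" for u v by (rule integrable_on_subcbox) simp
    then obtain N where N: "negligible N" "\<And>x r. \<lbrakk>x \<notin> N; 0 < r\<rbrakk> \<Longrightarrow>
               \<exists>s>0. \<forall>h. 0 < h \<and> h < s \<longrightarrow>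
                         norm(integral (cbox x (x + h *\<^sub>R One)) e /\<^sub>R h ^ DIM('a) - e x) < r"
      using integrable_ccontinuous_explicit[of e] by blast
    have "d x = 0" if x: "x \<in> box a b" "x \<notin> N" for x
    proof (rule ccontr)
      assume "d x \<noteq> 0"
      then obtain s where s: "s > 0" "\<And>h. 0 < h \<Longrightarrow> h < s \<Longrightarrow>
          norm(integral (cbox x (x + h *\<^sub>R One)) e /\<^sub>R h ^ DIM('a) - e x) < \<bar>d x\<bar>"
        using N(2)[OF x(2), of "\<bar>d x\<bar>"] by auto
      have "\<exists>r>0. ball x r \<subseteq> box a b" using x(1) open_box open_contains_ball by blast
      then obtain r where r: "r > 0" "ball x r \<subseteq> box a b" by blast
      \<comment> \<open>small enough for the differentiation theorem and for the cube to stay inside the box\<close>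
      define h where "h = min (s / 2) (r / (2 * (norm (One::'a) + 1)))"
      have np: "norm (One::'a) + 1 > 0" by (simp add: add_nonneg_pos)
      have h: "0 < h" "h < s" "h \<le> r / (2 * (norm (One::'a) + 1))" using s(1) r(1) np by (auto simp: h_def)
      have sub: "cbox x (x + h *\<^sub>R One) \<subseteq> cbox a b"
      proof -
        have "h * norm (One::'a) < r"
        proof -
          have "h * (norm (One::'a) + 1) \<le> r / 2" using h(3) np by (simp add: field_simps)
          then show ?thesis using h(1) r(1) by (simp add: algebra_simps)
        qed
        then have "x + h *\<^sub>R One \<in> ball x r" using h(1) by (simp add: dist_norm)
        then have "x \<in> cbox a b" "x + h *\<^sub>R One \<in> cbox a b" using r(2) x(1) box_subset_cbox by blast+
        then show ?thesis unfolding subset_iff mem_box by (blast intro: order_trans)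
      qed
      have "integral (cbox x (x + h *\<^sub>R One)) e = integral (cbox x (x + h *\<^sub>R One)) d"
        by (rule integral_cong) (use sub in \<open>auto simp: e_def\<close>)
      also have "\<dots> = 0" by (rule box0) (use sub ab in blast)
      finally have "\<bar>e x\<bar> < \<bar>d x\<bar>" using s(2)[OF h(1,2)] by simp
      then show False using x(1) box_subset_cbox by (auto simp: e_def split: if_splits)
    qed
    then have "{x \<in> cbox a b. d x \<noteq> 0} \<subseteq> N \<union> (cbox a b - box a b)" by auto
    moreover have "negligible (cbox a b - box a b)" by (rule negligible_frontier_interval)
    ultimately show ?thesis using N(1) by (meson negligible_Un negligible_subset)
  qed
  obtain \<D> where \<D>: "countable \<D>" "\<D> \<subseteq> Pow \<Omega>" "\<And>X. X \<in> \<D> \<Longrightarrow> \<exists>a b. X = cbox a b" "\<Union>\<D> = \<Omega>"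
    by (rule open_countable_Union_open_cbox[OF op]) auto
  have "negligible (\<Union>X\<in>\<D>. {x \<in> X. d x \<noteq> 0})"
  proof (rule negligible_countable_Union)
    fix Y assume "Y \<in> (\<lambda>X. {x \<in> X. d x \<noteq> 0}) ` \<D>"
    then obtain X where X: "X \<in> \<D>" "Y = {x \<in> X. d x \<noteq> 0}" by blast
    then obtain a b where "X = cbox a b" using \<D>(3) by blast
    then show "negligible Y" using local[of a b] X \<D>(2) by auto
  qed (use \<D>(1) in auto)
  moreover have "(\<Union>X\<in>\<D>. {x \<in> X. d x \<noteq> 0}) = {x \<in> \<Omega>. d x \<noteq> 0}" using \<D>(4) by auto
  ultimately have "{x \<in> \<Omega>. d x \<noteq> 0} \<in> null_sets lebesgue" by (simp add: negligible_iff_null_sets)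
  then have "AE x in lebesgue. x \<in> \<Omega> \<longrightarrow> d x = 0"
    by (rule AE_I') auto
  then show ?thesis using mO by (simp add: AE_restrict_space_iff)
qed


section \<open>Weak derivatives and the space \<open>H\<^sub>0\<^sup>1\<close>\<close>

lemma borel_measurable_lebesgue_on_cong_AE:
  fixes f g :: "'a::euclidean_space \<Rightarrow> 'b::euclidean_space"
  assumes S: "S \<in> sets lebesgue" and g: "g \<in> borel_measurable (lebesgue_on S)"
    and ae: "AE x in lebesgue_on S. f x = g x"
  shows "f \<in> borel_measurable (lebesgue_on S)"
proof -
  have "(\<lambda>x. if x \<in> S then g x else 0) \<in> borel_measurable lebesgue"
    using g S by (simp add: borel_measurable_if)
  moreover have "AE x in lebesgue. x \<in> S \<longrightarrow> f x = g x"
    using ae S by (simp add: AE_restrict_space_iff)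
  then have "AE x in lebesgue. (if x \<in> S then g x else 0) = (if x \<in> S then f x else 0)"
    by eventually_elim auto
  ultimately have "(\<lambda>x. if x \<in> S then f x else 0) \<in> borel_measurable lebesgue"
    by (rule borel_measurable_AE)
  then show ?thesis using S by (simp add: borel_measurable_if)
qed

lemma has_weak_deriv_unique_AE:
  fixes f :: "'a::euclidean_space \<Rightarrow> real"
  assumes op: "open \<Omega>" and g: "has_weak_deriv \<Omega> i f g" and h: "has_weak_deriv \<Omega> i f h"
  shows "AE x in lebesgue_on \<Omega>. g x = h x"
proof -
  have loc: "loc_integrable \<Omega> (\<lambda>x. g x - h x)"
    using g h by (auto simp: has_weak_deriv_def loc_integrable_def)
  have "AE x in lebesgue_on \<Omega>. g x - h x = 0"
  proof (rule AE_zero_if_orthogonal_to_test_functions[OF op loc])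
    fix \<phi> assume \<phi>: "test_function \<Omega> \<phi>"
    obtain K where K: "compact K" "K \<subseteq> \<Omega>" "\<And>x. x \<notin> K \<Longrightarrow> \<phi> x = 0"
      "\<And>x h. x \<notin> K \<Longrightarrow> frechet_derivative \<phi> (at x) h = 0"
      by (rule test_function_support[OF \<phi>]) (rule that)
    have "integrable (lebesgue_on \<Omega>) (\<lambda>x. g x * \<phi> x)" "integrable (lebesgue_on \<Omega>) (\<lambda>x. h x * \<phi> x)"
      using g h op by (auto intro!: loc_integrable_mult_integrable[OF _ _ test_functionD(3)[OF \<phi>] K(1-3)]
          simp: has_weak_deriv_def)
    then show "(LINT x|lebesgue_on \<Omega>. (g x - h x) * \<phi> x) = 0"
      using g h \<phi> by (simp add: has_weak_deriv_def left_diff_distrib)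
  qed
  then show ?thesis by simp
qed

lemma has_weak_deriv_lincomb:
  fixes f :: "'a::euclidean_space \<Rightarrow> real"
  assumes op: "open \<Omega>" and i: "i \<in> Basis"
    and f: "has_weak_deriv \<Omega> i f f'" and g: "has_weak_deriv \<Omega> i g g'"
  shows "has_weak_deriv \<Omega> i (\<lambda>x. a * f x + b * g x) (\<lambda>x. a * f' x + b * g' x)"
proof -
  have l: "loc_integrable \<Omega> (\<lambda>x. a * f x + b * g x)" "loc_integrable \<Omega> (\<lambda>x. a * f' x + b * g' x)"
    using f g by (auto simp: has_weak_deriv_def loc_integrable_def)
  have "(LINT x|lebesgue_on \<Omega>. (a * f x + b * g x) * frechet_derivative \<phi> (at x) i)
        = - (LINT x|lebesgue_on \<Omega>. (a * f' x + b * g' x) * \<phi> x)" if \<phi>: "test_function \<Omega> \<phi>" for \<phi>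
  proof -
    obtain K where K: "compact K" "K \<subseteq> \<Omega>" "\<And>x. x \<notin> K \<Longrightarrow> \<phi> x = 0"
      "\<And>x h. x \<notin> K \<Longrightarrow> frechet_derivative \<phi> (at x) h = 0"
      by (rule test_function_support[OF \<phi>]) (rule that)
    have int: "integrable (lebesgue_on \<Omega>) (\<lambda>x. h x * \<phi> x)"
      "integrable (lebesgue_on \<Omega>) (\<lambda>x. h x * frechet_derivative \<phi> (at x) i)"
      if "loc_integrable \<Omega> h" for h
      using that op by (auto intro!: loc_integrable_mult_integrable[OF _ _ test_functionD(3)[OF \<phi>] K(1-3)]
          loc_integrable_mult_integrable[OF _ _ test_functionD(4)[OF \<phi> i] K(1,2,4)])
    have "integrable (lebesgue_on \<Omega>) (\<lambda>x. f x * frechet_derivative \<phi> (at x) i)"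
      "integrable (lebesgue_on \<Omega>) (\<lambda>x. g x * frechet_derivative \<phi> (at x) i)"
      "integrable (lebesgue_on \<Omega>) (\<lambda>x. f' x * \<phi> x)" "integrable (lebesgue_on \<Omega>) (\<lambda>x. g' x * \<phi> x)"
      using f g by (auto simp: has_weak_deriv_def intro: int)
    then show ?thesis
      using f g \<phi> by (simp add: has_weak_deriv_def distrib_right mult.assoc)
  qed
  with l show ?thesis by (simp add: has_weak_deriv_def)
qed

lemma test_function_square_integrable:
  assumes op: "open \<Omega>" and \<phi>: "test_function \<Omega> \<phi>"
  shows "square_integrable \<Omega> \<phi>"
proof -
  obtain K where K: "compact K" "K \<subseteq> \<Omega>" "\<And>x. x \<notin> K \<Longrightarrow> \<phi> x = 0"
    "\<And>x h. x \<notin> K \<Longrightarrow> frechet_derivative \<phi> (at x) h = 0"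
    by (rule test_function_support[OF \<phi>]) (rule that)
  have c: "continuous_on UNIV \<phi>" by (rule test_functionD(3)[OF \<phi>])
  have "integrable lborel (\<lambda>x. (norm (\<phi> x))\<^sup>2)"
    by (rule continuous_compact_support_integrable[OF _ K(1)]) (use c K(3) in \<open>auto intro!: continuous_intros\<close>)
  then have "integrable (lebesgue_on \<Omega>) (\<lambda>x. (norm (\<phi> x))\<^sup>2)"
    using lebesgue_on_eq_lebesgue(2)[of \<Omega> "\<lambda>x. (norm (\<phi> x))\<^sup>2"] op K by (auto simp: integrable_completion)
  then show ?thesis using c by (simp add: square_integrable_def borel_measurable_lebesgue_on_continuous)
qed

text \<open>Integration by parts: the product of two test functions has compact support, so the integral of
its derivative is zero.\<close>

lemma test_function_has_weak_deriv:
  assumes op: "open \<Omega>" and \<phi>: "test_function \<Omega> \<phi>" and i: "i \<in> Basis"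
  shows "has_weak_deriv \<Omega> i \<phi> (\<lambda>x. frechet_derivative \<phi> (at x) i)"
  unfolding has_weak_deriv_def
proof (intro conjI allI impI)
  show "loc_integrable \<Omega> \<phi>" "loc_integrable \<Omega> (\<lambda>x. frechet_derivative \<phi> (at x) i)"
    using op \<phi> i by (auto intro!: square_integrable_loc_integrable test_function_square_integrable test_function_deriv)
  fix \<psi> assume \<psi>: "test_function \<Omega> \<psi>"
  let ?p = "\<lambda>x. \<phi> x * frechet_derivative \<psi> (at x) i" and ?q = "\<lambda>x. frechet_derivative \<phi> (at x) i * \<psi> x"
  have prod: "test_function \<Omega> (\<lambda>x. \<phi> x * \<psi> x)" by (rule test_function_mult[OF \<phi> \<psi>])
  obtain K where K: "compact K" "K \<subseteq> \<Omega>" "\<And>x. x \<notin> K \<Longrightarrow> \<phi> x * \<psi> x = 0"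
    "\<And>x h. x \<notin> K \<Longrightarrow> frechet_derivative (\<lambda>x. \<phi> x * \<psi> x) (at x) h = 0"
    by (rule test_function_support[OF prod]) (rule that)
  have "(LINT x|lebesgue. frechet_derivative (\<lambda>x. \<phi> x * \<psi> x) (at x) i) = 0"
    by (rule integral_directional_derivative_zero[OF _ _ K(1) K(3) K(4)])
       (rule test_functionD[OF prod] i)+
  moreover have "(LINT x|lebesgue_on \<Omega>. frechet_derivative (\<lambda>x. \<phi> x * \<psi> x) (at x) i)
      = (LINT x|lebesgue. frechet_derivative (\<lambda>x. \<phi> x * \<psi> x) (at x) i)"
    using op K by (intro lebesgue_on_eq_lebesgue(1)) auto
  moreover have "frechet_derivative (\<lambda>x. \<phi> x * \<psi> x) (at x) i = ?p x + ?q x" for x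
    by (rule frechet_derivative_mult) (rule test_functionD[OF \<phi>] test_functionD[OF \<psi>])+
  moreover have "integrable (lebesgue_on \<Omega>) ?p" "integrable (lebesgue_on \<Omega>) ?q"
    by (rule square_integrable_mult; rule test_function_square_integrable[OF op];
        rule \<phi> \<psi> test_function_deriv[OF \<phi> i] test_function_deriv[OF \<psi> i])+
  ultimately show "(LINT x|lebesgue_on \<Omega>. ?p x) = - (LINT x|lebesgue_on \<Omega>. ?q x)"
    by simp
qed

lemma weak_deriv_works:
  "has_weak_deriv \<Omega> i f g \<Longrightarrow> has_weak_deriv \<Omega> i f (weak_deriv \<Omega> i f)"
  unfolding weak_deriv_def by (rule someI[of "has_weak_deriv \<Omega> i f"])

lemma weak_deriv_AE:
  assumes "open \<Omega>" "has_weak_deriv \<Omega> i f g"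
  shows "AE x in lebesgue_on \<Omega>. weak_deriv \<Omega> i f x = g x"
  by (rule has_weak_deriv_unique_AE[OF assms(1) weak_deriv_works[OF assms(2)] assms(2)])

lemma wgrad_inner: "i \<in> Basis \<Longrightarrow> wgrad \<Omega> f x \<bullet> i = weak_deriv \<Omega> i f x"
  by (simp add: wgrad_def inner_sum_left inner_Basis if_distrib sum.delta cong: if_cong)

lemma wgrad_AE:
  fixes f :: "'a::euclidean_space \<Rightarrow> real" and g :: "'a \<Rightarrow> 'a"
  assumes "open \<Omega>" "\<And>i. i \<in> Basis \<Longrightarrow> has_weak_deriv \<Omega> i f (\<lambda>x. g x \<bullet> i)"
  shows "AE x in lebesgue_on \<Omega>. wgrad \<Omega> f x = g x"
proof -
  have "AE x in lebesgue_on \<Omega>. \<forall>i\<in>Basis. weak_deriv \<Omega> i f x = g x \<bullet> i"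
    using weak_deriv_AE[OF assms] by (subst AE_finite_all) auto
  then show ?thesis
    by eventually_elim (simp add: euclidean_eq_iff[where 'a='a] wgrad_inner)
qed

lemma in_H1I:
  fixes f :: "'a::euclidean_space \<Rightarrow> real" and g :: "'a \<Rightarrow> 'a"
  assumes "square_integrable \<Omega> f" "square_integrable \<Omega> g"
    "\<And>i. i \<in> Basis \<Longrightarrow> has_weak_deriv \<Omega> i f (\<lambda>x. g x \<bullet> i)"
  shows "in_H1 \<Omega> f"
  using assms square_integrable_components[of \<Omega> g] by (auto simp: in_H1_def in_L2_iff)

lemma in_H1D:
  fixes f :: "'a::euclidean_space \<Rightarrow> real"
  assumes op: "open \<Omega>" and f: "in_H1 \<Omega> f"
  shows "square_integrable \<Omega> f" "square_integrable \<Omega> (wgrad \<Omega> f)"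
    "i \<in> Basis \<Longrightarrow> has_weak_deriv \<Omega> i f (weak_deriv \<Omega> i f)"
    "i \<in> Basis \<Longrightarrow> square_integrable \<Omega> (weak_deriv \<Omega> i f)"
proof -
  show "square_integrable \<Omega> f" using f by (simp add: in_H1_def in_L2_iff)
  show "has_weak_deriv \<Omega> i f (weak_deriv \<Omega> i f)" if i: "i \<in> Basis" for i
  proof -
    obtain g where "has_weak_deriv \<Omega> i f g" using f i by (auto simp: in_H1_def)
    then show ?thesis by (rule weak_deriv_works)
  qed
  show d: "square_integrable \<Omega> (weak_deriv \<Omega> i f)" if i: "i \<in> Basis" for i
  proof -
    obtain g where g: "square_integrable \<Omega> g" "has_weak_deriv \<Omega> i f g"
      using f i by (auto simp: in_H1_def in_L2_iff)
    have ae: "AE x in lebesgue_on \<Omega>. weak_deriv \<Omega> i f x = g x"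
      by (rule weak_deriv_AE[OF op g(2)])
    show ?thesis
      using borel_measurable_lebesgue_on_cong_AE[OF _ square_integrable_measurable[OF g(1)] ae] op
      by (intro square_integrable_cong_AE[OF g(1) _ ae]) auto
  qed
  show "square_integrable \<Omega> (wgrad \<Omega> f)"
    using d by (subst square_integrable_components) (simp add: wgrad_inner)
qed

lemma in_H1_lincomb:
  fixes f g :: "'a::euclidean_space \<Rightarrow> real"
  assumes op: "open \<Omega>" and f: "in_H1 \<Omega> f" and g: "in_H1 \<Omega> g"
  shows "in_H1 \<Omega> (\<lambda>x. a * f x + b * g x)"
    "AE x in lebesgue_on \<Omega>. wgrad \<Omega> (\<lambda>x. a * f x + b * g x) x = a *\<^sub>R wgrad \<Omega> f x + b *\<^sub>R wgrad \<Omega> g x"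
proof -
  have d: "has_weak_deriv \<Omega> i (\<lambda>x. a * f x + b * g x) (\<lambda>x. (a *\<^sub>R wgrad \<Omega> f x + b *\<^sub>R wgrad \<Omega> g x) \<bullet> i)"
    if "i \<in> Basis" for i
    using has_weak_deriv_lincomb[OF op that in_H1D(3)[OF op f that] in_H1D(3)[OF op g that], of a b] that
    by (simp add: inner_add_left wgrad_inner)
  show "in_H1 \<Omega> (\<lambda>x. a * f x + b * g x)"
    using square_integrable_lincomb[OF in_H1D(1)[OF op f] in_H1D(1)[OF op g], of a b]
    by (intro in_H1I[OF _ square_integrable_lincomb[OF in_H1D(2)[OF op f] in_H1D(2)[OF op g], of a b] d]) simp_all
  show "AE x in lebesgue_on \<Omega>. wgrad \<Omega> (\<lambda>x. a * f x + b * g x) x = a *\<^sub>R wgrad \<Omega> f x + b *\<^sub>R wgrad \<Omega> g x"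
    by (rule wgrad_AE[OF op d])
qed

lemma in_H1_diff:
  fixes f g :: "'a::euclidean_space \<Rightarrow> real"
  assumes "open \<Omega>" "in_H1 \<Omega> f" "in_H1 \<Omega> g"
  shows "in_H1 \<Omega> (\<lambda>x. f x - g x)"
    "AE x in lebesgue_on \<Omega>. wgrad \<Omega> (\<lambda>x. f x - g x) x = wgrad \<Omega> f x - wgrad \<Omega> g x"
  using in_H1_lincomb[OF assms, of 1 "-1"] by simp_all

lemma test_function_in_H1:
  fixes \<phi> :: "'a::euclidean_space \<Rightarrow> real"
  assumes op: "open \<Omega>" and \<phi>: "test_function \<Omega> \<phi>"
  shows "in_H1 \<Omega> \<phi>"
    "i \<in> Basis \<Longrightarrow> AE x in lebesgue_on \<Omega>. weak_deriv \<Omega> i \<phi> x = frechet_derivative \<phi> (at x) i"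
proof -
  note d = test_function_has_weak_deriv[OF op \<phi>]
  show "in_H1 \<Omega> \<phi>"
    unfolding in_H1_def in_L2_iff
    using d test_function_square_integrable[OF op] test_function_deriv[OF \<phi>] \<phi> by blast
  show "AE x in lebesgue_on \<Omega>. weak_deriv \<Omega> i \<phi> x = frechet_derivative \<phi> (at x) i" if "i \<in> Basis"
    by (rule weak_deriv_AE[OF op d[OF that]])
qed

lemma h1_norm_diff:
  fixes f g :: "'a::euclidean_space \<Rightarrow> real"
  assumes op: "open \<Omega>" and f: "in_H1 \<Omega> f" and g: "in_H1 \<Omega> g"
  shows "h1_norm \<Omega> \<Omega> (\<lambda>x. f x - g x)
    = sqrt ((l2_norm \<Omega> (\<lambda>x. f x - g x))\<^sup>2 + (l2_norm \<Omega> (\<lambda>x. wgrad \<Omega> f x - wgrad \<Omega> g x))\<^sup>2)"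
proof -
  have "l2_norm \<Omega> (wgrad \<Omega> (\<lambda>x. f x - g x)) = l2_norm \<Omega> (\<lambda>x. wgrad \<Omega> f x - wgrad \<Omega> g x)"
    using in_H1D(2)[OF op] in_H1_diff[OF op f g] f g
    by (intro l2_norm_cong_AE) (auto intro!: square_integrable_measurable square_integrable_diff)
  then show ?thesis by (simp add: h1_norm_def h1_seminorm_def)
qed

text \<open>The definition of \<open>H\<^sub>0\<^sup>1\<close> involves the weak gradient of a difference; here the approximation is restated
with the difference of the weak gradients, which are equal almost everywhere.\<close>

lemma in_H10_approx:
  fixes v :: "'a::euclidean_space \<Rightarrow> real"
  assumes op: "open \<Omega>" and v: "in_H10 \<Omega> v"
  obtains \<phi> where "\<And>n::nat. test_function \<Omega> (\<phi> n)"
    "(\<lambda>n. l2_norm \<Omega> (\<lambda>x. v x - \<phi> n x)) \<longlonglongrightarrow> 0"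
    "(\<lambda>n. l2_norm \<Omega> (\<lambda>x. wgrad \<Omega> v x - wgrad \<Omega> (\<phi> n) x)) \<longlonglongrightarrow> 0"
proof -
  have "\<forall>n. \<exists>\<phi>. test_function \<Omega> \<phi> \<and> h1_norm \<Omega> \<Omega> (\<lambda>x. v x - \<phi> x) < 1 / real (Suc n)"
    using v by (auto simp: in_H10_def)
  then obtain \<phi> where \<phi>: "\<And>n. test_function \<Omega> (\<phi> n)"
      "\<And>n. h1_norm \<Omega> \<Omega> (\<lambda>x. v x - \<phi> n x) < 1 / real (Suc n)"
    by metis
  have vH: "in_H1 \<Omega> v" using v by (simp add: in_H10_def)
  note h = h1_norm_diff[OF op vH test_function_in_H1(1)[OF op \<phi>(1)]]
  have z: "(\<lambda>n. 1 / real (Suc n)) \<longlonglongrightarrow> 0" using LIMSEQ_Suc[OF lim_1_over_n] by simp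
  have le: "l2_norm \<Omega> (\<lambda>x. v x - \<phi> n x) \<le> 1 / real (Suc n)"
    "l2_norm \<Omega> (\<lambda>x. wgrad \<Omega> v x - wgrad \<Omega> (\<phi> n) x) \<le> 1 / real (Suc n)" for n
    using \<phi>(2)[of n] h[of n] real_sqrt_sum_squares_ge1[of "l2_norm \<Omega> (\<lambda>x. v x - \<phi> n x)" "l2_norm \<Omega> (\<lambda>x. wgrad \<Omega> v x - wgrad \<Omega> (\<phi> n) x)"]
      real_sqrt_sum_squares_ge2[of "l2_norm \<Omega> (\<lambda>x. wgrad \<Omega> v x - wgrad \<Omega> (\<phi> n) x)" "l2_norm \<Omega> (\<lambda>x. v x - \<phi> n x)"]
    by linarith+
  show thesis
    by (rule that[of \<phi>]; (rule \<phi>(1) | rule tendsto_sandwich[OF _ _ tendsto_const z]))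
       (auto intro!: always_eventually le l2_norm_nonneg simp del: of_nat_Suc)
qed

lemma in_H10I:
  fixes v :: "'a::euclidean_space \<Rightarrow> real"
  assumes op: "open \<Omega>" and v: "in_H1 \<Omega> v" and \<phi>: "\<And>n::nat. test_function \<Omega> (\<phi> n)"
    and l: "(\<lambda>n. l2_norm \<Omega> (\<lambda>x. v x - \<phi> n x)) \<longlonglongrightarrow> 0"
      "(\<lambda>n. l2_norm \<Omega> (\<lambda>x. wgrad \<Omega> v x - wgrad \<Omega> (\<phi> n) x)) \<longlonglongrightarrow> 0"
  shows "in_H10 \<Omega> v"
  unfolding in_H10_def
proof (intro conjI allI impI v)
  fix e :: real assume "e > 0"
  have "(\<lambda>n. h1_norm \<Omega> \<Omega> (\<lambda>x. v x - \<phi> n x)) \<longlonglongrightarrow> sqrt (0\<^sup>2 + 0\<^sup>2)"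
    unfolding h1_norm_diff[OF op v test_function_in_H1(1)[OF op \<phi>]] by (intro tendsto_intros l)
  then have "\<forall>\<^sub>F n in sequentially. h1_norm \<Omega> \<Omega> (\<lambda>x. v x - \<phi> n x) < e"
    using \<open>e > 0\<close> by (simp add: order_tendsto_iff)
  then show "\<exists>\<phi>. test_function \<Omega> \<phi> \<and> h1_norm \<Omega> \<Omega> (\<lambda>x. v x - \<phi> x) < e"
    using \<phi> eventually_happens'[OF sequentially_bot] by blast
qed

lemma l2_lincomb_tendsto_zero:
  fixes f g :: "'a::euclidean_space \<Rightarrow> 'b::euclidean_space"
  assumes "square_integrable S f" "square_integrable S g"
    "\<And>n. square_integrable S (F n)" "\<And>n. square_integrable S (G n)"
    and lim: "(\<lambda>n. l2_norm S (\<lambda>x. f x - F n x)) \<longlonglongrightarrow> 0" "(\<lambda>n. l2_norm S (\<lambda>x. g x - G n x)) \<longlonglongrightarrow> 0"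
  shows "(\<lambda>n. l2_norm S (\<lambda>x. (a *\<^sub>R f x + b *\<^sub>R g x) - (a *\<^sub>R F n x + b *\<^sub>R G n x))) \<longlonglongrightarrow> 0"
proof (rule tendsto_sandwich[OF _ _ tendsto_const])
  show "(\<lambda>n. \<bar>a\<bar> * l2_norm S (\<lambda>x. f x - F n x) + \<bar>b\<bar> * l2_norm S (\<lambda>x. g x - G n x)) \<longlonglongrightarrow> 0"
    using tendsto_add[OF tendsto_mult_left[OF lim(1), of "\<bar>a\<bar>"] tendsto_mult_left[OF lim(2), of "\<bar>b\<bar>"]] by simp
  have "l2_norm S (\<lambda>x. (a *\<^sub>R f x + b *\<^sub>R g x) - (a *\<^sub>R F n x + b *\<^sub>R G n x))
      \<le> \<bar>a\<bar> * l2_norm S (\<lambda>x. f x - F n x) + \<bar>b\<bar> * l2_norm S (\<lambda>x. g x - G n x)" for n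
  proof -
    have "l2_norm S (\<lambda>x. a *\<^sub>R (f x - F n x) + b *\<^sub>R (g x - G n x))
        \<le> \<bar>a\<bar> * l2_norm S (\<lambda>x. f x - F n x) + \<bar>b\<bar> * l2_norm S (\<lambda>x. g x - G n x)"
      using l2_triangle[OF square_integrable_scaleR[OF square_integrable_diff[OF assms(1,3)], of a n]
          square_integrable_scaleR[OF square_integrable_diff[OF assms(2,4)], of b n]]
      unfolding l2_norm_scaleR .
    then show ?thesis by (simp add: algebra_simps)
  qed
  then show "\<forall>\<^sub>F n in sequentially. l2_norm S (\<lambda>x. (a *\<^sub>R f x + b *\<^sub>R g x) - (a *\<^sub>R F n x + b *\<^sub>R G n x))
      \<le> \<bar>a\<bar> * l2_norm S (\<lambda>x. f x - F n x) + \<bar>b\<bar> * l2_norm S (\<lambda>x. g x - G n x)" by simp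
qed (simp add: l2_norm_nonneg)

lemma in_H10_lincomb:
  fixes v w :: "'a::euclidean_space \<Rightarrow> real"
  assumes op: "open \<Omega>" and v: "in_H10 \<Omega> v" and w: "in_H10 \<Omega> w"
  shows "in_H10 \<Omega> (\<lambda>x. a * v x + b * w x)"
proof -
  have H: "in_H1 \<Omega> v" "in_H1 \<Omega> w" using v w by (auto simp: in_H10_def)
  obtain \<phi> where \<phi>: "\<And>n::nat. test_function \<Omega> (\<phi> n)"
    "(\<lambda>n. l2_norm \<Omega> (\<lambda>x. v x - \<phi> n x)) \<longlonglongrightarrow> 0"
    "(\<lambda>n. l2_norm \<Omega> (\<lambda>x. wgrad \<Omega> v x - wgrad \<Omega> (\<phi> n) x)) \<longlonglongrightarrow> 0"
    by (rule in_H10_approx[OF op v]) (rule that)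
  obtain \<psi> where \<psi>: "\<And>n::nat. test_function \<Omega> (\<psi> n)"
    "(\<lambda>n. l2_norm \<Omega> (\<lambda>x. w x - \<psi> n x)) \<longlonglongrightarrow> 0"
    "(\<lambda>n. l2_norm \<Omega> (\<lambda>x. wgrad \<Omega> w x - wgrad \<Omega> (\<psi> n) x)) \<longlonglongrightarrow> 0"
    by (rule in_H10_approx[OF op w]) (rule that)
  note tH = test_function_in_H1(1)[OF op \<phi>(1)] test_function_in_H1(1)[OF op \<psi>(1)]
  have t: "test_function \<Omega> (\<lambda>x. a * \<phi> n x + b * \<psi> n x)" for n
    by (rule test_function_lincomb[OF \<phi>(1) \<psi>(1)])
  note I = in_H1_lincomb[OF op H, of a b] 
  show ?thesis
  proof (rule in_H10I[OF op I(1) t])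
    show "(\<lambda>n. l2_norm \<Omega> (\<lambda>x. (a * v x + b * w x) - (a * \<phi> n x + b * \<psi> n x))) \<longlonglongrightarrow> 0"
      using l2_lincomb_tendsto_zero[OF in_H1D(1)[OF op H(1)] in_H1D(1)[OF op H(2)]
          in_H1D(1)[OF op tH(1)] in_H1D(1)[OF op tH(2)] \<phi>(2) \<psi>(2), of a b] by simp
    have "l2_norm \<Omega> (\<lambda>x. wgrad \<Omega> (\<lambda>x. a * v x + b * w x) x - wgrad \<Omega> (\<lambda>x. a * \<phi> n x + b * \<psi> n x) x)
        = l2_norm \<Omega> (\<lambda>x. (a *\<^sub>R wgrad \<Omega> v x + b *\<^sub>R wgrad \<Omega> w x) - (a *\<^sub>R wgrad \<Omega> (\<phi> n) x + b *\<^sub>R wgrad \<Omega> (\<psi> n) x))" for n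
    proof (rule l2_norm_cong_AE)
      note J = in_H1_lincomb[OF op tH(1)[of n] tH(2)[of n], of a b]
      show "AE x in lebesgue_on \<Omega>. wgrad \<Omega> (\<lambda>x. a * v x + b * w x) x - wgrad \<Omega> (\<lambda>x. a * \<phi> n x + b * \<psi> n x) x
          = (a *\<^sub>R wgrad \<Omega> v x + b *\<^sub>R wgrad \<Omega> w x) - (a *\<^sub>R wgrad \<Omega> (\<phi> n) x + b *\<^sub>R wgrad \<Omega> (\<psi> n) x)"
        using I(2) J(2) by eventually_elim simp
      show "(\<lambda>x. wgrad \<Omega> (\<lambda>x. a * v x + b * w x) x - wgrad \<Omega> (\<lambda>x. a * \<phi> n x + b * \<psi> n x) x) \<in> borel_measurable (lebesgue_on \<Omega>)"
        by (intro square_integrable_measurable square_integrable_diff in_H1D(2)[OF op] I(1) J(1))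
      show "(\<lambda>x. (a *\<^sub>R wgrad \<Omega> v x + b *\<^sub>R wgrad \<Omega> w x) - (a *\<^sub>R wgrad \<Omega> (\<phi> n) x + b *\<^sub>R wgrad \<Omega> (\<psi> n) x)) \<in> borel_measurable (lebesgue_on \<Omega>)"
        by (intro square_integrable_measurable square_integrable_diff square_integrable_lincomb in_H1D(2)[OF op] H tH)
    qed
    then show "(\<lambda>n. l2_norm \<Omega> (\<lambda>x. wgrad \<Omega> (\<lambda>x. a * v x + b * w x) x - wgrad \<Omega> (\<lambda>x. a * \<phi> n x + b * \<psi> n x) x)) \<longlonglongrightarrow> 0"
      using l2_lincomb_tendsto_zero[OF in_H1D(2)[OF op H(1)] in_H1D(2)[OF op H(2)]
          in_H1D(2)[OF op tH(1)] in_H1D(2)[OF op tH(2)] \<phi>(3) \<psi>(3), of a b] by simp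
  qed
qed

text \<open>An identity that is linear and \<open>L\<^sup>2\<close>-continuous in a function and its gradient extends from test functions
to \<open>H\<^sub>0\<^sup>1\<close>. Integration by parts and the skew symmetry of convection are both of this form.\<close>

lemma H10_density:
  fixes v g :: "'a::euclidean_space \<Rightarrow> real" and F :: "'a \<Rightarrow> 'a"
  assumes op: "open \<Omega>" and v: "in_H10 \<Omega> v"
    and F: "square_integrable \<Omega> F" and g: "square_integrable \<Omega> g"
    and test: "\<And>\<phi>. test_function \<Omega> \<phi> \<Longrightarrow> l2_inner \<Omega> (wgrad \<Omega> \<phi>) F + l2_inner \<Omega> \<phi> g = 0"
  shows "l2_inner \<Omega> (wgrad \<Omega> v) F + l2_inner \<Omega> v g = 0"
proof -
  have H: "in_H1 \<Omega> v" using v by (auto simp: in_H10_def)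
  obtain \<phi> where \<phi>: "\<And>n::nat. test_function \<Omega> (\<phi> n)"
    "(\<lambda>n. l2_norm \<Omega> (\<lambda>x. v x - \<phi> n x)) \<longlonglongrightarrow> 0"
    "(\<lambda>n. l2_norm \<Omega> (\<lambda>x. wgrad \<Omega> v x - wgrad \<Omega> (\<phi> n) x)) \<longlonglongrightarrow> 0"
    by (rule in_H10_approx[OF op v]) (rule that)
  note tH = test_function_in_H1(1)[OF op \<phi>(1)]
  have "(\<lambda>n. l2_inner \<Omega> (wgrad \<Omega> (\<phi> n)) F + l2_inner \<Omega> (\<phi> n) g) \<longlonglongrightarrow> l2_inner \<Omega> (wgrad \<Omega> v) F + l2_inner \<Omega> v g"
    by (intro tendsto_add l2_inner_tendsto in_H1D(1,2)[OF op] H tH F g \<phi>)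
  then show ?thesis by (simp add: test[OF \<phi>(1)] LIMSEQ_const_iff)
qed

lemma weak_deriv_integration_by_parts:
  fixes v w :: "'a::euclidean_space \<Rightarrow> real"
  assumes op: "open \<Omega>" and v: "in_H10 \<Omega> v" and i: "i \<in> Basis"
    and w: "square_integrable \<Omega> w" "square_integrable \<Omega> g" "has_weak_deriv \<Omega> i w g"
  shows "l2_inner \<Omega> w (weak_deriv \<Omega> i v) = - l2_inner \<Omega> g v"
proof -
  have wi: "square_integrable \<Omega> (\<lambda>x. w x *\<^sub>R i)"
    using i w(1) by (intro square_integrable_bound[OF w(1), of _ 1]) auto
  have eq: "l2_inner \<Omega> (wgrad \<Omega> v) (\<lambda>x. w x *\<^sub>R i) = l2_inner \<Omega> w (weak_deriv \<Omega> i v)" for v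
    using i by (simp add: l2_inner_def wgrad_inner)
  have "l2_inner \<Omega> (wgrad \<Omega> v) (\<lambda>x. w x *\<^sub>R i) + l2_inner \<Omega> v g = 0"
  proof (rule H10_density[OF op v wi w(2)])
    fix \<phi> assume \<phi>: "test_function \<Omega> \<phi>"
    have "l2_inner \<Omega> w (weak_deriv \<Omega> i \<phi>) = l2_inner \<Omega> w (\<lambda>x. frechet_derivative \<phi> (at x) i)"
      using test_function_in_H1[OF op \<phi>] in_H1D(4)[OF op _ i] i
        test_function_square_integrable[OF op test_function_deriv[OF \<phi> i]] w(1)
      by (intro l2_inner_cong_AE) (auto intro: square_integrable_measurable)
    also have "\<dots> = - l2_inner \<Omega> \<phi> g"
      using w(3) \<phi> by (simp add: has_weak_deriv_def l2_inner_def mult.commute)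
    finally show "l2_inner \<Omega> (wgrad \<Omega> \<phi>) (\<lambda>x. w x *\<^sub>R i) + l2_inner \<Omega> \<phi> g = 0" by (simp add: eq)
  qed
  then show ?thesis by (simp add: eq l2_inner_commute)
qed


section \<open>The convection-diffusion form and the energy norm\<close>

lemma wgrad_lincomb_norms:
  fixes v w :: "'a::euclidean_space \<Rightarrow> real"
  assumes op: "open \<Omega>" and v: "in_H1 \<Omega> v" and w: "in_H1 \<Omega> w"
  shows "l2_norm \<Omega> (\<lambda>x. a * v x + b * w x) \<le> \<bar>a\<bar> * l2_norm \<Omega> v + \<bar>b\<bar> * l2_norm \<Omega> w"
    "h1_seminorm \<Omega> \<Omega> (\<lambda>x. a * v x + b * w x) \<le> \<bar>a\<bar> * h1_seminorm \<Omega> \<Omega> v + \<bar>b\<bar> * h1_seminorm \<Omega> \<Omega> w"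
proof -
  note V = in_H1D(1,2)[OF op v] and W = in_H1D(1,2)[OF op w]
  show "l2_norm \<Omega> (\<lambda>x. a * v x + b * w x) \<le> \<bar>a\<bar> * l2_norm \<Omega> v + \<bar>b\<bar> * l2_norm \<Omega> w"
    using l2_triangle[OF square_integrable_scaleR[OF V(1), of a] square_integrable_scaleR[OF W(1), of b]]
    unfolding l2_norm_scaleR by simp
  have "h1_seminorm \<Omega> \<Omega> (\<lambda>x. a * v x + b * w x) = l2_norm \<Omega> (\<lambda>x. a *\<^sub>R wgrad \<Omega> v x + b *\<^sub>R wgrad \<Omega> w x)"
    unfolding h1_seminorm_def
    by (intro l2_norm_cong_AE in_H1_lincomb(2)[OF op v w] square_integrable_measurable
        in_H1D(2)[OF op] in_H1_lincomb(1)[OF op v w] square_integrable_lincomb V W)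
  then show "h1_seminorm \<Omega> \<Omega> (\<lambda>x. a * v x + b * w x) \<le> \<bar>a\<bar> * h1_seminorm \<Omega> \<Omega> v + \<bar>b\<bar> * h1_seminorm \<Omega> \<Omega> w"
    using l2_triangle[OF square_integrable_scaleR[OF V(2), of a] square_integrable_scaleR[OF W(2), of b]]
    unfolding l2_norm_scaleR h1_seminorm_def by simp
qed

lemma h1_seminorm_nonneg: "0 \<le> h1_seminorm \<Omega> S v"
  by (simp add: h1_seminorm_def l2_norm_nonneg)

lemma energy_norm_nonneg: "0 \<le> \<epsilon> \<Longrightarrow> 0 \<le> \<sigma> \<Longrightarrow> 0 \<le> energy_norm \<Omega> \<epsilon> \<sigma> v"
  by (simp add: energy_norm_def)

lemma energy_norm_power2:
  "0 \<le> \<epsilon> \<Longrightarrow> 0 \<le> \<sigma> \<Longrightarrow> (energy_norm \<Omega> \<epsilon> \<sigma> v)\<^sup>2 = \<epsilon> * (h1_seminorm \<Omega> \<Omega> v)\<^sup>2 + \<sigma> * (l2_norm \<Omega> v)\<^sup>2"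
  by (simp add: energy_norm_def)

lemma energy_norm_le:
  assumes "0 \<le> \<epsilon>" "0 \<le> \<sigma>" "h1_seminorm \<Omega> \<Omega> v \<le> a" "l2_norm \<Omega> v \<le> b"
  shows "energy_norm \<Omega> \<epsilon> \<sigma> v \<le> sqrt (\<epsilon> * a\<^sup>2 + \<sigma> * b\<^sup>2)"
  unfolding energy_norm_def using assms
  by (intro real_sqrt_le_mono add_mono mult_left_mono power_mono)
     (auto simp: h1_seminorm_nonneg l2_norm_nonneg)

text \<open>The energy norm is the Euclidean norm of the pair \<open>(\<surd>\<epsilon> |v|\<^sub>1, \<surd>\<sigma> \<parallel>v\<parallel>\<^sub>0)\<close>, so it inherits Minkowski's
inequality from its components and from the plane.\<close>

lemma energy_norm_lincomb:
  fixes v w :: "'a::euclidean_space \<Rightarrow> real"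
  assumes op: "open \<Omega>" and v: "in_H1 \<Omega> v" and w: "in_H1 \<Omega> w" and p: "0 \<le> \<epsilon>" "0 \<le> \<sigma>"
  shows "energy_norm \<Omega> \<epsilon> \<sigma> (\<lambda>x. a * v x + b * w x)
      \<le> \<bar>a\<bar> * energy_norm \<Omega> \<epsilon> \<sigma> v + \<bar>b\<bar> * energy_norm \<Omega> \<epsilon> \<sigma> w"
proof -
  define V1 V0 W1 W0 where "V1 = h1_seminorm \<Omega> \<Omega> v" and "V0 = l2_norm \<Omega> v"
    and "W1 = h1_seminorm \<Omega> \<Omega> w" and "W0 = l2_norm \<Omega> w"
  have s: "sqrt (\<epsilon> * (\<bar>c\<bar> * s)\<^sup>2 + \<sigma> * (\<bar>c\<bar> * t)\<^sup>2) = \<bar>c\<bar> * sqrt (\<epsilon> * s\<^sup>2 + \<sigma> * t\<^sup>2)" for c s t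
  proof -
    have "\<epsilon> * (\<bar>c\<bar> * s)\<^sup>2 + \<sigma> * (\<bar>c\<bar> * t)\<^sup>2 = c\<^sup>2 * (\<epsilon> * s\<^sup>2 + \<sigma> * t\<^sup>2)"
      by (simp add: power_mult_distrib algebra_simps)
    then show ?thesis by (simp add: real_sqrt_mult)
  qed
  have "energy_norm \<Omega> \<epsilon> \<sigma> (\<lambda>x. a * v x + b * w x)
      \<le> sqrt (\<epsilon> * (\<bar>a\<bar> * V1 + \<bar>b\<bar> * W1)\<^sup>2 + \<sigma> * (\<bar>a\<bar> * V0 + \<bar>b\<bar> * W0)\<^sup>2)"
    unfolding V1_def V0_def W1_def W0_def by (intro energy_norm_le p wgrad_lincomb_norms[OF op v w])
  also have "\<dots> = sqrt ((sqrt \<epsilon> * (\<bar>a\<bar> * V1) + sqrt \<epsilon> * (\<bar>b\<bar> * W1))\<^sup>2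
        + (sqrt \<sigma> * (\<bar>a\<bar> * V0) + sqrt \<sigma> * (\<bar>b\<bar> * W0))\<^sup>2)"
    using p by (simp add: power_mult_distrib flip: distrib_left)
  also have "\<dots> \<le> sqrt ((sqrt \<epsilon> * (\<bar>a\<bar> * V1))\<^sup>2 + (sqrt \<sigma> * (\<bar>a\<bar> * V0))\<^sup>2)
        + sqrt ((sqrt \<epsilon> * (\<bar>b\<bar> * W1))\<^sup>2 + (sqrt \<sigma> * (\<bar>b\<bar> * W0))\<^sup>2)"
    by (rule real_sqrt_sum_squares_triangle_ineq)
  also have "\<dots> = sqrt (\<epsilon> * (\<bar>a\<bar> * V1)\<^sup>2 + \<sigma> * (\<bar>a\<bar> * V0)\<^sup>2) + sqrt (\<epsilon> * (\<bar>b\<bar> * W1)\<^sup>2 + \<sigma> * (\<bar>b\<bar> * W0)\<^sup>2)"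
    using p by (simp add: power_mult_distrib)
  finally show ?thesis
    unfolding s unfolding V1_def V0_def W1_def W0_def energy_norm_def .
qed

lemma W1inf_field_bounded:
  fixes \<beta> :: "'a::euclidean_space \<Rightarrow> 'a"
  assumes "\<forall>i\<in>Basis. in_W1inf \<Omega> (\<lambda>x. \<beta> x \<bullet> i)"
  obtains M where "M \<ge> 0" "\<beta> \<in> borel_measurable (lebesgue_on \<Omega>)" "AE x in lebesgue_on \<Omega>. norm (\<beta> x) \<le> M"
proof -
  have "\<forall>i\<in>Basis. \<exists>m. AE x in lebesgue_on \<Omega>. \<bar>\<beta> x \<bullet> i\<bar> \<le> m"
    using assms by (auto simp: in_W1inf_def in_Linf_def)
  then obtain m where m: "\<And>i. i \<in> Basis \<Longrightarrow> AE x in lebesgue_on \<Omega>. \<bar>\<beta> x \<bullet> i\<bar> \<le> m i" by metis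
  have "AE x in lebesgue_on \<Omega>. \<forall>i\<in>Basis. \<bar>\<beta> x \<bullet> i\<bar> \<le> m i" using m by (subst AE_finite_all) auto
  then have "AE x in lebesgue_on \<Omega>. norm (\<beta> x) \<le> (\<Sum>i\<in>Basis. \<bar>m i\<bar>)"
  proof eventually_elim
    case (elim x)
    have "norm (\<beta> x) \<le> (\<Sum>i\<in>Basis. \<bar>\<beta> x \<bullet> i\<bar>)" by (rule norm_le_l1)
    also have "\<dots> \<le> (\<Sum>i\<in>Basis. \<bar>m i\<bar>)" using elim by (intro sum_mono) force
    finally show ?case .
  qed
  moreover have "\<beta> \<in> borel_measurable (lebesgue_on \<Omega>)"
    using assms by (subst borel_measurable_euclidean_space) (auto simp: in_W1inf_def in_Linf_def)
  ultimately show thesis by (intro that[of "\<Sum>i\<in>Basis. \<bar>m i\<bar>"]) (auto intro: sum_nonneg)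
qed

lemma bounded_field_inner:
  fixes \<beta> G :: "'a::euclidean_space \<Rightarrow> 'a"
  assumes b: "M \<ge> 0" "\<beta> \<in> borel_measurable (lebesgue_on S)" "AE x in lebesgue_on S. norm (\<beta> x) \<le> M"
    and G: "square_integrable S G"
  shows "square_integrable S (\<lambda>x. \<beta> x \<bullet> G x)" "l2_norm S (\<lambda>x. \<beta> x \<bullet> G x) \<le> M * l2_norm S G"
proof -
  have ae: "AE x in lebesgue_on S. norm (\<beta> x \<bullet> G x) \<le> M * norm (G x)"
    using b(3)
  proof eventually_elim
    case (elim x)
    have "norm (\<beta> x \<bullet> G x) \<le> norm (\<beta> x) * norm (G x)" by (simp add: Cauchy_Schwarz_ineq2)
    also have "\<dots> \<le> M * norm (G x)" using elim by (intro mult_right_mono) auto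
    finally show ?case .
  qed
  have m: "(\<lambda>x. \<beta> x \<bullet> G x) \<in> borel_measurable (lebesgue_on S)"
    using b(2) G by measurable
  show "square_integrable S (\<lambda>x. \<beta> x \<bullet> G x)" by (rule square_integrable_bound[OF G m ae])
  show "l2_norm S (\<lambda>x. \<beta> x \<bullet> G x) \<le> M * l2_norm S G" by (rule l2_norm_bound[OF G m b(1) ae])
qed

lemma bounded_field_scaleR:
  fixes \<beta> :: "'a::euclidean_space \<Rightarrow> 'a" and v :: "'a \<Rightarrow> real"
  assumes b: "\<beta> \<in> borel_measurable (lebesgue_on S)" "AE x in lebesgue_on S. norm (\<beta> x) \<le> M"
    and v: "square_integrable S v"
  shows "square_integrable S (\<lambda>x. v x *\<^sub>R \<beta> x)"
proof (rule square_integrable_bound[OF v])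
  show "(\<lambda>x. v x *\<^sub>R \<beta> x) \<in> borel_measurable (lebesgue_on S)" using b(1) v by measurable
  show "AE x in lebesgue_on S. norm (v x *\<^sub>R \<beta> x) \<le> M * norm (v x)"
    using b(2) by eventually_elim (simp add: mult.commute[of M] mult_left_mono)
qed

text \<open>By the definition of the weak derivatives of \<open>\<beta>\<close> the integral is minus that of \<open>(\<nabla> \<bullet> \<beta>) \<phi>\<close>.\<close>

lemma divergence_free_test:
  fixes \<beta> :: "'a::euclidean_space \<Rightarrow> 'a"
  assumes op: "open \<Omega>" and beta: "\<forall>i\<in>Basis. in_W1inf \<Omega> (\<lambda>x. \<beta> x \<bullet> i)"
    and div: "AE x in lebesgue_on \<Omega>. wdiv \<Omega> \<beta> x = 0" and \<phi>: "test_function \<Omega> \<phi>"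
  shows "(LINT x|lebesgue_on \<Omega>. \<beta> x \<bullet> wgrad \<Omega> \<phi> x) = 0"
proof -
  obtain M where M: "M \<ge> 0" "\<beta> \<in> borel_measurable (lebesgue_on \<Omega>)" "AE x in lebesgue_on \<Omega>. norm (\<beta> x) \<le> M"
    by (rule W1inf_field_bounded[OF beta])
  obtain K where K: "compact K" "K \<subseteq> \<Omega>" "\<And>x. x \<notin> K \<Longrightarrow> \<phi> x = 0"
    "\<And>x h. x \<notin> K \<Longrightarrow> frechet_derivative \<phi> (at x) h = 0"
    by (rule test_function_support[OF \<phi>]) (rule that)
  have w: "has_weak_deriv \<Omega> i (\<lambda>x. \<beta> x \<bullet> i) (weak_deriv \<Omega> i (\<lambda>x. \<beta> x \<bullet> i))" if "i \<in> Basis" for i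
  proof -
    obtain g where "has_weak_deriv \<Omega> i (\<lambda>x. \<beta> x \<bullet> i) g" using beta \<open>i \<in> Basis\<close> by (auto simp: in_W1inf_def)
    then show ?thesis by (rule weak_deriv_works)
  qed
  have mO: "\<Omega> \<in> sets lebesgue" using op by simp
  have i1: "integrable (lebesgue_on \<Omega>) (\<lambda>x. (\<beta> x \<bullet> i) * frechet_derivative \<phi> (at x) i)" if "i \<in> Basis" for i
    using w[OF that] by (intro loc_integrable_mult_integrable[OF mO _ test_functionD(4)[OF \<phi> that] K(1,2,4)])
      (simp_all add: has_weak_deriv_def)
  have i2: "integrable (lebesgue_on \<Omega>) (\<lambda>x. weak_deriv \<Omega> i (\<lambda>x. \<beta> x \<bullet> i) x * \<phi> x)" if "i \<in> Basis" for i
    using w[OF that] by (intro loc_integrable_mult_integrable[OF mO _ test_functionD(3)[OF \<phi>] K(1,2,3)])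
      (simp_all add: has_weak_deriv_def)
  have "AE x in lebesgue_on \<Omega>. \<forall>i\<in>Basis. weak_deriv \<Omega> i \<phi> x = frechet_derivative \<phi> (at x) i"
    using test_function_in_H1(2)[OF op \<phi>] by (subst AE_finite_all) auto
  then have ae: "AE x in lebesgue_on \<Omega>. \<beta> x \<bullet> wgrad \<Omega> \<phi> x = (\<Sum>i\<in>Basis. (\<beta> x \<bullet> i) * frechet_derivative \<phi> (at x) i)"
    by eventually_elim (simp add: wgrad_def inner_sum_right mult.commute)
  have "(LINT x|lebesgue_on \<Omega>. \<beta> x \<bullet> wgrad \<Omega> \<phi> x)
      = (LINT x|lebesgue_on \<Omega>. (\<Sum>i\<in>Basis. (\<beta> x \<bullet> i) * frechet_derivative \<phi> (at x) i))"
    using bounded_field_inner(1)[OF M in_H1D(2)[OF op test_function_in_H1(1)[OF op \<phi>]]] i1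
    by (intro integral_cong_AE ae) auto
  also have "\<dots> = (\<Sum>i\<in>Basis. (LINT x|lebesgue_on \<Omega>. (\<beta> x \<bullet> i) * frechet_derivative \<phi> (at x) i))"
    by (rule Bochner_Integration.integral_sum) (rule i1)
  also have "\<dots> = (\<Sum>i\<in>Basis. - (LINT x|lebesgue_on \<Omega>. weak_deriv \<Omega> i (\<lambda>x. \<beta> x \<bullet> i) x * \<phi> x))"
    using w \<phi> by (intro sum.cong refl) (simp add: has_weak_deriv_def)
  also have "\<dots> = - (LINT x|lebesgue_on \<Omega>. (\<Sum>i\<in>Basis. weak_deriv \<Omega> i (\<lambda>x. \<beta> x \<bullet> i) x * \<phi> x))"
    by (subst Bochner_Integration.integral_sum) (simp_all add: i2 sum_negf)
  also have "(LINT x|lebesgue_on \<Omega>. (\<Sum>i\<in>Basis. weak_deriv \<Omega> i (\<lambda>x. \<beta> x \<bullet> i) x * \<phi> x)) = 0"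
  proof (rule integral_eq_zero_AE)
    show "AE x in lebesgue_on \<Omega>. (\<Sum>i\<in>Basis. weak_deriv \<Omega> i (\<lambda>x. \<beta> x \<bullet> i) x * \<phi> x) = 0"
      using div by eventually_elim (simp add: wdiv_def flip: sum_distrib_right)
  qed
  finally show ?thesis by simp
qed

text \<open>For test functions the two inner products add up to the integral of \<open>\<beta> \<bullet> \<nabla>(v w)\<close>, which vanishes for a
divergence-free field. Density is applied first in \<open>v\<close> and then in \<open>w\<close>.\<close>

lemma convection_skew_symmetric:
  fixes \<beta> :: "'a::euclidean_space \<Rightarrow> 'a" and v w :: "'a \<Rightarrow> real"
  assumes op: "open \<Omega>" and beta: "\<forall>i\<in>Basis. in_W1inf \<Omega> (\<lambda>x. \<beta> x \<bullet> i)"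
    and div: "AE x in lebesgue_on \<Omega>. wdiv \<Omega> \<beta> x = 0"
    and v: "in_H10 \<Omega> v" and w: "in_H10 \<Omega> w"
  shows "l2_inner \<Omega> (\<lambda>x. \<beta> x \<bullet> wgrad \<Omega> v x) w = - l2_inner \<Omega> v (\<lambda>x. \<beta> x \<bullet> wgrad \<Omega> w x)"
proof -
  obtain M where M: "M \<ge> 0" "\<beta> \<in> borel_measurable (lebesgue_on \<Omega>)" "AE x in lebesgue_on \<Omega>. norm (\<beta> x) \<le> M"
    by (rule W1inf_field_bounded[OF beta])
  have vH: "in_H1 \<Omega> v" using v by (simp add: in_H10_def)
  have swap: "l2_inner \<Omega> (wgrad \<Omega> v) (\<lambda>x. w x *\<^sub>R \<beta> x) = l2_inner \<Omega> (\<lambda>x. \<beta> x \<bullet> wgrad \<Omega> v x) w" for v w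
    by (simp add: l2_inner_def inner_commute mult.commute)
  have both: "l2_inner \<Omega> (\<lambda>x. \<beta> x \<bullet> wgrad \<Omega> \<phi> x) \<psi> + l2_inner \<Omega> \<phi> (\<lambda>x. \<beta> x \<bullet> wgrad \<Omega> \<psi> x) = 0"
    if \<phi>: "test_function \<Omega> \<phi>" and \<psi>: "test_function \<Omega> \<psi>" for \<phi> \<psi>
  proof -
    note p = test_function_mult[OF \<phi> \<psi>]
    note H = test_function_in_H1(1)[OF op \<phi>] test_function_in_H1(1)[OF op \<psi>] test_function_in_H1(1)[OF op p]
    note S = test_function_square_integrable[OF op \<phi>] test_function_square_integrable[OF op \<psi>]
    have "AE x in lebesgue_on \<Omega>. \<forall>i\<in>Basis. weak_deriv \<Omega> i \<phi> x = frechet_derivative \<phi> (at x) i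
        \<and> weak_deriv \<Omega> i \<psi> x = frechet_derivative \<psi> (at x) i
        \<and> weak_deriv \<Omega> i (\<lambda>x. \<phi> x * \<psi> x) x = frechet_derivative (\<lambda>x. \<phi> x * \<psi> x) (at x) i"
      using test_function_in_H1(2)[OF op \<phi>] test_function_in_H1(2)[OF op \<psi>] test_function_in_H1(2)[OF op p]
      by (subst AE_finite_all) auto
    then have ae: "AE x in lebesgue_on \<Omega>. (\<beta> x \<bullet> wgrad \<Omega> \<phi> x) * \<psi> x + \<phi> x * (\<beta> x \<bullet> wgrad \<Omega> \<psi> x)
        = \<beta> x \<bullet> wgrad \<Omega> (\<lambda>x. \<phi> x * \<psi> x) x"
    proof eventually_elim
      case (elim x)
      have "wgrad \<Omega> (\<lambda>x. \<phi> x * \<psi> x) x = \<psi> x *\<^sub>R wgrad \<Omega> \<phi> x + \<phi> x *\<^sub>R wgrad \<Omega> \<psi> x"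
        by (rule euclidean_eqI)
           (use elim in \<open>simp add: wgrad_inner inner_add_left frechet_derivative_mult
              test_functionD(1)[OF \<phi>] test_functionD(1)[OF \<psi>]\<close>)
      then show ?case by (simp add: inner_add_right mult.commute)
    qed
    have i1: "integrable (lebesgue_on \<Omega>) (\<lambda>x. (\<beta> x \<bullet> wgrad \<Omega> \<phi> x) * \<psi> x)"
      by (intro square_integrable_mult bounded_field_inner(1)[OF M] in_H1D(2)[OF op] H S)
    have i2: "integrable (lebesgue_on \<Omega>) (\<lambda>x. \<phi> x * (\<beta> x \<bullet> wgrad \<Omega> \<psi> x))"
      by (intro square_integrable_mult bounded_field_inner(1)[OF M] in_H1D(2)[OF op] H S)
    have "l2_inner \<Omega> (\<lambda>x. \<beta> x \<bullet> wgrad \<Omega> \<phi> x) \<psi> + l2_inner \<Omega> \<phi> (\<lambda>x. \<beta> x \<bullet> wgrad \<Omega> \<psi> x)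
        = (LINT x|lebesgue_on \<Omega>. (\<beta> x \<bullet> wgrad \<Omega> \<phi> x) * \<psi> x + \<phi> x * (\<beta> x \<bullet> wgrad \<Omega> \<psi> x))"
      using i1 i2 by (simp add: l2_inner_def)
    also have "\<dots> = (LINT x|lebesgue_on \<Omega>. \<beta> x \<bullet> wgrad \<Omega> (\<lambda>x. \<phi> x * \<psi> x) x)"
      using i1 i2 square_integrable_measurable[OF bounded_field_inner(1)[OF M in_H1D(2)[OF op H(3)]]]
      by (intro integral_cong_AE ae) auto
    also have "\<dots> = 0" by (rule divergence_free_test[OF op beta div p])
    finally show ?thesis .
  qed
  have one: "l2_inner \<Omega> (\<lambda>x. \<beta> x \<bullet> wgrad \<Omega> v x) \<psi> + l2_inner \<Omega> v (\<lambda>x. \<beta> x \<bullet> wgrad \<Omega> \<psi> x) = 0"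
    if \<psi>: "test_function \<Omega> \<psi>" for \<psi>
  proof -
    have "l2_inner \<Omega> (wgrad \<Omega> v) (\<lambda>x. \<psi> x *\<^sub>R \<beta> x) + l2_inner \<Omega> v (\<lambda>x. \<beta> x \<bullet> wgrad \<Omega> \<psi> x) = 0"
      using both[OF _ \<psi>]
      by (intro H10_density[OF op v] bounded_field_scaleR[OF M(2,3)] bounded_field_inner(1)[OF M] in_H1D(2)[OF op]
          test_function_square_integrable[OF op \<psi>] test_function_in_H1(1)[OF op \<psi>]) (simp add: swap)
    then show ?thesis by (simp add: swap)
  qed
  have "l2_inner \<Omega> (wgrad \<Omega> w) (\<lambda>x. v x *\<^sub>R \<beta> x) + l2_inner \<Omega> w (\<lambda>x. \<beta> x \<bullet> wgrad \<Omega> v x) = 0"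
    using one by (intro H10_density[OF op w] bounded_field_scaleR[OF M(2,3)] bounded_field_inner(1)[OF M]
        in_H1D[OF op vH]) (simp add: swap l2_inner_commute add.commute)
  then show ?thesis by (simp add: swap l2_inner_commute)
qed

lemma B_form_coercive:
  fixes \<beta> :: "'a::euclidean_space \<Rightarrow> 'a" and v :: "'a \<Rightarrow> real"
  assumes "open \<Omega>" "\<forall>i\<in>Basis. in_W1inf \<Omega> (\<lambda>x. \<beta> x \<bullet> i)"
    "AE x in lebesgue_on \<Omega>. wdiv \<Omega> \<beta> x = 0" "in_H10 \<Omega> v" "0 \<le> \<epsilon>" "0 \<le> \<sigma>"
  shows "B_form \<Omega> \<epsilon> \<beta> \<sigma> v v = (energy_norm \<Omega> \<epsilon> \<sigma> v)\<^sup>2"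
proof -
  have "l2_inner \<Omega> (\<lambda>x. \<beta> x \<bullet> wgrad \<Omega> v x) v = 0"
    using convection_skew_symmetric[OF assms(1-4) assms(4)] by (simp add: l2_inner_commute)
  then show ?thesis
    using assms(5,6) by (simp add: B_form_def energy_norm_power2 h1_seminorm_def l2_norm_power2)
qed

lemma B_form_lincomb_left:
  fixes \<beta> :: "'a::euclidean_space \<Rightarrow> 'a" and v w z :: "'a \<Rightarrow> real"
  assumes op: "open \<Omega>" and M: "M \<ge> 0" "\<beta> \<in> borel_measurable (lebesgue_on \<Omega>)" "AE x in lebesgue_on \<Omega>. norm (\<beta> x) \<le> M"
    and v: "in_H1 \<Omega> v" and w: "in_H1 \<Omega> w" and z: "in_H1 \<Omega> z"
  shows "B_form \<Omega> \<epsilon> \<beta> \<sigma> (\<lambda>x. a * v x + b * w x) z = a * B_form \<Omega> \<epsilon> \<beta> \<sigma> v z + b * B_form \<Omega> \<epsilon> \<beta> \<sigma> w z"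
proof -
  note I = in_H1_lincomb[OF op v w, of a b]
  note V = in_H1D(1,2)[OF op v] and W = in_H1D(1,2)[OF op w] and Z = in_H1D(1,2)[OF op z]
  note S = square_integrable_lincomb[OF V(2) W(2), of a b]
  have 1: "l2_inner \<Omega> (wgrad \<Omega> (\<lambda>x. a * v x + b * w x)) (wgrad \<Omega> z)
      = a * l2_inner \<Omega> (wgrad \<Omega> v) (wgrad \<Omega> z) + b * l2_inner \<Omega> (wgrad \<Omega> w) (wgrad \<Omega> z)"
    using l2_inner_cong_AE[OF square_integrable_measurable[OF in_H1D(2)[OF op I(1)]] square_integrable_measurable[OF S]
        square_integrable_measurable[OF Z(2)] square_integrable_measurable[OF Z(2)] I(2)]
      l2_inner_lincomb_left[OF V(2) W(2) Z(2), of a b] by simp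
  have ae: "AE x in lebesgue_on \<Omega>. \<beta> x \<bullet> wgrad \<Omega> (\<lambda>x. a * v x + b * w x) x
      = a *\<^sub>R (\<beta> x \<bullet> wgrad \<Omega> v x) + b *\<^sub>R (\<beta> x \<bullet> wgrad \<Omega> w x)"
    using I(2) by eventually_elim (simp add: inner_add_right)
  note BV = bounded_field_inner(1)[OF M V(2)] and BW = bounded_field_inner(1)[OF M W(2)]
  have 2: "l2_inner \<Omega> (\<lambda>x. \<beta> x \<bullet> wgrad \<Omega> (\<lambda>x. a * v x + b * w x) x) z
      = a * l2_inner \<Omega> (\<lambda>x. \<beta> x \<bullet> wgrad \<Omega> v x) z + b * l2_inner \<Omega> (\<lambda>x. \<beta> x \<bullet> wgrad \<Omega> w x) z"
    using l2_inner_cong_AE[OF square_integrable_measurable[OF bounded_field_inner(1)[OF M in_H1D(2)[OF op I(1)]]]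
        square_integrable_measurable[OF square_integrable_lincomb[OF BV BW, of a b]]
        square_integrable_measurable[OF Z(1)] square_integrable_measurable[OF Z(1)] ae]
      l2_inner_lincomb_left[OF BV BW Z(1), of a b] by simp
  have 3: "l2_inner \<Omega> (\<lambda>x. a * v x + b * w x) z = a * l2_inner \<Omega> v z + b * l2_inner \<Omega> w z"
    using l2_inner_lincomb_left[OF V(1) W(1) Z(1), of a b] by simp
  show ?thesis unfolding B_form_def 1 2 3 by (simp add: algebra_simps)
qed

text \<open>Only the diffusion term has to be integrated by parts, component by component: the first weak
derivatives of \<open>u\<close> again lie in \<open>H\<^sup>1\<close>, and \<open>v\<close> lies in \<open>H\<^sub>0\<^sup>1\<close>.\<close>

lemma strong_solution_weak_form:
  fixes \<beta> :: "'a::euclidean_space \<Rightarrow> 'a" and u v f :: "'a \<Rightarrow> real"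
  assumes op: "open \<Omega>" and M: "M \<ge> 0" "\<beta> \<in> borel_measurable (lebesgue_on \<Omega>)" "AE x in lebesgue_on \<Omega>. norm (\<beta> x) \<le> M"
    and u: "in_H2 \<Omega> u" and f: "square_integrable \<Omega> f" and v: "in_H10 \<Omega> v"
    and pde: "AE x in lebesgue_on \<Omega>. - \<epsilon> * wlaplace \<Omega> u x + \<beta> x \<bullet> wgrad \<Omega> u x + \<sigma> * u x = f x"
  shows "B_form \<Omega> \<epsilon> \<beta> \<sigma> u v = l2_inner \<Omega> f v"
proof -
  have H: "in_H1 \<Omega> u" "\<And>i. i \<in> Basis \<Longrightarrow> in_H1 \<Omega> (weak_deriv \<Omega> i u)" and vH: "in_H1 \<Omega> v"
    using u v by (auto simp: in_H2_def in_H10_def)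
  note U = in_H1D(1,2)[OF op H(1)] and V = in_H1D(1,2)[OF op vH]
  have S2: "square_integrable \<Omega> (weak_deriv \<Omega> i (weak_deriv \<Omega> i u))" if "i \<in> Basis" for i
    by (rule in_H1D(4)[OF op H(2)[OF that] that])
  have i1: "integrable (lebesgue_on \<Omega>) (\<lambda>x. \<Sum>i\<in>Basis. weak_deriv \<Omega> i (weak_deriv \<Omega> i u) x * v x)"
    by (intro Bochner_Integration.integrable_sum square_integrable_mult S2 V(1))
  note BU = bounded_field_inner(1)[OF M U(2)]
  have i2: "integrable (lebesgue_on \<Omega>) (\<lambda>x. (\<beta> x \<bullet> wgrad \<Omega> u x) * v x)"
    "integrable (lebesgue_on \<Omega>) (\<lambda>x. u x * v x)"
    by (intro square_integrable_mult BU V U)+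
  have "l2_inner \<Omega> f v = (LINT x|lebesgue_on \<Omega>. - \<epsilon> * (\<Sum>i\<in>Basis. weak_deriv \<Omega> i (weak_deriv \<Omega> i u) x * v x)
      + (\<beta> x \<bullet> wgrad \<Omega> u x) * v x + \<sigma> * (u x * v x))"
    unfolding l2_inner_def
  proof (rule integral_cong_AE)
    show "AE x in lebesgue_on \<Omega>. f x \<bullet> v x = - \<epsilon> * (\<Sum>i\<in>Basis. weak_deriv \<Omega> i (weak_deriv \<Omega> i u) x * v x)
      + (\<beta> x \<bullet> wgrad \<Omega> u x) * v x + \<sigma> * (u x * v x)"
      using pde
    proof eventually_elim
      case (elim x)
      have "f x \<bullet> v x = (- \<epsilon> * wlaplace \<Omega> u x + \<beta> x \<bullet> wgrad \<Omega> u x + \<sigma> * u x) * v x" using elim by simp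
      then show ?case by (simp add: wlaplace_def algebra_simps sum_distrib_left sum_distrib_right)
    qed
    show "(\<lambda>x. f x \<bullet> v x) \<in> borel_measurable (lebesgue_on \<Omega>)" using f V(1) by measurable
    show "(\<lambda>x. - \<epsilon> * (\<Sum>i\<in>Basis. weak_deriv \<Omega> i (weak_deriv \<Omega> i u) x * v x)
      + (\<beta> x \<bullet> wgrad \<Omega> u x) * v x + \<sigma> * (u x * v x)) \<in> borel_measurable (lebesgue_on \<Omega>)"
      using i1 i2 BU U(1) V(1)
      by (intro borel_measurable_add borel_measurable_times borel_measurable_const)
         (auto intro: square_integrable_measurable)
  qed
  also have "\<dots> = - \<epsilon> * (LINT x|lebesgue_on \<Omega>. (\<Sum>i\<in>Basis. weak_deriv \<Omega> i (weak_deriv \<Omega> i u) x * v x))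
      + l2_inner \<Omega> (\<lambda>x. \<beta> x \<bullet> wgrad \<Omega> u x) v + \<sigma> * l2_inner \<Omega> u v"
    using i1 i2 by (simp add: l2_inner_def)
  also have "(LINT x|lebesgue_on \<Omega>. (\<Sum>i\<in>Basis. weak_deriv \<Omega> i (weak_deriv \<Omega> i u) x * v x))
      = (\<Sum>i\<in>Basis. l2_inner \<Omega> (weak_deriv \<Omega> i (weak_deriv \<Omega> i u)) v)"
    by (subst Bochner_Integration.integral_sum) (auto simp: l2_inner_def intro: square_integrable_mult S2 V(1))
  also have "\<dots> = (\<Sum>i\<in>Basis. - l2_inner \<Omega> (weak_deriv \<Omega> i u) (weak_deriv \<Omega> i v))"
  proof (intro sum.cong refl)
    fix i :: 'a assume i: "i \<in> Basis"
    show "l2_inner \<Omega> (weak_deriv \<Omega> i (weak_deriv \<Omega> i u)) v = - l2_inner \<Omega> (weak_deriv \<Omega> i u) (weak_deriv \<Omega> i v)"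
      using weak_deriv_integration_by_parts[OF op v i in_H1D(4)[OF op H(1) i] S2[OF i] in_H1D(3)[OF op H(2)[OF i] i]]
      by simp
  qed
  also have "\<dots> = - l2_inner \<Omega> (wgrad \<Omega> u) (wgrad \<Omega> v)"
    by (simp add: l2_inner_components[OF U(2) V(2)] wgrad_inner sum_negf)
  finally show ?thesis by (simp add: B_form_def)
qed


section \<open>Barycentric coordinates and smooth cut-offs\<close>

text \<open>With \<open>d + 1\<close> affinely independent vertices every point has unique affine coordinates. Uniqueness forces
each coordinate to be an affine function, written here as \<open>x \<mapsto> a \<bullet> x + b\<close> by means of an adjoint.\<close>

lemma full_simplex_affine_coordinates:
  fixes C :: "'a::euclidean_space set"
  assumes ind: "\<not> affine_dependent C" and card: "card C = DIM('a) + 1"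
  obtains a :: "'a \<Rightarrow> 'a" and b :: "'a \<Rightarrow> real" where
    "\<And>x. (\<Sum>p\<in>C. a p \<bullet> x + b p) = 1" "\<And>x. (\<Sum>p\<in>C. (a p \<bullet> x + b p) *\<^sub>R p) = x"
    "\<And>c x p. (\<Sum>q\<in>C. c q) = 1 \<Longrightarrow> (\<Sum>q\<in>C. c q *\<^sub>R q) = x \<Longrightarrow> p \<in> C \<Longrightarrow> c p = a p \<bullet> x + b p"
proof -
  have fin: "finite C" using card card_ge_0_finite by force
  have uniq: "c p = d p"
    if "(\<Sum>q\<in>C. c q) = 1" "(\<Sum>q\<in>C. d q) = 1" "(\<Sum>q\<in>C. c q *\<^sub>R q) = (\<Sum>q\<in>C. d q *\<^sub>R q)" "p \<in> C"
    for c d p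
  proof (rule ccontr)
    assume "c p \<noteq> d p"
    then have "affine_dependent C"
      unfolding affine_dependent_explicit_finite[OF fin]
      using that by (intro exI[of _ "\<lambda>q. c q - d q"]) (auto simp: sum_subtractf scaleR_left_diff_distrib)
    with ind show False ..
  qed
  have "affine hull C = UNIV"
    using ind card by (intro affine_independent_span_gt) auto
  then have "\<forall>x. \<exists>c. (\<Sum>q\<in>C. c q) = 1 \<and> (\<Sum>q\<in>C. c q *\<^sub>R q) = x"
    unfolding affine_hull_finite[OF fin] by blast
  then obtain l where l: "\<And>x. (\<Sum>q\<in>C. l x q) = 1" "\<And>x. (\<Sum>q\<in>C. l x q *\<^sub>R q) = x"
    by metis
  have lin: "linear (\<lambda>x. l x p - l 0 p)" if p: "p \<in> C" for p
  proof (rule linearI)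
    fix x y :: 'a and r :: real
    have "l (x + y) p = l x p + l y p - l 0 p"
      by (rule uniq[OF _ _ _ p]) (simp_all add: l sum.distrib sum_subtractf scaleR_left_diff_distrib scaleR_left_distrib)
    then show "l (x + y) p - l 0 p = (l x p - l 0 p) + (l y p - l 0 p)" by simp
    have "l (r *\<^sub>R x) p = r * l x p + (1 - r) * l 0 p"
    proof (rule uniq[OF _ _ _ p])
      have "(\<Sum>q\<in>C. (r * l x q + (1 - r) * l 0 q) *\<^sub>R q)
          = r *\<^sub>R (\<Sum>q\<in>C. l x q *\<^sub>R q) + (1 - r) *\<^sub>R (\<Sum>q\<in>C. l 0 q *\<^sub>R q)"
        by (simp add: scaleR_left_distrib sum.distrib scaleR_sum_right)
      then show "(\<Sum>q\<in>C. l (r *\<^sub>R x) q *\<^sub>R q) = (\<Sum>q\<in>C. (r * l x q + (1 - r) * l 0 q) *\<^sub>R q)"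
        by (simp add: l)
    qed (simp_all add: l sum.distrib flip: sum_distrib_left)
    then show "l (r *\<^sub>R x) p - l 0 p = r *\<^sub>R (l x p - l 0 p)" by (simp add: algebra_simps)
  qed
  define a where "a p = adjoint (\<lambda>x. l x p - l 0 p) 1" for p
  have eq: "l x p = a p \<bullet> x + l 0 p" if p: "p \<in> C" for x p
    using adjoint_works[OF lin[OF p], of x 1] by (simp add: a_def inner_commute)
  show thesis
  proof (rule that[of a "l 0"])
    show "(\<Sum>p\<in>C. a p \<bullet> x + l 0 p) = 1" for x
      unfolding l(1)[of x, symmetric] by (intro sum.cong refl) (rule eq[symmetric])
    show "(\<Sum>p\<in>C. (a p \<bullet> x + l 0 p) *\<^sub>R p) = x" for x
      by (subst (2) l(2)[of x, symmetric], intro sum.cong refl arg_cong2[where f=scaleR]) (rule eq[symmetric])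
    fix c x p assume c: "(\<Sum>q\<in>C. c q) = 1" "(\<Sum>q\<in>C. c q *\<^sub>R q) = x" and p: "p \<in> C"
    have "c p = l x p" by (rule uniq[OF c(1) l(1) _ p]) (simp add: c(2) l(2))
    then show "c p = a p \<bullet> x + l 0 p" using eq[OF p, of x] by (rule trans)
  qed
qed

text \<open>The barycentric coordinates as affine functions, together with their signs and values that matter for bubbles:
the simplex is where all of them are nonnegative, they are at most one there, and their product
vanishes at every vertex.\<close>

lemma simplex_barycentric:
  fixes T :: "'a::euclidean_space set"
  assumes T: "int DIM('a) simplex T"
  obtains a :: "'a \<Rightarrow> 'a" and b :: "'a \<Rightarrow> real" where
    "finite (vertices T)" "vertices T \<noteq> {}" "T = convex hull (vertices T)"
    "\<And>p x. p \<in> vertices T \<Longrightarrow> barycentric T p x = a p \<bullet> x + b p"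
    "T = {x. \<forall>p\<in>vertices T. 0 \<le> a p \<bullet> x + b p}"
    "\<And>x p. x \<in> T \<Longrightarrow> p \<in> vertices T \<Longrightarrow> a p \<bullet> x + b p \<le> 1"
    "\<And>p. p \<in> vertices T \<Longrightarrow> (\<Prod>q\<in>vertices T. a q \<bullet> p + b q) = 0"
    "interior T \<noteq> {}"
proof -
  obtain C where C: "\<not> affine_dependent C" "card C = DIM('a) + 1" "T = convex hull C"
    using T by (auto simp: simplex_def)
  have fin: "finite C" using C(2) card_ge_0_finite by force
  have V: "vertices T = C"
    unfolding vertices_def C(3) using extreme_point_of_convex_hull_affine_independent[OF C(1)] by auto
  obtain a b where ab: "\<And>x. (\<Sum>p\<in>C. a p \<bullet> x + b p) = 1" "\<And>x. (\<Sum>p\<in>C. (a p \<bullet> x + b p) *\<^sub>R p) = x"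
    "\<And>c x p. (\<Sum>q\<in>C. c q) = 1 \<Longrightarrow> (\<Sum>q\<in>C. c q *\<^sub>R q) = x \<Longrightarrow> p \<in> C \<Longrightarrow> c p = a p \<bullet> x + b p"
    by (rule full_simplex_affine_coordinates[OF C(1,2)]) (rule that)
  have T_eq: "T = {x. \<forall>p\<in>C. 0 \<le> a p \<bullet> x + b p}"
  proof (intro set_eqI iffI)
    fix x assume "x \<in> T"
    then obtain u where u: "\<And>p. p \<in> C \<Longrightarrow> 0 \<le> u p" "(\<Sum>q\<in>C. u q) = 1" "(\<Sum>q\<in>C. u q *\<^sub>R q) = x"
      unfolding C(3) convex_hull_finite[OF fin] by auto
    then show "x \<in> {x. \<forall>p\<in>C. 0 \<le> a p \<bullet> x + b p}" using ab(3)[OF u(2,3)] by force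
  next
    fix x assume "x \<in> {x. \<forall>p\<in>C. 0 \<le> a p \<bullet> x + b p}"
    then show "x \<in> T" unfolding C(3) convex_hull_finite[OF fin] using ab(1,2)[of x]
      by (auto intro!: exI[of _ "\<lambda>p. a p \<bullet> x + b p"])
  qed
  show thesis
  proof (rule that[of a b, unfolded V])
    show "finite C" by (rule fin)
    show "C \<noteq> {}" using C(2) by auto
    show "T = convex hull C" by (rule C(3))
    show "T = {x. \<forall>p\<in>C. 0 \<le> a p \<bullet> x + b p}" by (rule T_eq)
    show "barycentric T p x = a p \<bullet> x + b p" if p: "p \<in> C" for p x
      unfolding barycentric_def V
    proof (rule the_equality)
      show "\<exists>c. (\<Sum>q\<in>C. c q) = 1 \<and> (\<Sum>q\<in>C. c q *\<^sub>R q) = x \<and> a p \<bullet> x + b p = c p"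
        using ab(1,2)[of x] by (intro exI[of _ "\<lambda>p. a p \<bullet> x + b p"]) auto
      show "t = a p \<bullet> x + b p" if "\<exists>c. (\<Sum>q\<in>C. c q) = 1 \<and> (\<Sum>q\<in>C. c q *\<^sub>R q) = x \<and> t = c p" for t
        using that ab(3)[OF _ _ p] by blast
    qed
    show "a p \<bullet> x + b p \<le> 1" if x: "x \<in> T" and p: "p \<in> C" for x p
    proof -
      have "a p \<bullet> x + b p \<le> (\<Sum>p\<in>C. a p \<bullet> x + b p)"
        using x by (intro member_le_sum[OF p] fin) (auto simp: T_eq)
      then show ?thesis by (simp add: ab(1))
    qed
    show "(\<Prod>q\<in>C. a q \<bullet> p + b q) = 0" if p: "p \<in> C" for p
    proof -
      have "C \<noteq> {p}" using C(2) by auto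
      then obtain q where q: "q \<in> C" "q \<noteq> p" using p by blast
      have "(\<Sum>r\<in>C. if r = p then 1 else 0 :: real) = 1" using p fin by simp
      moreover have "(\<Sum>r\<in>C. (if r = p then 1 else 0 :: real) *\<^sub>R r) = p"
      proof -
        have "(\<Sum>r\<in>C. (if r = p then 1 else 0 :: real) *\<^sub>R r) = (\<Sum>r\<in>C. if r = p then r else 0)"
          by (intro sum.cong) auto
        then show ?thesis using p fin by simp
      qed
      ultimately have "(if q = p then 1 else 0 :: real) = a q \<bullet> p + b q" by (rule ab(3)[OF _ _ q(1)])
      then show ?thesis using q fin by (intro prod_zero) auto
    qed
    show "interior T \<noteq> {}"
      using C interior_convex_hull_eq_empty[of C] by auto
  qed
qed

text \<open>Dominated convergence, with a multiple of the indicator function of the compact set as majorant.\<close>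

lemma l2_tendsto_dominated:
  fixes f :: "nat \<Rightarrow> 'a::euclidean_space \<Rightarrow> 'b::euclidean_space"
  assumes S: "S \<in> sets lebesgue" and K: "compact K"
    and m: "\<And>n. f n \<in> borel_measurable (lebesgue_on S)"
    and bd: "\<And>n x. norm (f n x) \<le> B * indicator K x"
    and lim: "\<And>x. (\<lambda>n. f n x) \<longlonglongrightarrow> g x"
  shows "square_integrable S (f n)" "square_integrable S g" "(\<lambda>n. l2_norm S (\<lambda>x. g x - f n x)) \<longlonglongrightarrow> 0"
proof -
  have ind: "integrable (lebesgue_on S) (\<lambda>x. c * indicator K x :: real)" for c
  proof -
    have "S \<inter> K \<in> lmeasurable"
      using S K by (metis fmeasurable_Int_fmeasurable inf_commute lmeasurable_compact)
    then have "integrable lebesgue (indicator (S \<inter> K) :: 'a \<Rightarrow> real)" using lmeasurable_iff_integrable by blast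
    moreover have "(\<lambda>x. indicator S x *\<^sub>R indicator K x) = (indicator (S \<inter> K) :: 'a \<Rightarrow> real)"
      by (auto simp: fun_eq_iff indicator_def)
    ultimately have "integrable (lebesgue_on S) (indicator K :: 'a \<Rightarrow> real)"
      using S by (simp add: integrable_restrict_space)
    then show ?thesis by (rule integrable_mult_right)
  qed
  have mg: "g \<in> borel_measurable (lebesgue_on S)"
    by (rule borel_measurable_LIMSEQ_metric[OF m lim])
  have bg: "norm (g x) \<le> B * indicator K x" for x
    by (rule LIMSEQ_le_const2[OF tendsto_norm[OF lim]]) (use bd in auto)
  have sq: "square_integrable S h" if "h \<in> borel_measurable (lebesgue_on S)" "\<And>x. norm (h x) \<le> B * indicator K x"
    for h :: "'a \<Rightarrow> 'b"
    unfolding square_integrable_def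
  proof
    show "integrable (lebesgue_on S) (\<lambda>x. (norm (h x))\<^sup>2)"
    proof (rule Bochner_Integration.integrable_bound[OF ind[of "B\<^sup>2"]])
      show "(\<lambda>x. (norm (h x))\<^sup>2) \<in> borel_measurable (lebesgue_on S)" using that(1) by measurable
      show "AE x in lebesgue_on S. norm ((norm (h x))\<^sup>2) \<le> norm (B\<^sup>2 * indicator K x :: real)"
      proof (rule AE_I2)
        fix x
        have "(norm (h x))\<^sup>2 \<le> (B * indicator K x)\<^sup>2" using that(2) by (intro power_mono) auto
        then show "norm ((norm (h x))\<^sup>2) \<le> norm (B\<^sup>2 * indicator K x :: real)"
          by (auto simp: power_mult_distrib indicator_def)
      qed
    qed
  qed (rule that(1))
  show 1: "square_integrable S (f n)" for n by (rule sq[OF m bd])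
  show 2: "square_integrable S g" by (rule sq[OF mg bg])
  have "(\<lambda>n. LINT x|lebesgue_on S. (norm (g x - f n x))\<^sup>2) \<longlonglongrightarrow> (LINT x|lebesgue_on S. 0)"
  proof (rule integral_dominated_convergence)
    show "integrable (lebesgue_on S) (\<lambda>x. (2 * B)\<^sup>2 * indicator K x :: real)" by (rule ind)
    show "AE x in lebesgue_on S. (\<lambda>n. (norm (g x - f n x))\<^sup>2) \<longlonglongrightarrow> 0"
    proof (rule AE_I2)
      fix x
      have "(\<lambda>n. (norm (g x - f n x))\<^sup>2) \<longlonglongrightarrow> (norm (g x - g x))\<^sup>2" by (intro tendsto_intros lim)
      then show "(\<lambda>n. (norm (g x - f n x))\<^sup>2) \<longlonglongrightarrow> 0" by simp
    qed
    show "AE x in lebesgue_on S. norm ((norm (g x - f n x))\<^sup>2) \<le> (2 * B)\<^sup>2 * indicator K x" for n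
    proof (rule AE_I2)
      fix x
      have "norm (g x - f n x) \<le> 2 * B * indicator K x"
        using norm_triangle_ineq4[of "g x" "f n x"] bg[of x] bd[of n x] by simp
      then have "(norm (g x - f n x))\<^sup>2 \<le> (2 * B * indicator K x)\<^sup>2" by (intro power_mono) auto
      then show "norm ((norm (g x - f n x))\<^sup>2) \<le> (2 * B)\<^sup>2 * indicator K x"
        by (auto simp: power_mult_distrib indicator_def)
    qed
    show "(\<lambda>x. (norm (g x - f n x))\<^sup>2) \<in> borel_measurable (lebesgue_on S)" for n
      using mg m by measurable
  qed simp
  then have "(\<lambda>n. sqrt (l2_inner S (\<lambda>x. g x - f n x) (\<lambda>x. g x - f n x))) \<longlonglongrightarrow> sqrt 0"
    by (intro tendsto_real_sqrt) (simp add: l2_inner_def power2_norm_eq_inner)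
  then show "(\<lambda>n. l2_norm S (\<lambda>x. g x - f n x)) \<longlonglongrightarrow> 0" by (simp add: l2_norm_def)
qed

lemma has_weak_deriv_limit:
  fixes f :: "'a::euclidean_space \<Rightarrow> real"
  assumes op: "open \<Omega>" and i: "i \<in> Basis" and wd: "\<And>n. has_weak_deriv \<Omega> i (F n) (G n)"
    and sq: "\<And>n. square_integrable \<Omega> (F n)" "\<And>n. square_integrable \<Omega> (G n)"
      "square_integrable \<Omega> f" "square_integrable \<Omega> g"
    and lim: "(\<lambda>n. l2_norm \<Omega> (\<lambda>x. f x - F n x)) \<longlonglongrightarrow> 0" "(\<lambda>n. l2_norm \<Omega> (\<lambda>x. g x - G n x)) \<longlonglongrightarrow> 0"
  shows "has_weak_deriv \<Omega> i f g"
  unfolding has_weak_deriv_def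
proof (intro conjI allI impI)
  show "loc_integrable \<Omega> f" "loc_integrable \<Omega> g"
    using op sq by (auto intro: square_integrable_loc_integrable)
  fix \<psi> assume \<psi>: "test_function \<Omega> \<psi>"
  note S = test_function_square_integrable[OF op \<psi>] test_function_square_integrable[OF op test_function_deriv[OF \<psi> i]]
  have a: "(\<lambda>n. l2_inner \<Omega> (F n) (\<lambda>x. frechet_derivative \<psi> (at x) i)) \<longlonglongrightarrow> l2_inner \<Omega> f (\<lambda>x. frechet_derivative \<psi> (at x) i)"
    by (intro l2_inner_tendsto sq lim S)
  have "(\<lambda>n. - l2_inner \<Omega> (G n) \<psi>) \<longlonglongrightarrow> - l2_inner \<Omega> g \<psi>"
    by (intro tendsto_minus l2_inner_tendsto sq lim S)
  moreover have "l2_inner \<Omega> (F n) (\<lambda>x. frechet_derivative \<psi> (at x) i) = - l2_inner \<Omega> (G n) \<psi>" for n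
    using wd[of n] \<psi> by (simp add: has_weak_deriv_def l2_inner_def)
  ultimately have "l2_inner \<Omega> f (\<lambda>x. frechet_derivative \<psi> (at x) i) = - l2_inner \<Omega> g \<psi>"
    using a LIMSEQ_unique by simp
  then show "(LINT x|lebesgue_on \<Omega>. f x * frechet_derivative \<psi> (at x) i) = - (LINT x|lebesgue_on \<Omega>. g x * \<psi> x)"
    by (simp add: l2_inner_def)
qed

text \<open>A smooth approximation of the positive part that is zero for \<open>t \<le> 1 / (n + 1)\<close>. The step from zero to one has
a derivative of order \<open>n\<close>, but it is steep only for \<open>t\<close> of order \<open>1 / n\<close>, where the factor \<open>t\<close> compensates;
so the derivative is bounded uniformly in \<open>n\<close>.\<close>

definition cutoff :: "nat \<Rightarrow> real \<Rightarrow> real" where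
  "cutoff n t = t * flat_exp 0 (real (Suc n) * t - 1)"

definition cutoff_deriv :: "nat \<Rightarrow> real \<Rightarrow> real" where
  "cutoff_deriv n t = flat_exp 0 (real (Suc n) * t - 1) + t * (real (Suc n) * flat_exp 1 (real (Suc n) * t - 1))"

lemma cutoff_has_deriv: "(cutoff n has_real_derivative cutoff_deriv n t) (at t)"
proof -
  have "((\<lambda>t. flat_exp 0 (real (Suc n) * t - 1)) has_real_derivative flat_exp 1 (real (Suc n) * t - 1) * real (Suc n)) (at t)"
    using flat_exp_deriv[of 0 "real (Suc n) * t - 1"]
    by (intro DERIV_chain2[where g="\<lambda>t. real (Suc n) * t - 1"]) (auto intro!: derivative_eq_intros)
  from DERIV_mult[OF DERIV_ident this] show ?thesis
    by (simp add: cutoff_def[abs_def] cutoff_deriv_def algebra_simps)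
qed

lemma cutoff_zero: "real (Suc n) * t \<le> 1 \<Longrightarrow> cutoff n t = 0" "real (Suc n) * t \<le> 1 \<Longrightarrow> cutoff_deriv n t = 0"
  by (simp_all add: cutoff_def cutoff_deriv_def flat_exp_bounds)

lemma cutoff_bound: "\<bar>cutoff n t\<bar> \<le> \<bar>t\<bar>"
  using flat_exp_bounds(1,2)[of "real (Suc n) * t - 1"]
  by (simp add: cutoff_def abs_mult mult_left_le)

text \<open>Written in \<open>z = 1 / ((n + 1) t - 1)\<close>, the only term of the derivative that could be large is
\<open>(z + z\<^sup>2) exp (- z)\<close>: it is bounded for \<open>z > 0\<close>, and it tends to zero with \<open>z\<close>.\<close>

lemma cutoff_deriv_form:
  assumes "real (Suc n) * t - 1 > 0"
  shows "t * (real (Suc n) * flat_exp 1 (real (Suc n) * t - 1))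
    = (1 / (real (Suc n) * t - 1) + (1 / (real (Suc n) * t - 1))\<^sup>2) * exp (- (1 / (real (Suc n) * t - 1)))"
proof -
  define y where "y = real (Suc n) * t - 1"
  have y: "y > 0" using assms by (simp add: y_def)
  have "flat_exp 1 y = (1 / y)\<^sup>2 * exp (- (1 / y))"
    using y by (simp add: flat_exp_def power2_eq_square)
  moreover have "t * real (Suc n) = y + 1" by (simp add: y_def)
  ultimately have "t * (real (Suc n) * flat_exp 1 y) = (y + 1) * ((1 / y)\<^sup>2 * exp (- (1 / y)))"
    by (simp flip: mult.assoc)
  also have "\<dots> = (1 / y + (1 / y)\<^sup>2) * exp (- (1 / y))"
    using y by (simp add: power2_eq_square field_simps)
  finally show ?thesis by (simp add: y_def)
qed

lemma cutoff_deriv_bound: "\<bar>cutoff_deriv n t\<bar> \<le> 4"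
proof (cases "real (Suc n) * t - 1 > 0")
  case True
  define z where "z = 1 / (real (Suc n) * t - 1)"
  have z: "z > 0" using True by (simp add: z_def)
  have "z \<le> exp z" using exp_ge_add_one_self[of z] by linarith
  moreover have "z\<^sup>2 \<le> 2 * exp z" using exp_lower_Taylor_quadratic[of z] z by simp
  ultimately have "(z + z\<^sup>2) * exp (- z) \<le> 3"
    by (simp add: exp_minus field_simps)
  moreover have "0 \<le> (z + z\<^sup>2) * exp (- z)" using z by simp
  ultimately show ?thesis
    using flat_exp_bounds(1,2)[of "real (Suc n) * t - 1"] cutoff_deriv_form[OF True]
    unfolding cutoff_deriv_def z_def by linarith
qed (simp add: cutoff_zero)

lemma shift_tendsto_infinity:
  "t > 0 \<Longrightarrow> filterlim (\<lambda>n. real (Suc n) * t - 1) at_top sequentially"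
proof -
  assume t: "t > 0"
  have "filterlim (\<lambda>n. real n * t) at_top sequentially"
    using t by (intro filterlim_at_top_mult_tendsto_pos[OF tendsto_const _ filterlim_real_sequentially]) auto
  then have "filterlim (\<lambda>n. (t - 1) + real n * t) at_top sequentially"
    by (intro filterlim_tendsto_add_at_top[OF tendsto_const])
  then show ?thesis by (simp add: algebra_simps)
qed

lemma inverse_shift_tendsto_zero:
  assumes "t > 0" shows "(\<lambda>n. 1 / (real (Suc n) * t - 1)) \<longlonglongrightarrow> 0"
  by (rule tendsto_divide_0[OF tendsto_const filterlim_at_top_imp_at_infinity[OF shift_tendsto_infinity[OF assms]]])

lemma flat_exp_shift_tendsto:
  assumes "t > 0" shows "(\<lambda>n. flat_exp 0 (real (Suc n) * t - 1)) \<longlonglongrightarrow> 1"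
proof -
  have "(\<lambda>n. exp (- (1 / (real (Suc n) * t - 1)))) \<longlonglongrightarrow> exp (- 0)"
    by (intro tendsto_intros inverse_shift_tendsto_zero assms)
  moreover have "\<forall>\<^sub>F n in sequentially. exp (- (1 / (real (Suc n) * t - 1))) = flat_exp 0 (real (Suc n) * t - 1)"
    using filterlim_at_top_dense[THEN iffD1, rule_format, OF shift_tendsto_infinity[OF assms], of 0]
    by eventually_elim (simp add: flat_exp_def)
  ultimately show ?thesis using Lim_transform_eventually by fastforce
qed

lemma cutoff_tendsto: "(\<lambda>n. cutoff n t) \<longlonglongrightarrow> max t 0"
proof (cases "t > 0")
  case True
  have "(\<lambda>n. t * flat_exp 0 (real (Suc n) * t - 1)) \<longlonglongrightarrow> t * 1"
    by (intro tendsto_intros flat_exp_shift_tendsto True)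
  then show ?thesis using True by (simp add: cutoff_def)
next
  case False
  then have "real (Suc n) * t \<le> 1" for n by (smt (verit) mult_nonneg_nonpos of_nat_0_le_iff)
  then show ?thesis using False by (simp add: cutoff_zero)
qed

lemma cutoff_deriv_tendsto: "(\<lambda>n. cutoff_deriv n t) \<longlonglongrightarrow> (if t > 0 then 1 else 0)"
proof (cases "t > 0")
  case True
  let ?z = "\<lambda>n. 1 / (real (Suc n) * t - 1)"
  have "(\<lambda>n. flat_exp 0 (real (Suc n) * t - 1) + (?z n + (?z n)\<^sup>2) * exp (- ?z n)) \<longlonglongrightarrow> 1 + (0 + 0\<^sup>2) * exp (- 0)"
    by (intro tendsto_intros flat_exp_shift_tendsto inverse_shift_tendsto_zero True)
  moreover have "\<forall>\<^sub>F n in sequentially. flat_exp 0 (real (Suc n) * t - 1) + (?z n + (?z n)\<^sup>2) * exp (- ?z n) = cutoff_deriv n t"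
    using filterlim_at_top_dense[THEN iffD1, rule_format, OF shift_tendsto_infinity[OF True], of 0]
  proof eventually_elim
    case (elim n)
    then show ?case using cutoff_deriv_form[of n t] by (simp only: cutoff_deriv_def)
  qed
  ultimately have "(\<lambda>n. cutoff_deriv n t) \<longlonglongrightarrow> 1 + (0 + 0\<^sup>2) * exp (- 0)" by (rule Lim_transform_eventually)
  then show ?thesis using True by simp
next
  case False
  then have "real (Suc n) * t \<le> 1" for n by (smt (verit) mult_nonneg_nonpos of_nat_0_le_iff)
  then show ?thesis using False by (simp add: cutoff_zero)
qed


section \<open>Bubble functions\<close>

text \<open>The approximations are the products of the cut-off barycentric coordinates. Each vanishes unless all
coordinates exceed \<open>1 / (n + 1)\<close>, so its support is a compact subset of the interior. Values and gradients
are uniformly bounded and converge pointwise, to the bubble and to its classical gradient.\<close>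

lemma bubble_approximation:
  fixes T \<Omega> :: "'a::euclidean_space set"
  assumes op: "open \<Omega>" and T: "int DIM('a) simplex T" and sub: "interior T \<subseteq> \<Omega>"
  obtains \<phi> where "\<And>n::nat. test_function (interior T) (\<phi> n)" "in_H1 \<Omega> (bubble T)"
    "(\<lambda>n. l2_norm \<Omega> (\<lambda>x. bubble T x - \<phi> n x)) \<longlonglongrightarrow> 0"
    "(\<lambda>n. l2_norm \<Omega> (\<lambda>x. wgrad \<Omega> (bubble T) x - wgrad \<Omega> (\<phi> n) x)) \<longlonglongrightarrow> 0"
proof -
  obtain a b where ab: "finite (vertices T)" "vertices T \<noteq> {}" "T = convex hull (vertices T)"
    "\<And>p x. p \<in> vertices T \<Longrightarrow> barycentric T p x = a p \<bullet> x + b p"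
    "T = {x. \<forall>p\<in>vertices T. 0 \<le> a p \<bullet> x + b p}"
    "\<And>x p. x \<in> T \<Longrightarrow> p \<in> vertices T \<Longrightarrow> a p \<bullet> x + b p \<le> 1"
    "\<And>p. p \<in> vertices T \<Longrightarrow> (\<Prod>q\<in>vertices T. a q \<bullet> p + b q) = 0"
    "interior T \<noteq> {}"
    by (rule simplex_barycentric[OF T]) (rule that)
  define V where "V = vertices T"
  define lam where "lam p x = a p \<bullet> x + b p" for p x
  define \<phi> where "\<phi> n x = (\<Prod>p\<in>V. cutoff n (lam p x))" for n x
  define G where "G n x = (\<Sum>p\<in>V. (cutoff_deriv n (lam p x) * (\<Prod>q\<in>V-{p}. cutoff n (lam q x))) *\<^sub>R a p)" for n x
  define H where "H x = (\<Sum>p\<in>V. ((if lam p x > 0 then 1 else 0) * (\<Prod>q\<in>V-{p}. max (lam q x) 0)) *\<^sub>R a p)" for x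
  have fin: "finite V" using ab(1) by (simp add: V_def)
  have memT: "x \<in> T \<longleftrightarrow> (\<forall>p\<in>V. 0 \<le> lam p x)" for x
    using ab(5) by (auto simp: V_def lam_def)
  have le1: "lam p x \<le> 1" if "x \<in> T" "p \<in> V" for p x using ab(6) that by (auto simp: V_def lam_def)
  have cT: "compact T" using ab(3) finite_imp_compact_convex_hull[OF ab(1)] by simp
  have bub: "bubble T x = (\<Prod>p\<in>V. max (lam p x) 0)" for x
  proof (cases "x \<in> T")
    case True
    then show ?thesis using ab(4) memT by (auto simp: bubble_def V_def lam_def intro!: prod.cong)
  next
    case False
    then obtain p where p: "p \<in> V" "\<not> 0 \<le> lam p x" using memT by blast
    then have "(\<Prod>p\<in>V. max (lam p x) 0) = 0"
      using fin by (intro prod_zero) (auto intro!: bexI[of _ p])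
    then show ?thesis using False by (simp add: bubble_def)
  qed
  have open_pos: "{x. \<forall>p\<in>V. 0 < lam p x} \<subseteq> interior T"
  proof (rule interior_maximal)
    have "{x. \<forall>p\<in>V. 0 < lam p x} = (\<Inter>p\<in>V. {x. 0 < lam p x})" by auto
    also have "open \<dots>" unfolding lam_def by (intro open_INT fin ballI open_Collect_less continuous_intros)
    finally show "open {x. \<forall>p\<in>V. 0 < lam p x}" .
  qed (auto simp: memT less_imp_le)
  have test: "test_function (interior T) (\<phi> n)" for n
  proof (rule test_function_zero_outside)
    \<comment> \<open>closed, and a subset of \<open>T\<close> because all coordinates are nonnegative on it; hence compact\<close>
    define K where "K = {x. \<forall>p\<in>V. 1 / real (Suc n) \<le> lam p x}"
    have sub: "K \<subseteq> {x. \<forall>p\<in>V. 0 < lam p x}"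
    proof
      fix x assume x: "x \<in> K"
      have "0 < lam p x" if "p \<in> V" for p
      proof (rule less_le_trans)
        show "0 < 1 / real (Suc n)" by simp
      qed (use x that in \<open>simp add: K_def\<close>)
      then show "x \<in> {x. \<forall>p\<in>V. 0 < lam p x}" by simp
    qed
    then show "K \<subseteq> interior T" using open_pos by blast
    have "K = (\<Inter>p\<in>V. {x. 1 / real (Suc n) \<le> lam p x})" by (auto simp: K_def)
    also have "closed \<dots>" unfolding lam_def by (intro closed_INT ballI closed_Collect_le continuous_intros)
    finally have "closed K" .
    moreover have "T \<inter> K = K" using \<open>K \<subseteq> interior T\<close> interior_subset by blast
    ultimately show "compact K" using compact_Int_closed[OF cT, of K] by simp
    show "\<phi> n x = 0" if x: "x \<notin> K" for x
    proof -
      obtain p where p: "p \<in> V" "lam p x < 1 / real (Suc n)" using x by (auto simp: K_def not_le)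
      then have "real (Suc n) * lam p x \<le> 1" by (simp add: field_simps)
      then show ?thesis unfolding \<phi>_def using p(1) fin cutoff_zero(1) by (intro prod_zero) blast+
    qed
    have l: "Ck k (lam p)" for k p
      using Ck_add[OF Ck_inner Ck_const, of k "a p" "b p"] by (simp add: lam_def[abs_def])
    have "Ck k (\<lambda>x. cutoff n (lam p x))" for k p
      unfolding cutoff_def
      using Ck_mult[OF l Ck_flat_exp[OF Ck_add[OF Ck_mult[OF Ck_const l] Ck_const]], of k p 0 "real (Suc n)" p "-1"]
      by simp
    then show "Ck k (\<phi> n)" for k unfolding \<phi>_def by (intro Ck_prod)
  qed
  have deriv: "(\<phi> n has_derivative (\<lambda>h. G n x \<bullet> h)) (at x)" for n x
  proof -
    have d: "((\<lambda>x. cutoff n (lam p x)) has_derivative (\<lambda>h. cutoff_deriv n (lam p x) * (a p \<bullet> h))) (at x)" for p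
    proof -
      have 1: "(lam p has_derivative (\<lambda>h. a p \<bullet> h)) (at x)"
        unfolding lam_def[abs_def] by (auto intro!: derivative_eq_intros)
      have 2: "(cutoff n has_derivative (\<lambda>h. cutoff_deriv n (lam p x) * h)) (at (lam p x))"
        by (rule has_field_derivative_imp_has_derivative[OF cutoff_has_deriv])
      from has_derivative_compose[OF 1 2] show ?thesis .
    qed
    have "((\<lambda>x. \<Prod>p\<in>V. cutoff n (lam p x)) has_derivative
       (\<lambda>h. \<Sum>p\<in>V. (cutoff_deriv n (lam p x) * (a p \<bullet> h)) * (\<Prod>q\<in>V - {p}. cutoff n (lam q x)))) (at x)"
      by (rule has_derivative_prod) (rule d)
    then show ?thesis
      unfolding \<phi>_def[abs_def]
      by (rule has_derivative_eq_rhs) (auto simp: G_def inner_sum_left fun_eq_iff mult_ac)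
  qed
  have frech: "frechet_derivative (\<phi> n) (at x) i = G n x \<bullet> i" for n x i
    using frechet_derivative_at[OF deriv[of n x]] by metis
  have testO: "test_function \<Omega> (\<phi> n)" for n by (rule test_function_mono[OF test sub])
  have out: "\<exists>p\<in>V. real (Suc n) * lam p x \<le> 1 \<and> lam p x < 0" if notT: "x \<notin> T" for n x
  proof -
    obtain p where "p \<in> V" "\<not> 0 \<le> lam p x" using notT memT by blast
    then have p: "p \<in> V" "lam p x < 0" by auto
    then have "real (Suc n) * lam p x \<le> 0" by (intro mult_nonneg_nonpos) auto
    then show ?thesis using p by (intro bexI[of _ p]) auto
  qed
  have prod_le: "\<bar>\<Prod>q\<in>W. cutoff n (lam q x)\<bar> \<le> 1" if "W \<subseteq> V" "x \<in> T" for W n x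
    unfolding abs_prod
  proof (rule prod_le_1)
    fix q assume "q \<in> W"
    then have "q \<in> V" using that by blast
    then have "\<bar>lam q x\<bar> \<le> 1" using memT le1 that by auto
    then show "0 \<le> \<bar>cutoff n (lam q x)\<bar> \<and> \<bar>cutoff n (lam q x)\<bar> \<le> 1" using cutoff_bound[of n "lam q x"] by auto
  qed
  have bd0: "norm (\<phi> n x) \<le> 1 * indicator T x" for n x
  proof (cases "x \<in> T")
    case False
    then obtain p where p: "p \<in> V" "real (Suc n) * lam p x \<le> 1" using out by blast
    then have "\<phi> n x = 0" unfolding \<phi>_def using fin cutoff_zero(1) by (intro prod_zero) blast+
    then show ?thesis by simp
  qed (use prod_le in \<open>simp add: \<phi>_def\<close>)
  have bd1: "norm (G n x) \<le> (\<Sum>p\<in>V. 4 * norm (a p)) * indicator T x" for n x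
  proof (cases "x \<in> T")
    case False
    then obtain p where p: "p \<in> V" "real (Suc n) * lam p x \<le> 1" using out by blast
    have "(cutoff_deriv n (lam q x) * (\<Prod>r\<in>V-{q}. cutoff n (lam r x))) *\<^sub>R a q = 0" if "q \<in> V" for q
    proof (cases "q = p")
      case False
      then have "(\<Prod>r\<in>V-{q}. cutoff n (lam r x)) = 0"
        using p fin cutoff_zero(1)[OF p(2)] by (intro prod_zero) (auto intro!: bexI[of _ p])
      then show ?thesis by simp
    qed (use cutoff_zero(2)[OF p(2)] in simp)
    then have "G n x = 0" unfolding G_def by (intro sum.neutral ballI)
    then show ?thesis by (simp add: sum_nonneg)
  next
    case True
    have "norm (G n x) \<le> (\<Sum>p\<in>V. norm ((cutoff_deriv n (lam p x) * (\<Prod>q\<in>V-{p}. cutoff n (lam q x))) *\<^sub>R a p))"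
      unfolding G_def by (rule norm_sum)
    also have "\<dots> \<le> (\<Sum>p\<in>V. 4 * norm (a p))"
    proof (rule sum_mono)
      fix p assume "p \<in> V"
      have "\<bar>cutoff_deriv n (lam p x)\<bar> * \<bar>\<Prod>q\<in>V-{p}. cutoff n (lam q x)\<bar> \<le> 4 * 1"
        by (intro mult_mono cutoff_deriv_bound prod_le True) auto
      then show "norm ((cutoff_deriv n (lam p x) * (\<Prod>q\<in>V-{p}. cutoff n (lam q x))) *\<^sub>R a p) \<le> 4 * norm (a p)"
        by (simp add: abs_mult mult_right_mono)
    qed
    finally show ?thesis using True by simp
  qed
  have m0: "\<phi> n \<in> borel_measurable (lebesgue_on \<Omega>)" for n
    by (rule borel_measurable_lebesgue_on_continuous[OF test_functionD(3)[OF testO]])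
  have m1: "G n \<in> borel_measurable (lebesgue_on \<Omega>)" for n
    using test_functionD(4)[OF testO]
    by (subst borel_measurable_euclidean_space) (auto simp: frech intro: borel_measurable_lebesgue_on_continuous)
  have lim0: "(\<lambda>n. \<phi> n x) \<longlonglongrightarrow> bubble T x" for x
    unfolding \<phi>_def bub by (intro tendsto_prod cutoff_tendsto)
  have lim1: "(\<lambda>n. G n x) \<longlonglongrightarrow> H x" for x
    unfolding G_def H_def by (intro tendsto_sum tendsto_scaleR tendsto_mult tendsto_prod cutoff_tendsto cutoff_deriv_tendsto tendsto_const)
  have mO: "\<Omega> \<in> sets lebesgue" using op by simp
  note D0 = l2_tendsto_dominated[OF mO cT m0 bd0 lim0]
  note D1 = l2_tendsto_dominated[OF mO cT m1 bd1 lim1]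
  have wd\<phi>: "has_weak_deriv \<Omega> i (\<phi> n) (\<lambda>x. G n x \<bullet> i)" if "i \<in> Basis" for i n
    using test_function_has_weak_deriv[OF op testO that] by (simp add: frech)
  have wdb: "has_weak_deriv \<Omega> i (bubble T) (\<lambda>x. H x \<bullet> i)" if i: "i \<in> Basis" for i
  proof (rule has_weak_deriv_limit[OF op i wd\<phi>[OF i] D0(1) _ D0(2) _ D0(3)])
    show "square_integrable \<Omega> (\<lambda>x. G n x \<bullet> i)" "square_integrable \<Omega> (\<lambda>x. H x \<bullet> i)" for n
      using D1(1,2) i square_integrable_components[of \<Omega> "G n"] square_integrable_components[of \<Omega> H] by auto
    show "(\<lambda>n. l2_norm \<Omega> (\<lambda>x. H x \<bullet> i - G n x \<bullet> i)) \<longlonglongrightarrow> 0"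
    proof (rule tendsto_sandwich[OF _ _ tendsto_const D1(3)])
      show "\<forall>\<^sub>F n in sequentially. l2_norm \<Omega> (\<lambda>x. H x \<bullet> i - G n x \<bullet> i) \<le> l2_norm \<Omega> (\<lambda>x. H x - G n x)"
        using l2_norm_component_le[OF square_integrable_diff[OF D1(2,1)] i] by (simp add: inner_diff_left)
    qed (simp add: l2_norm_nonneg)
  qed
  have H1: "in_H1 \<Omega> (bubble T)" by (rule in_H1I[OF D0(2) D1(2) wdb])
  have g0: "AE x in lebesgue_on \<Omega>. wgrad \<Omega> (bubble T) x = H x"
    by (rule wgrad_AE[OF op]) (rule wdb)
  have g1: "AE x in lebesgue_on \<Omega>. wgrad \<Omega> (\<phi> n) x = G n x" for n
    by (rule wgrad_AE[OF op]) (rule wd\<phi>)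
  have "l2_norm \<Omega> (\<lambda>x. wgrad \<Omega> (bubble T) x - wgrad \<Omega> (\<phi> n) x) = l2_norm \<Omega> (\<lambda>x. H x - G n x)" for n
  proof (rule l2_norm_cong_AE)
    show "AE x in lebesgue_on \<Omega>. wgrad \<Omega> (bubble T) x - wgrad \<Omega> (\<phi> n) x = H x - G n x"
      using g0 g1[of n] by eventually_elim simp
  qed (intro square_integrable_measurable square_integrable_diff D1 in_H1D(2)[OF op] H1 test_function_in_H1(1)[OF op testO])+
  then show thesis using that[OF test H1 D0(3)] D1(3) by simp
qed

lemma bubble_in_H10:
  fixes T \<Omega> :: "'a::euclidean_space set"
  assumes op: "open \<Omega>" and T: "int DIM('a) simplex T" and sub: "interior T \<subseteq> \<Omega>"
  shows "in_H10 \<Omega> (bubble T)"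
proof -
  obtain \<phi> where "\<And>n::nat. test_function (interior T) (\<phi> n)" "in_H1 \<Omega> (bubble T)"
    "(\<lambda>n. l2_norm \<Omega> (\<lambda>x. bubble T x - \<phi> n x)) \<longlonglongrightarrow> 0"
    "(\<lambda>n. l2_norm \<Omega> (\<lambda>x. wgrad \<Omega> (bubble T) x - wgrad \<Omega> (\<phi> n) x)) \<longlonglongrightarrow> 0"
    by (rule bubble_approximation[OF assms]) (rule that)
  then show ?thesis by (intro in_H10I[OF op] test_function_mono[OF _ sub])
qed

text \<open>Moving the derivative from \<open>v\<close> to the test function replaces \<open>v\<close> by its affine expression; a
second integration by parts leaves a multiple of the integral of \<open>\<partial>\<^sub>i \<phi>\<close>, which is zero.\<close>

lemma affine_deriv_test_orthogonal:
  fixes T \<Omega> :: "'a::euclidean_space set" and v \<phi> :: "'a \<Rightarrow> real"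
  assumes op: "open \<Omega>" and sub: "interior T \<subseteq> \<Omega>" and v: "in_H1 \<Omega> v"
    and aff: "\<And>x. x \<in> T \<Longrightarrow> v x = a \<bullet> x + b" and \<phi>: "test_function (interior T) \<phi>" and i: "i \<in> Basis"
  shows "l2_inner \<Omega> (weak_deriv \<Omega> i v) (\<lambda>x. frechet_derivative \<phi> (at x) i) = 0"
proof -
  define \<psi> where "\<psi> x = frechet_derivative \<phi> (at x) i" for x
  have \<psi>: "test_function (interior T) \<psi>"
    unfolding \<psi>_def by (rule test_function_deriv[OF \<phi> i])
  obtain L where L: "compact L" "L \<subseteq> interior T" "\<And>x. x \<notin> L \<Longrightarrow> \<phi> x = 0"
    "\<And>x h. x \<notin> L \<Longrightarrow> frechet_derivative \<phi> (at x) h = 0"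
    by (rule test_function_support[OF \<phi>]) (rule that)
  obtain K where K: "compact K" "K \<subseteq> interior T" "\<And>x. x \<notin> K \<Longrightarrow> \<psi> x = 0"
    "\<And>x h. x \<notin> K \<Longrightarrow> frechet_derivative \<psi> (at x) h = 0"
    by (rule test_function_support[OF \<psi>]) (rule that)
  define d where "d x = frechet_derivative \<psi> (at x) i" for x
  have cd: "continuous_on UNIV d" "continuous_on UNIV \<psi>"
    using test_functionD(3,4)[OF \<psi>] i by (auto simp: d_def[abs_def])
  define F where "F x = (a \<bullet> x + b) * \<psi> x" for x
  have dF: "F differentiable (at x)" "frechet_derivative F (at x) i = (a \<bullet> x + b) * d x + (a \<bullet> i) * \<psi> x" for x
  proof -
    have 1: "((\<lambda>x. a \<bullet> x + b) has_derivative (\<lambda>h. a \<bullet> h)) (at x)"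
      by (auto intro!: derivative_eq_intros)
    then have 2: "(\<lambda>x. a \<bullet> x + b) differentiable (at x)" by (rule differentiableI)
    show "F differentiable (at x)"
      unfolding F_def[abs_def] by (rule differentiable_mult[OF 2 test_functionD(1)[OF \<psi>]])
    have "frechet_derivative (\<lambda>x. a \<bullet> x + b) (at x) i = a \<bullet> i"
      using frechet_derivative_at[OF 1] by metis
    then show "frechet_derivative F (at x) i = (a \<bullet> x + b) * d x + (a \<bullet> i) * \<psi> x"
      unfolding F_def[abs_def] by (simp add: frechet_derivative_mult[OF 2 test_functionD(1)[OF \<psi>]] d_def)
  qed
  have z1: "(LINT x|lebesgue. \<psi> x) = 0"
    unfolding \<psi>_def
    by (rule integral_directional_derivative_zero[OF _ _ L(1) L(3) L(4)]) (rule test_functionD[OF \<phi>] i)+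
  have z2: "(LINT x|lebesgue. (a \<bullet> x + b) * d x + (a \<bullet> i) * \<psi> x) = 0"
  proof -
    have "(LINT x|lebesgue. frechet_derivative F (at x) i) = 0"
      by (rule integral_directional_derivative_zero[OF _ _ K(1)])
         (use cd K in \<open>auto intro!: dF(1) continuous_intros simp: dF(2) F_def d_def\<close>)
    then show ?thesis by (simp add: dF(2))
  qed
  have "integrable lborel (\<lambda>x. (a \<bullet> x + b) * d x)" "integrable lborel (\<lambda>x. (a \<bullet> i) * \<psi> x)"
    by (rule continuous_compact_support_integrable[OF _ K(1)];
        use cd K in \<open>auto intro!: continuous_intros simp: d_def\<close>)+
  then have int: "integrable lebesgue (\<lambda>x. (a \<bullet> x + b) * d x)" "integrable lebesgue (\<lambda>x. (a \<bullet> i) * \<psi> x)"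
    by (metis borel_measurable_integrable integrable_completion)+
  have "has_weak_deriv \<Omega> i v (weak_deriv \<Omega> i v)" by (rule in_H1D(3)[OF op v i])
  then have "l2_inner \<Omega> (weak_deriv \<Omega> i v) \<psi> = - (LINT x|lebesgue_on \<Omega>. v x * d x)"
    using test_function_mono[OF \<psi> sub] by (simp add: has_weak_deriv_def l2_inner_def d_def)
  also have "(LINT x|lebesgue_on \<Omega>. v x * d x) = (LINT x|lebesgue. v x * d x)"
  proof (rule lebesgue_on_eq_lebesgue(1))
    show "v x * d x = 0" if "x \<notin> \<Omega>" for x
    proof -
      have "x \<notin> K" using that K(2) sub by blast
      then show ?thesis by (simp add: d_def K(4))
    qed
  qed (use op in simp)
  also have "\<dots> = (LINT x|lebesgue. (a \<bullet> x + b) * d x)"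
  proof (rule Bochner_Integration.integral_cong[OF refl])
    show "v x * d x = (a \<bullet> x + b) * d x" for x
    proof (cases "x \<in> K")
      case True
      then have "x \<in> T" using K(2) interior_subset by blast
      then show ?thesis by (simp add: aff)
    qed (simp add: d_def K(4))
  qed
  also have "\<dots> = 0" using z2 int z1 by simp
  finally show ?thesis by (simp add: \<psi>_def)
qed

lemma affine_bubble_orthogonal:
  fixes T \<Omega> :: "'a::euclidean_space set" and v :: "'a \<Rightarrow> real"
  assumes op: "open \<Omega>" and T: "int DIM('a) simplex T" and sub: "interior T \<subseteq> \<Omega>" and v: "in_H1 \<Omega> v"
    and aff: "\<And>x. x \<in> T \<Longrightarrow> v x = a \<bullet> x + b"
  shows "l2_inner \<Omega> (wgrad \<Omega> (bubble T)) (wgrad \<Omega> v) = 0"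
proof -
  obtain \<phi> where \<phi>: "\<And>n::nat. test_function (interior T) (\<phi> n)" "in_H1 \<Omega> (bubble T)"
    "(\<lambda>n. l2_norm \<Omega> (\<lambda>x. bubble T x - \<phi> n x)) \<longlonglongrightarrow> 0"
    "(\<lambda>n. l2_norm \<Omega> (\<lambda>x. wgrad \<Omega> (bubble T) x - wgrad \<Omega> (\<phi> n) x)) \<longlonglongrightarrow> 0"
    by (rule bubble_approximation[OF op T sub]) (rule that)
  have tO: "test_function \<Omega> (\<phi> n)" for n by (rule test_function_mono[OF \<phi>(1) sub])
  note tH = test_function_in_H1[OF op tO]
  have z: "l2_inner \<Omega> (wgrad \<Omega> (\<phi> n)) (wgrad \<Omega> v) = 0" for n
  proof -
    have "l2_inner \<Omega> (wgrad \<Omega> (\<phi> n)) (wgrad \<Omega> v) = (\<Sum>i\<in>Basis. l2_inner \<Omega> (weak_deriv \<Omega> i (\<phi> n)) (weak_deriv \<Omega> i v))"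
      by (simp add: l2_inner_components[OF in_H1D(2)[OF op tH(1)] in_H1D(2)[OF op v]] wgrad_inner)
    also have "\<dots> = (\<Sum>i\<in>Basis. l2_inner \<Omega> (weak_deriv \<Omega> i v) (\<lambda>x. frechet_derivative (\<phi> n) (at x) i))"
    proof (intro sum.cong refl, subst l2_inner_commute)
      fix i :: 'a assume i: "i \<in> Basis"
      show "l2_inner \<Omega> (weak_deriv \<Omega> i v) (weak_deriv \<Omega> i (\<phi> n))
          = l2_inner \<Omega> (weak_deriv \<Omega> i v) (\<lambda>x. frechet_derivative (\<phi> n) (at x) i)"
        using tH(2)[OF i, of n] in_H1D(4)[OF op tH(1) i, of n] in_H1D(4)[OF op v i]
          test_function_square_integrable[OF op test_function_deriv[OF tO i], of n]
        by (intro l2_inner_cong_AE) (auto intro: square_integrable_measurable)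
    qed
    also have "\<dots> = 0"
      using affine_deriv_test_orthogonal[OF op sub v aff \<phi>(1)] by simp
    finally show ?thesis .
  qed
  have "(\<lambda>n. l2_inner \<Omega> (wgrad \<Omega> (\<phi> n)) (wgrad \<Omega> v)) \<longlonglongrightarrow> l2_inner \<Omega> (wgrad \<Omega> (bubble T)) (wgrad \<Omega> v)"
    by (intro l2_inner_tendsto in_H1D(2)[OF op] tH v \<phi>(2,4))
  then show ?thesis by (simp add: z LIMSEQ_const_iff)
qed


section \<open>Meshes, discrete spaces and the projection\<close>

text \<open>A boundary point lies on or below the graph describing the boundary near it. Points slightly further
down lie strictly below the graph, an open region disjoint from \<open>\<Omega>\<close>. So a boundary point is not interior
to the closure: the domain has no slits.\<close>

lemma lipschitz_boundary_interior_closure: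
  fixes \<Omega> :: "'a::euclidean_space set"
  assumes op: "open \<Omega>" and lip: "lipschitz_boundary \<Omega>"
  shows "interior (closure \<Omega>) \<subseteq> \<Omega>"
proof
  fix x assume x: "x \<in> interior (closure \<Omega>)"
  show "x \<in> \<Omega>"
  proof (rule ccontr)
    assume nx: "x \<notin> \<Omega>"
    then have "x \<in> frontier \<Omega>"
      using x op interior_subset[of "closure \<Omega>"] by (auto simp: frontier_def interior_open)
    then obtain e r L \<gamma> where e: "norm e = 1" and r: "r > 0"
      and \<gamma>: "L-lipschitz_on {y. y \<bullet> e = 0} (\<gamma> :: 'a \<Rightarrow> real)"
      and eq: "\<Omega> \<inter> ball x r = {y \<in> ball x r. y \<bullet> e > \<gamma> (y - (y \<bullet> e) *\<^sub>R e)}"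
      using lip unfolding lipschitz_boundary_def by blast
    have ee: "e \<bullet> e = 1" using e by (simp add: norm_eq_1)
    define P where "P y = y - (y \<bullet> e) *\<^sub>R e" for y
    have "continuous_on UNIV (\<lambda>y. \<gamma> (P y))"
    proof (rule continuous_on_compose2[OF lipschitz_on_continuous_on[OF \<gamma>]])
      show "continuous_on UNIV P" unfolding P_def[abs_def] by (intro continuous_intros)
      show "P ` UNIV \<subseteq> {y. y \<bullet> e = 0}" by (auto simp: P_def inner_diff_left ee)
    qed
    then have "open {y. y \<bullet> e < \<gamma> (P y)}" by (intro open_Collect_less continuous_intros)
    then have oW: "open ({y. y \<bullet> e < \<gamma> (P y)} \<inter> ball x r)" by (intro open_Int open_ball)
    have "({y. y \<bullet> e < \<gamma> (P y)} \<inter> ball x r) \<inter> \<Omega> = {}"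
    proof -
      have "\<not> y \<bullet> e < \<gamma> (P y)" if "y \<in> \<Omega> \<inter> ball x r" for y
        using that unfolding eq P_def by simp
      then show ?thesis by blast
    qed
    then have dis: "({y. y \<bullet> e < \<gamma> (P y)} \<inter> ball x r) \<inter> closure \<Omega> = {}"
      using oW by (simp add: open_Int_closure_eq_empty)
    have le: "x \<bullet> e \<le> \<gamma> (P x)"
    proof (rule ccontr)
      assume "\<not> ?thesis"
      then have "x \<in> \<Omega> \<inter> ball x r" unfolding eq using r by (simp add: P_def)
      with nx show False by simp
    qed
    obtain s where s: "s > 0" "ball x s \<subseteq> closure \<Omega>" using x mem_interior by blast
    \<comment> \<open>a point vertically below \<open>x\<close>, close enough to belong to the closure and to the chart\<close>
    define y where "y = x - (min r s / 2) *\<^sub>R e"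
    have d: "dist x y < r" "dist x y < s" using r s(1) e by (simp_all add: y_def dist_norm)
    have "P y = P x" by (simp add: P_def y_def inner_diff_left ee algebra_simps)
    moreover have "y \<bullet> e = x \<bullet> e - min r s / 2" by (simp add: y_def inner_diff_left ee)
    ultimately have "y \<bullet> e < \<gamma> (P y)" using le r s(1) by simp
    moreover have "y \<in> closure \<Omega>" using s(2) d(2) by auto
    ultimately show False using dis d(1) by auto
  qed
qed

text \<open>A polytope of dimension less than \<open>d\<close> is convex with empty interior.\<close>

lemma polyhedral_domain_frontier_negligible:
  fixes \<Omega> :: "'a::euclidean_space set"
  assumes "polyhedral_domain \<Omega>"
  shows "negligible (frontier \<Omega>)"
proof -
  obtain \<F> where F: "finite \<F>" "\<And>F. F \<in> \<F> \<Longrightarrow> polytope F \<and> aff_dim F = int DIM('a) - 1" "frontier \<Omega> = \<Union>\<F>"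
    using assms by (auto simp: polyhedral_domain_def)
  have "negligible F" if "F \<in> \<F>" for F
  proof -
    have "interior F = {}"
    proof (rule ccontr)
      assume "interior F \<noteq> {}"
      then have "affine hull F = UNIV" by (rule affine_hull_nonempty_interior)
      then have "aff_dim F = int DIM('a)" by (metis aff_dim_affine_hull aff_dim_UNIV)
      then show False using F(2)[OF that] by simp
    qed
    then show ?thesis using F(2)[OF that] negligible_convex_interior polytope_imp_convex by blast
  qed
  then show ?thesis unfolding F(3) using F(1) by (intro negligible_Union) auto
qed

lemma conforming_meshD:
  fixes \<Omega> :: "'a::euclidean_space set"
  assumes op: "open \<Omega>" and lip: "lipschitz_boundary \<Omega>" and mesh: "conforming_mesh \<Omega> \<T>"
  shows "finite \<T>" "\<Union>\<T> = closure \<Omega>"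
    "T \<in> \<T> \<Longrightarrow> int DIM('a) simplex T" "T \<in> \<T> \<Longrightarrow> compact T" "T \<in> \<T> \<Longrightarrow> convex T"
    "T \<in> \<T> \<Longrightarrow> T \<subseteq> closure \<Omega>" "T \<in> \<T> \<Longrightarrow> interior T \<subseteq> \<Omega>"
    "T \<in> \<T> \<Longrightarrow> interior T \<noteq> {}"
    "T \<in> \<T> \<Longrightarrow> T' \<in> \<T> \<Longrightarrow> T \<noteq> T' \<Longrightarrow> interior T \<inter> T' = {}"
proof -
  show fin: "finite \<T>" and un: "\<Union>\<T> = closure \<Omega>"
    using mesh by (auto simp: conforming_mesh_def triangulation_def)
  show s: "int DIM('a) simplex T" if "T \<in> \<T>" for T using mesh that by (auto simp: conforming_mesh_def)
  have *: "compact T \<and> convex T \<and> interior T \<noteq> {}" if T: "T \<in> \<T>" for T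
  proof -
    obtain a b where ab: "finite (vertices T)" "vertices T \<noteq> {}" "T = convex hull (vertices T)"
      "\<And>p x. p \<in> vertices T \<Longrightarrow> barycentric T p x = a p \<bullet> x + b p"
      "T = {x. \<forall>p\<in>vertices T. 0 \<le> a p \<bullet> x + b p}"
      "\<And>x p. x \<in> T \<Longrightarrow> p \<in> vertices T \<Longrightarrow> a p \<bullet> x + b p \<le> 1"
      "\<And>p. p \<in> vertices T \<Longrightarrow> (\<Prod>q\<in>vertices T. a q \<bullet> p + b q) = 0"
      "interior T \<noteq> {}"
      by (rule simplex_barycentric[OF s[OF T]]) (rule that)
    show ?thesis using ab(3,8) finite_imp_compact_convex_hull[OF ab(1)] convex_convex_hull[of "vertices T"] by simp
  qed
  then show "T \<in> \<T> \<Longrightarrow> compact T" "T \<in> \<T> \<Longrightarrow> convex T" and ne: "T \<in> \<T> \<Longrightarrow> interior T \<noteq> {}" for T by auto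
  show sub: "T \<subseteq> closure \<Omega>" if "T \<in> \<T>" for T using un that by blast
  show "interior T \<subseteq> \<Omega>" if "T \<in> \<T>"
    using interior_mono[OF sub[OF that]] lipschitz_boundary_interior_closure[OF op lip] by blast
  show "interior T \<inter> T' = {}" if T: "T \<in> \<T>" "T' \<in> \<T>" "T \<noteq> T'" for T T'
  proof (rule ccontr)
    assume "interior T \<inter> T' \<noteq> {}"
    then have meet: "(T \<inter> T') \<inter> interior T \<noteq> {}" using interior_subset by blast
    have f: "(T \<inter> T') face_of T" "(T' \<inter> T) face_of T'"
      using mesh T by (auto simp: conforming_mesh_def triangulation_def)
    from face_of_disjoint_interior[OF f(1)] meet have "T \<inter> T' = T" by blast
    then have "T \<subseteq> T'" by blast
    then have "(T' \<inter> T) \<inter> interior T' \<noteq> {}" using ne[OF T(1)] interior_mono[of T T'] interior_subset[of T] by blast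
    with face_of_disjoint_interior[OF f(2)] have "T' \<inter> T = T'" by blast
    with \<open>T \<subseteq> T'\<close> T(3) show False by blast
  qed
qed

lemma negligible_AE_transfer:
  fixes S T :: "'a::euclidean_space set"
  assumes S: "S \<in> sets lebesgue" and T: "T \<in> sets lebesgue" and neg: "negligible (T - S)"
    and ae: "AE x in lebesgue_on S. P x"
  shows "AE x in lebesgue_on T. P x"
proof -
  have "AE x in lebesgue. x \<in> S \<longrightarrow> P x" using ae S by (simp add: AE_restrict_space_iff)
  moreover have "AE x in lebesgue. x \<notin> T - S"
    using neg by (intro AE_not_in) (simp add: negligible_iff_null_sets)
  ultimately have "AE x in lebesgue. x \<in> T \<longrightarrow> P x" by eventually_elim auto
  then show ?thesis using T by (simp add: AE_restrict_space_iff)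
qed

text \<open>Elements are closed and may touch the boundary, so they are subsets of \<open>\<Omega>\<close> only up to a null set.\<close>

lemma negligible_measurable_transfer:
  fixes S T :: "'a::euclidean_space set" and g :: "'a \<Rightarrow> 'b::euclidean_space"
  assumes S: "S \<in> sets lebesgue" and T: "T \<in> sets lebesgue" and neg: "negligible (T - S)"
    and g: "g \<in> borel_measurable (lebesgue_on S)"
  shows "g \<in> borel_measurable (lebesgue_on T)"
proof (rule borel_measurable_lebesgue_on_cong_AE[OF T])
  have "(\<lambda>x. if x \<in> S then g x else 0) \<in> borel_measurable lebesgue"
    using g S by (simp add: borel_measurable_if)
  then show "(\<lambda>x. if x \<in> S then g x else 0) \<in> borel_measurable (lebesgue_on T)"
    by (rule measurable_restrict_space1)
  show "AE x in lebesgue_on T. g x = (if x \<in> S then g x else 0)"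
    using S by (intro negligible_AE_transfer[OF S T neg]) (simp add: AE_restrict_space_iff)
qed

locale mesh =
  fixes \<Omega> :: "'a::euclidean_space set" and \<T> :: "'a set set"
  assumes domain: "polyhedral_domain \<Omega>" "lipschitz_boundary \<Omega>" and conforming: "conforming_mesh \<Omega> \<T>"
begin

lemma open_domain: "open \<Omega>" using domain(1) by (simp add: polyhedral_domain_def)

lemmas meshD = conforming_meshD[OF open_domain domain(2) conforming]

lemma lebesgue_domain: "\<Omega> \<in> sets lebesgue" using open_domain by simp

lemma element_measurable: "T \<in> \<T> \<Longrightarrow> T \<in> sets lebesgue"
  using meshD(4) lmeasurable_compact fmeasurableD by blast

lemma element_minus_domain: "T \<in> \<T> \<Longrightarrow> negligible (T - \<Omega>)"
  using meshD(6) open_domain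
  by (intro negligible_subset[OF polyhedral_domain_frontier_negligible[OF domain(1)]])
     (auto simp: frontier_def interior_open)

lemma measurable_on_element:
  fixes g :: "'a \<Rightarrow> 'b::euclidean_space"
  shows "T \<in> \<T> \<Longrightarrow> g \<in> borel_measurable (lebesgue_on \<Omega>) \<Longrightarrow> g \<in> borel_measurable (lebesgue_on T)"
  by (rule negligible_measurable_transfer[OF lebesgue_domain element_measurable element_minus_domain])

lemma AE_on_element: "T \<in> \<T> \<Longrightarrow> AE x in lebesgue_on \<Omega>. P x \<Longrightarrow> AE x in lebesgue_on T. P x"
  by (rule negligible_AE_transfer[OF lebesgue_domain element_measurable element_minus_domain])

text \<open>Away from the null set formed by the boundaries of \<open>\<Omega>\<close> and of all elements, a point of \<open>\<Omega>\<close> is interior to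
some element, and it belongs to no other element.\<close>

lemma AE_indicator_partition: "AE x in lebesgue. (\<Sum>T\<in>\<T>. indicator T x :: real) = indicator \<Omega> x"
proof -
  let ?N = "frontier \<Omega> \<union> (\<Union>T\<in>\<T>. frontier T)"
  have "negligible ?N"
    using meshD(1,5) polyhedral_domain_frontier_negligible[OF domain(1)]
    by (intro negligible_Un negligible_Union) (auto intro: negligible_convex_frontier)
  then have "AE x in lebesgue. x \<notin> ?N" by (intro AE_not_in) (simp add: negligible_iff_null_sets)
  then show ?thesis
  proof eventually_elim
    case (elim x)
    show ?case
    proof (cases "x \<in> \<Omega>")
      case True
      then obtain T where T: "T \<in> \<T>" "x \<in> T" using meshD(2) closure_subset by blast
      then have "x \<in> interior T" using elim closure_subset[of T] by (auto simp: frontier_def)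
      then have "x \<notin> T'" if "T' \<in> \<T>" "T \<noteq> T'" for T'
        using meshD(9)[OF T(1) that] by blast
      then have "indicator T' x = (if T' = T then 1 else 0 :: real)" if "T' \<in> \<T>" for T'
        using that T(2) by (cases "T' = T") auto
      then have "(\<Sum>T\<in>\<T>. indicator T x :: real) = (\<Sum>T'\<in>\<T>. if T' = T then 1 else 0)"
        by (intro sum.cong) auto
      then show ?thesis using T True meshD(1) by simp
    next
      case False
      then have "x \<notin> closure \<Omega>" using elim open_domain by (auto simp: frontier_def interior_open)
      then have "indicator T x = (0 :: real)" if "T \<in> \<T>" for T
        using meshD(6)[OF that] by (intro indicator_simps(2)) blast
      then show ?thesis using False by simp
    qed
  qed
qed

lemma integral_decomposition:
  fixes g :: "'a \<Rightarrow> real"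
  assumes g: "integrable (lebesgue_on \<Omega>) g"
  shows "T \<in> \<T> \<Longrightarrow> integrable (lebesgue_on T) g"
    "(LINT x|lebesgue_on \<Omega>. g x) = (\<Sum>T\<in>\<T>. (LINT x|lebesgue_on T. g x))"
proof -
  define h where "h x = indicator \<Omega> x * g x" for x
  have h: "integrable lebesgue h" using g lebesgue_domain by (simp add: integrable_restrict_space h_def[abs_def])
  have loc: "integrable lebesgue (\<lambda>x. indicator T x * h x)" if "T \<in> \<T>" for T
    using integrable_mult_indicator[OF element_measurable[OF that] h] by simp
  have ae: "AE x in lebesgue. indicator T x * g x = indicator T x * h x" if "T \<in> \<T>" for T
  proof -
    have "AE x in lebesgue. x \<notin> T - \<Omega>"
      using element_minus_domain[OF that] by (intro AE_not_in) (simp add: negligible_iff_null_sets)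
    then show ?thesis by eventually_elim (auto simp: h_def)
  qed
  have m: "(\<lambda>x. indicator T x * g x) \<in> borel_measurable lebesgue" if "T \<in> \<T>" for T
    using measurable_on_element[OF that borel_measurable_integrable[OF g]] element_measurable[OF that]
    by (simp add: borel_measurable_restrict_space_iff)
  have i: "integrable lebesgue (\<lambda>x. indicator T x * g x)" if "T \<in> \<T>" for T
    using integrable_cong_AE[OF m[OF that] borel_measurable_integrable[OF loc[OF that]] ae[OF that]] loc[OF that] by simp
  show "integrable (lebesgue_on T) g" if "T \<in> \<T>" for T
    using i[OF that] element_measurable[OF that] by (simp add: integrable_restrict_space)
  have "(LINT x|lebesgue_on \<Omega>. g x) = (LINT x|lebesgue. h x)"
    using lebesgue_domain by (simp add: integral_restrict_space h_def)
  also have "\<dots> = (LINT x|lebesgue. (\<Sum>T\<in>\<T>. indicator T x * h x))"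
  proof (rule integral_cong_AE)
    show "AE x in lebesgue. h x = (\<Sum>T\<in>\<T>. indicator T x * h x)"
      using AE_indicator_partition
      by eventually_elim (auto simp: h_def indicator_def simp flip: sum_distrib_right)
    show "(\<lambda>x. \<Sum>T\<in>\<T>. indicator T x * h x) \<in> borel_measurable lebesgue"
      using loc by (intro borel_measurable_sum) auto
  qed (use h in auto)
  also have "\<dots> = (\<Sum>T\<in>\<T>. (LINT x|lebesgue. indicator T x * h x))"
    by (rule Bochner_Integration.integral_sum) (rule loc)
  also have "\<dots> = (\<Sum>T\<in>\<T>. (LINT x|lebesgue_on T. g x))"
  proof (intro sum.cong refl)
    fix T assume T: "T \<in> \<T>"
    have "(LINT x|lebesgue. indicator T x * h x) = (LINT x|lebesgue. indicator T x * g x)"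
      by (rule integral_cong_AE[OF borel_measurable_integrable[OF i[OF T]]
            borel_measurable_integrable[OF loc[OF T]] ae[OF T], symmetric])
    then show "(LINT x|lebesgue. indicator T x * h x) = (LINT x|lebesgue_on T. g x)"
      using element_measurable[OF T] by (simp add: integral_restrict_space)
  qed
  finally show "(LINT x|lebesgue_on \<Omega>. g x) = (\<Sum>T\<in>\<T>. (LINT x|lebesgue_on T. g x))" .
qed

lemma square_integrable_on_element:
  fixes g :: "'a \<Rightarrow> 'b::euclidean_space"
  shows "T \<in> \<T> \<Longrightarrow> square_integrable \<Omega> g \<Longrightarrow> square_integrable T g"
  using integral_decomposition(1) measurable_on_element unfolding square_integrable_def by blast

lemma l2_inner_decomposition:
  fixes f g :: "'a \<Rightarrow> 'b::euclidean_space"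
  shows "square_integrable \<Omega> f \<Longrightarrow> square_integrable \<Omega> g \<Longrightarrow> l2_inner \<Omega> f g = (\<Sum>T\<in>\<T>. l2_inner T f g)"
  unfolding l2_inner_def by (intro integral_decomposition(2) square_integrable_inner)

lemma l2_norm_element_le:
  fixes f :: "'a \<Rightarrow> 'b::euclidean_space"
  assumes "T \<in> \<T>" "square_integrable \<Omega> f"
  shows "l2_norm T f \<le> l2_norm \<Omega> f"
  unfolding l2_norm_def l2_inner_decomposition[OF assms(2,2)]
  using assms(1) meshD(1) l2_inner_self_nonneg by (intro real_sqrt_le_mono member_le_sum) auto

lemma Vh0_H10: "v \<in> Vh0 \<Omega> \<T> \<Longrightarrow> in_H10 \<Omega> v"
  by (simp add: Vh0_def)

lemma Vh0_diff: "v \<in> Vh0 \<Omega> \<T> \<Longrightarrow> w \<in> Vh0 \<Omega> \<T> \<Longrightarrow> (\<lambda>x. v x - w x) \<in> Vh0 \<Omega> \<T>"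
  unfolding Vh0_def
proof (clarsimp, intro conjI ballI)
  assume v: "in_H10 \<Omega> v" "\<forall>T\<in>\<T>. \<exists>a b. \<forall>x\<in>T. v x = a \<bullet> x + b"
    and w: "in_H10 \<Omega> w" "\<forall>T\<in>\<T>. \<exists>a b. \<forall>x\<in>T. w x = a \<bullet> x + b"
  show "in_H10 \<Omega> (\<lambda>x. v x - w x)" using in_H10_lincomb[OF open_domain v(1) w(1), of 1 "-1"] by simp
  fix T assume T: "T \<in> \<T>"
  obtain a b where ab: "\<forall>x\<in>T. v x = a \<bullet> x + b" using v(2) T by blast
  obtain c d where cd: "\<forall>x\<in>T. w x = c \<bullet> x + d" using w(2) T by blast
  have "\<forall>x\<in>T. v x - w x = (a - c) \<bullet> x + (b - d)" using ab cd by (simp add: inner_diff_left)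
  then show "\<exists>a b. \<forall>x\<in>T. v x - w x = a \<bullet> x + b" by blast
qed

lemma Vb_diff: "v \<in> Vb \<T> \<Longrightarrow> w \<in> Vb \<T> \<Longrightarrow> (\<lambda>x. v x - w x) \<in> Vb \<T>"
proof -
  assume "v \<in> Vb \<T>" "w \<in> Vb \<T>"
  then obtain c d where "v = (\<lambda>x. \<Sum>T\<in>\<T>. c T * bubble T x)" "w = (\<lambda>x. \<Sum>T\<in>\<T>. d T * bubble T x)"
    by (auto simp: Vb_def)
  then have "(\<lambda>x. v x - w x) = (\<lambda>x. \<Sum>T\<in>\<T>. (c T - d T) * bubble T x)"
    by (simp add: sum_subtractf left_diff_distrib)
  then show ?thesis by (auto simp: Vb_def)
qed

text \<open>On the interior of an element all bubbles but its own vanish, so an affine function there equals a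
multiple of the product of the barycentric coordinates. By continuity this holds at the
vertices too, where the product is zero; an affine function that is zero at all vertices vanishes on the
element.\<close>

lemma Vh0_Vb_disjoint:
  assumes z: "z \<in> Vh0 \<Omega> \<T>" "z \<in> Vb \<T>"
  shows "z = (\<lambda>x. 0)"
proof
  fix x
  obtain c where c: "z = (\<lambda>x. \<Sum>T\<in>\<T>. c T * bubble T x)" using z(2) by (auto simp: Vb_def)
  show "z x = 0"
  proof (cases "x \<in> closure \<Omega>")
    case True
    then obtain T where T: "T \<in> \<T>" "x \<in> T" using meshD(2) by blast
    obtain A B where AB: "\<And>x. x \<in> T \<Longrightarrow> z x = A \<bullet> x + B" using z(1) T(1) by (fastforce simp: Vh0_def)
    obtain a b where ab: "finite (vertices T)" "vertices T \<noteq> {}" "T = convex hull (vertices T)"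
      "\<And>p x. p \<in> vertices T \<Longrightarrow> barycentric T p x = a p \<bullet> x + b p"
      "T = {x. \<forall>p\<in>vertices T. 0 \<le> a p \<bullet> x + b p}"
      "\<And>x p. x \<in> T \<Longrightarrow> p \<in> vertices T \<Longrightarrow> a p \<bullet> x + b p \<le> 1"
      "\<And>p. p \<in> vertices T \<Longrightarrow> (\<Prod>q\<in>vertices T. a q \<bullet> p + b q) = 0"
      "interior T \<noteq> {}"
      by (rule simplex_barycentric[OF meshD(3)[OF T(1)]]) (rule that)
    define g where "g x = A \<bullet> x + B - c T * (\<Prod>p\<in>vertices T. a p \<bullet> x + b p)" for x
    have "g y = 0" if y: "y \<in> interior T" for y
    proof -
      have "z y = (\<Sum>T'\<in>\<T>. if T' = T then c T * bubble T y else 0)"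
        unfolding c
      proof (intro sum.cong refl)
        fix T' assume "T' \<in> \<T>"
        then show "c T' * bubble T' y = (if T' = T then c T * bubble T y else 0)"
          using meshD(9)[OF T(1), of T'] y by (auto simp: bubble_def)
      qed
      also have "\<dots> = c T * bubble T y" using T(1) meshD(1) by simp
      also have "bubble T y = (\<Prod>p\<in>vertices T. a p \<bullet> y + b p)"
        using y interior_subset ab(4) by (auto simp: bubble_def)
      finally show ?thesis using AB[of y] subsetD[OF interior_subset y] by (simp add: g_def)
    qed
    moreover have "continuous_on (closure (interior T)) g" unfolding g_def by (intro continuous_intros)
    moreover have "closure (interior T) = T"
      using convex_closure_interior[OF meshD(5)[OF T(1)] ab(8)] meshD(4)[OF T(1)]
      by (simp add: compact_imp_closed)
    ultimately have g0: "g y = 0" if "y \<in> T" for y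
      using continuous_constant_on_closure[of "interior T" g 0 y] that by simp
    have "vertices T \<subseteq> {y. A \<bullet> y = - B}"
    proof
      fix p assume p: "p \<in> vertices T"
      then have "p \<in> T" by (subst ab(3)) (rule hull_inc)
      then show "p \<in> {y. A \<bullet> y = - B}" using g0[of p] ab(7)[OF p] by (simp add: g_def)
    qed
    then have "convex hull (vertices T) \<subseteq> {y. A \<bullet> y = - B}"
      by (rule hull_minimal) (rule convex_hyperplane)
    then have "A \<bullet> x = - B" using T(2) ab(3) by blast
    then show ?thesis using AB[OF T(2)] by simp
  qed (use z(1) in \<open>simp add: Vh0_def\<close>)
qed

lemma kappa_eq:
  assumes v: "v1 \<in> Vh0 \<Omega> \<T>" "v2 \<in> Vb \<T>" "v = (\<lambda>x. v1 x + v2 x)"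
  shows "kappa \<Omega> \<T> v = v1"
  unfolding kappa_def
proof (rule the_equality)
  show "v1 \<in> Vh0 \<Omega> \<T> \<and> (\<exists>v2\<in>Vb \<T>. v = (\<lambda>x. v1 x + v2 x))" using v by blast
  fix w1 assume "w1 \<in> Vh0 \<Omega> \<T> \<and> (\<exists>v2\<in>Vb \<T>. v = (\<lambda>x. w1 x + v2 x))"
  then obtain w2 where w: "w1 \<in> Vh0 \<Omega> \<T>" "w2 \<in> Vb \<T>" "v = (\<lambda>x. w1 x + w2 x)" by blast
  have "w1 x - v1 x = v2 x - w2 x" for x using fun_cong[OF v(3), of x] fun_cong[OF w(3), of x] by simp
  then have "(\<lambda>x. w1 x - v1 x) \<in> Vb \<T>" using Vb_diff[OF v(2) w(2)] by simp
  from Vh0_Vb_disjoint[OF Vh0_diff[OF w(1) v(1)] this] show "w1 = v1" by (simp add: fun_eq_iff)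
qed

text \<open>An element of \<open>V\<^sub>b\<close> is a finite combination of bubbles, and \<open>v1\<close> is affine on the element of each of them.\<close>

lemma Vb_orthogonal:
  assumes v1: "v1 \<in> Vh0 \<Omega> \<T>" and v2: "v2 \<in> Vb \<T>"
  shows "in_H10 \<Omega> v2" "l2_inner \<Omega> (wgrad \<Omega> v2) (wgrad \<Omega> v1) = 0"
proof -
  have H1: "in_H1 \<Omega> v1" using Vh0_H10[OF v1] by (simp add: in_H10_def)
  note S1 = in_H1D(2)[OF open_domain H1]
  obtain c where c: "v2 = (\<lambda>x. \<Sum>T\<in>\<T>. c T * bubble T x)" using v2 by (auto simp: Vb_def)
  have lin: "in_H10 \<Omega> (\<lambda>x. a * w x + b * w' x) \<and>
      l2_inner \<Omega> (wgrad \<Omega> (\<lambda>x. a * w x + b * w' x)) (wgrad \<Omega> v1)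
      = a * l2_inner \<Omega> (wgrad \<Omega> w) (wgrad \<Omega> v1) + b * l2_inner \<Omega> (wgrad \<Omega> w') (wgrad \<Omega> v1)"
    if w: "in_H10 \<Omega> w" "in_H10 \<Omega> w'" for a b w w'
  proof (intro conjI in_H10_lincomb[OF open_domain w])
    have H: "in_H1 \<Omega> w" "in_H1 \<Omega> w'" using w by (auto simp: in_H10_def)
    note I = in_H1_lincomb[OF open_domain H, of a b]
    note S = in_H1D(2)[OF open_domain H(1)] in_H1D(2)[OF open_domain H(2)]
    have "l2_inner \<Omega> (wgrad \<Omega> (\<lambda>x. a * w x + b * w' x)) (wgrad \<Omega> v1)
        = l2_inner \<Omega> (\<lambda>x. a *\<^sub>R wgrad \<Omega> w x + b *\<^sub>R wgrad \<Omega> w' x) (wgrad \<Omega> v1)"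
      by (rule l2_inner_cong_AE[OF square_integrable_measurable[OF in_H1D(2)[OF open_domain I(1)]]
          square_integrable_measurable[OF square_integrable_lincomb[OF S]]
          square_integrable_measurable[OF S1] square_integrable_measurable[OF S1] I(2)]) simp
    then show "l2_inner \<Omega> (wgrad \<Omega> (\<lambda>x. a * w x + b * w' x)) (wgrad \<Omega> v1)
        = a * l2_inner \<Omega> (wgrad \<Omega> w) (wgrad \<Omega> v1) + b * l2_inner \<Omega> (wgrad \<Omega> w') (wgrad \<Omega> v1)"
      by (simp add: l2_inner_lincomb_left[OF S S1])
  qed
  have "in_H10 \<Omega> (\<lambda>x. \<Sum>T\<in>\<S>. c T * bubble T x)
      \<and> l2_inner \<Omega> (wgrad \<Omega> (\<lambda>x. \<Sum>T\<in>\<S>. c T * bubble T x)) (wgrad \<Omega> v1) = 0"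
    if "finite \<S>" "\<S> \<subseteq> \<T>" for \<S>
    using that
  proof induction
    case empty
    show ?case using lin[OF Vh0_H10[OF v1] Vh0_H10[OF v1], of 0 0] by simp
  next
    case (insert T \<S>)
    have T: "T \<in> \<T>" using insert.prems by blast
    obtain a b where "\<And>x. x \<in> T \<Longrightarrow> v1 x = a \<bullet> x + b" using v1 T by (fastforce simp: Vh0_def)
    from affine_bubble_orthogonal[OF open_domain meshD(3)[OF T] meshD(7)[OF T] H1 this]
    have "l2_inner \<Omega> (wgrad \<Omega> (bubble T)) (wgrad \<Omega> v1) = 0" by simp
    then show ?case
      using lin[of "bubble T" "\<lambda>x. \<Sum>T\<in>\<S>. c T * bubble T x" "c T" 1]
        bubble_in_H10[OF open_domain meshD(3)[OF T] meshD(7)[OF T]] insert by simp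
  qed
  from this[OF meshD(1) subset_refl] show "in_H10 \<Omega> v2" "l2_inner \<Omega> (wgrad \<Omega> v2) (wgrad \<Omega> v1) = 0"
    by (simp_all add: c)
qed

lemma Vhb0_cases:
  assumes "v \<in> Vhb0 \<Omega> \<T>"
  obtains v1 v2 where "v1 \<in> Vh0 \<Omega> \<T>" "v2 \<in> Vb \<T>" "v = (\<lambda>x. v1 x + v2 x)" "kappa \<Omega> \<T> v = v1"
proof -
  obtain v1 v2 where v: "v1 \<in> Vh0 \<Omega> \<T>" "v2 \<in> Vb \<T>" "v = (\<lambda>x. v1 x + v2 x)"
    using assms by (auto simp: Vhb0_def)
  then show thesis using that kappa_eq[OF v] by blast
qed

lemma Vhb0_H10:
  assumes "v \<in> Vhb0 \<Omega> \<T>" shows "in_H10 \<Omega> v" "kappa \<Omega> \<T> v \<in> Vh0 \<Omega> \<T>"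
proof -
  obtain v1 v2 where v: "v1 \<in> Vh0 \<Omega> \<T>" "v2 \<in> Vb \<T>" "v = (\<lambda>x. v1 x + v2 x)" "kappa \<Omega> \<T> v = v1"
    by (rule Vhb0_cases[OF assms])
  show "in_H10 \<Omega> v" using in_H10_lincomb[OF open_domain Vh0_H10[OF v(1)] Vb_orthogonal(1)[OF v(1,2)], of 1 1] v(3) by simp
  show "kappa \<Omega> \<T> v \<in> Vh0 \<Omega> \<T>" using v by simp
qed

lemma kappa_h1_seminorm_le:
  assumes "v \<in> Vhb0 \<Omega> \<T>"
  shows "h1_seminorm \<Omega> \<Omega> (kappa \<Omega> \<T> v) \<le> h1_seminorm \<Omega> \<Omega> v"
proof -
  obtain v1 v2 where v: "v1 \<in> Vh0 \<Omega> \<T>" "v2 \<in> Vb \<T>" "v = (\<lambda>x. v1 x + v2 x)" "kappa \<Omega> \<T> v = v1"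
    by (rule Vhb0_cases[OF assms])
  have H: "in_H1 \<Omega> v1" "in_H1 \<Omega> v2" using Vh0_H10[OF v(1)] Vb_orthogonal(1)[OF v(1,2)] by (auto simp: in_H10_def)
  note S = in_H1D(2)[OF open_domain H(1)] in_H1D(2)[OF open_domain H(2)]
  have veq: "v = (\<lambda>x. 1 * v1 x + 1 * v2 x)" using v(3) by simp
  note I = in_H1_lincomb[OF open_domain H, of 1 1, folded veq]
  have "l2_norm \<Omega> (wgrad \<Omega> v) = l2_norm \<Omega> (\<lambda>x. 1 *\<^sub>R wgrad \<Omega> v1 x + 1 *\<^sub>R wgrad \<Omega> v2 x)"
    by (intro l2_norm_cong_AE I(2) square_integrable_measurable in_H1D(2)[OF open_domain I(1)] square_integrable_lincomb S)
  then have "(l2_norm \<Omega> (wgrad \<Omega> v))\<^sup>2 = (l2_norm \<Omega> (wgrad \<Omega> v1))\<^sup>2 + (l2_norm \<Omega> (wgrad \<Omega> v2))\<^sup>2"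
    using Vb_orthogonal(2)[OF v(1,2)] by (simp only: l2_norm_lincomb[OF S]) (simp add: l2_inner_commute)
  then have "(l2_norm \<Omega> (wgrad \<Omega> v1))\<^sup>2 \<le> (l2_norm \<Omega> (wgrad \<Omega> v))\<^sup>2" by simp
  then show ?thesis
    unfolding v(4) h1_seminorm_def by (rule power2_le_imp_le) (rule l2_norm_nonneg)
qed

lemma kappa_l2_norm_le:
  assumes v: "v \<in> Vhb0 \<Omega> \<T>" and C: "C \<ge> 0"
    and stable: "\<And>T. T \<in> \<T> \<Longrightarrow> l2_norm T (kappa \<Omega> \<T> v) \<le> C * l2_norm T v"
  shows "l2_norm \<Omega> (kappa \<Omega> \<T> v) \<le> C * l2_norm \<Omega> v"
proof (rule power2_le_imp_le)
  have S: "square_integrable \<Omega> v" "square_integrable \<Omega> (kappa \<Omega> \<T> v)"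
    using Vhb0_H10[OF v] Vh0_H10 in_H1D(1)[OF open_domain] by (auto simp: in_H10_def)
  have "(l2_norm \<Omega> (kappa \<Omega> \<T> v))\<^sup>2 = (\<Sum>T\<in>\<T>. (l2_norm T (kappa \<Omega> \<T> v))\<^sup>2)"
    unfolding l2_norm_power2 by (rule l2_inner_decomposition[OF S(2,2)])
  also have "\<dots> \<le> (\<Sum>T\<in>\<T>. (C * l2_norm T v)\<^sup>2)"
    by (intro sum_mono power_mono stable l2_norm_nonneg)
  also have "\<dots> = (C * l2_norm \<Omega> v)\<^sup>2"
    unfolding power_mult_distrib l2_norm_power2 l2_inner_decomposition[OF S(1,1)]
    by (rule sum_distrib_left[symmetric])
  finally show "(l2_norm \<Omega> (kappa \<Omega> \<T> v))\<^sup>2 \<le> (C * l2_norm \<Omega> v)\<^sup>2" .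
qed (simp add: C l2_norm_nonneg)

lemma kappa_energy_stable:
  assumes v: "v \<in> Vhb0 \<Omega> \<T>" and C: "C \<ge> 0" and p: "0 \<le> \<epsilon>" "0 \<le> \<sigma>"
    and stable: "\<And>T. T \<in> \<T> \<Longrightarrow> l2_norm T (kappa \<Omega> \<T> v) \<le> C * l2_norm T v"
  shows "energy_norm \<Omega> \<epsilon> \<sigma> (kappa \<Omega> \<T> v) \<le> max 1 C * energy_norm \<Omega> \<epsilon> \<sigma> v"
proof -
  have "energy_norm \<Omega> \<epsilon> \<sigma> (kappa \<Omega> \<T> v)
      \<le> sqrt (\<epsilon> * (max 1 C * h1_seminorm \<Omega> \<Omega> v)\<^sup>2 + \<sigma> * (max 1 C * l2_norm \<Omega> v)\<^sup>2)"
  proof (rule energy_norm_le[OF p])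
    have "h1_seminorm \<Omega> \<Omega> (kappa \<Omega> \<T> v) \<le> 1 * h1_seminorm \<Omega> \<Omega> v" using kappa_h1_seminorm_le[OF v] by simp
    also have "\<dots> \<le> max 1 C * h1_seminorm \<Omega> \<Omega> v" by (intro mult_right_mono) (auto simp: h1_seminorm_nonneg)
    finally show "h1_seminorm \<Omega> \<Omega> (kappa \<Omega> \<T> v) \<le> max 1 C * h1_seminorm \<Omega> \<Omega> v" .
    have "l2_norm \<Omega> (kappa \<Omega> \<T> v) \<le> C * l2_norm \<Omega> v" by (rule kappa_l2_norm_le[OF v C stable])
    also have "\<dots> \<le> max 1 C * l2_norm \<Omega> v" by (intro mult_right_mono) (auto simp: l2_norm_nonneg)
    finally show "l2_norm \<Omega> (kappa \<Omega> \<T> v) \<le> max 1 C * l2_norm \<Omega> v" .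
  qed
  also have "\<dots> = sqrt ((max 1 C)\<^sup>2 * (\<epsilon> * (h1_seminorm \<Omega> \<Omega> v)\<^sup>2 + \<sigma> * (l2_norm \<Omega> v)\<^sup>2))"
    by (simp add: power_mult_distrib algebra_simps)
  also have "\<dots> = max 1 C * energy_norm \<Omega> \<epsilon> \<sigma> v"
    by (simp add: real_sqrt_mult energy_norm_def)
  finally show ?thesis .
qed

end


section \<open>The error estimate\<close>

context mesh begin

lemma linf_norm_element_le:
  assumes T: "T \<in> \<T>" and M: "M \<ge> 0" "\<beta> \<in> borel_measurable (lebesgue_on \<Omega>)" "AE x in lebesgue_on \<Omega>. norm (\<beta> x) \<le> M"
  shows "linf_norm T \<beta> \<le> M"
proof -
  have "\<beta> \<in> borel_measurable (lebesgue_on T)" by (rule measurable_on_element[OF T M(2)])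
  then have "(\<lambda>x. ereal (norm (\<beta> x))) \<in> borel_measurable (lebesgue_on T)" by measurable
  moreover have "AE x in lebesgue_on T. ereal (norm (\<beta> x)) \<le> ereal M"
    using AE_on_element[OF T M(3)] by simp
  ultimately have "esssup (lebesgue_on T) (\<lambda>x. ereal (norm (\<beta> x))) \<le> ereal M" by (rule esssup_I)
  then show ?thesis
    unfolding linf_norm_def using M(1) by (cases "esssup (lebesgue_on T) (\<lambda>x. ereal (norm (\<beta> x)))") auto
qed

lemma residual_l2_norm_le:
  assumes T: "T \<in> \<T>" and M: "M \<ge> 0" "\<beta> \<in> borel_measurable (lebesgue_on \<Omega>)" "AE x in lebesgue_on \<Omega>. norm (\<beta> x) \<le> M"
    and sigma: "\<sigma> \<ge> 0" and f: "square_integrable \<Omega> f" and v: "in_H1 \<Omega> v"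
  shows "l2_norm T (residual \<Omega> \<beta> \<sigma> f v) \<le> M * h1_seminorm \<Omega> T v + \<sigma> * l2_norm T v + l2_norm T f"
proof -
  note V = square_integrable_on_element[OF T in_H1D(1)[OF open_domain v]] square_integrable_on_element[OF T in_H1D(2)[OF open_domain v]]
  note F = square_integrable_on_element[OF T f]
  note B = bounded_field_inner[OF M(1) measurable_on_element[OF T M(2)] AE_on_element[OF T M(3)] V(2)]
  have "l2_norm T (\<lambda>x. \<beta> x \<bullet> wgrad \<Omega> v x + (\<sigma> *\<^sub>R v x + (-1) *\<^sub>R f x))
      \<le> l2_norm T (\<lambda>x. \<beta> x \<bullet> wgrad \<Omega> v x) + l2_norm T (\<lambda>x. \<sigma> *\<^sub>R v x + (-1) *\<^sub>R f x)"
    by (rule l2_triangle[OF B(1) square_integrable_lincomb[OF V(1) F]])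
  moreover have "l2_norm T (\<lambda>x. \<sigma> *\<^sub>R v x + (-1) *\<^sub>R f x) \<le> \<sigma> * l2_norm T v + l2_norm T f"
    using l2_triangle[OF square_integrable_scaleR[OF V(1), of \<sigma>] square_integrable_scaleR[OF F, of "-1"]] sigma
    unfolding l2_norm_scaleR by simp
  moreover have "residual \<Omega> \<beta> \<sigma> f v = (\<lambda>x. \<beta> x \<bullet> wgrad \<Omega> v x + (\<sigma> *\<^sub>R v x + (-1) *\<^sub>R f x))"
    by (simp add: residual_def fun_eq_iff)
  ultimately show ?thesis using B(2) by (simp add: h1_seminorm_def)
qed

text \<open>Since \<open>\<chi>\<^sub>T \<le> Pe\<^sub>T\<close>, one factor \<open>h\<^sub>T\<close> comes from the Peclet number and the other from \<open>\<mu>\<close>. The quotient of residual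
and \<open>\<N>\<^sub>T + \<tau>\<close> is bounded because \<open>\<N>\<^sub>T\<close> controls those norms of \<open>v\<close> that enter the residual, and \<open>\<tau>\<close> controls
the contribution of \<open>f\<close>.\<close>

lemma xi_bounds:
  assumes T: "T \<in> \<T>" and M: "M \<ge> 0" "\<beta> \<in> borel_measurable (lebesgue_on \<Omega>)" "AE x in lebesgue_on \<Omega>. norm (\<beta> x) \<le> M"
    and eps: "\<epsilon> > 0" and sigma: "\<sigma> \<ge> 0" and tau: "\<tau> > 0" and f: "square_integrable \<Omega> f" and v: "in_H1 \<Omega> v"
    and mu: "0 < \<mu> (diameter T)" "\<mu> (diameter T) \<le> C * diameter T"
  shows "0 \<le> xi \<Omega> \<epsilon> \<beta> \<sigma> f \<tau> \<mu> T v"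
    "xi \<Omega> \<epsilon> \<beta> \<sigma> f \<tau> \<mu> T v \<le> M / (2 * \<epsilon>) * C * (M + \<sigma> + l2_norm \<Omega> f / \<tau>) * (diameter T)\<^sup>2"
proof -
  define h where "h = diameter T"
  define N where "N = N_loc \<Omega> \<sigma> T v"
  define F where "F = l2_norm \<Omega> f"
  define R where "R = l2_norm T (residual \<Omega> \<beta> \<sigma> f v)"
  have h: "h \<ge> 0" using diameter_ge_0 meshD(4)[OF T] compact_imp_bounded by (auto simp: h_def)
  have F: "F \<ge> 0" "l2_norm T f \<le> F" using l2_norm_element_le[OF T f] by (auto simp: F_def l2_norm_nonneg)
  have R0: "R \<ge> 0" by (simp add: R_def l2_norm_nonneg)
  have N: "h1_seminorm \<Omega> T v \<le> N" "\<sigma> * l2_norm T v \<le> \<sigma> * N"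
    using sigma by (auto simp: N_def N_loc_def h1_norm_def intro: mult_left_mono)
  have N0: "N \<ge> 0" using N(1) h1_seminorm_nonneg order_trans by blast
  have "R \<le> M * h1_seminorm \<Omega> T v + \<sigma> * l2_norm T v + l2_norm T f"
    unfolding R_def by (rule residual_l2_norm_le[OF T M sigma f v])
  also have "\<dots> \<le> M * N + \<sigma> * N + F" using mult_left_mono[OF N(1) M(1)] N(2) F(2) by linarith
  also have "\<dots> \<le> (M + \<sigma> + F / \<tau>) * (N + \<tau>)"
  proof -
    have "(M + \<sigma> + F / \<tau>) * (N + \<tau>) = M * N + \<sigma> * N + F + (M * \<tau> + \<sigma> * \<tau> + F / \<tau> * N)"
      using tau by (simp add: algebra_simps add_divide_distrib)
    moreover have "0 \<le> M * \<tau> + \<sigma> * \<tau> + F / \<tau> * N" using M(1) sigma tau F N0 by simp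
    ultimately show ?thesis by linarith
  qed
  finally have q: "R / (N + \<tau>) \<le> M + \<sigma> + F / \<tau>" using N0 tau by (simp add: divide_le_eq)
  have q0: "0 \<le> R / (N + \<tau>)" using R0 N0 tau by simp
  have c0: "0 \<le> chi \<epsilon> \<beta> T" by (simp add: chi_def)
  have c: "chi \<epsilon> \<beta> T \<le> M / (2 * \<epsilon>) * h"
  proof (cases "peclet \<epsilon> \<beta> T > 1")
    case True
    have "linf_norm T \<beta> * h / (2 * \<epsilon>) \<le> M * h / (2 * \<epsilon>)"
      using linf_norm_element_le[OF T M] h eps by (intro divide_right_mono mult_right_mono) auto
    then show ?thesis using True by (simp add: chi_def peclet_def h_def)
  qed (use M(1) eps h in \<open>simp add: chi_def\<close>)
  have xi: "xi \<Omega> \<epsilon> \<beta> \<sigma> f \<tau> \<mu> T v = chi \<epsilon> \<beta> T * \<mu> h * (R / (N + \<tau>))"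
    by (simp add: xi_def h_def R_def N_def)
  show "0 \<le> xi \<Omega> \<epsilon> \<beta> \<sigma> f \<tau> \<mu> T v"
    unfolding xi h_def by (intro mult_nonneg_nonneg c0 q0 less_imp_le[OF mu(1)])
  have "chi \<epsilon> \<beta> T * \<mu> h * (R / (N + \<tau>)) \<le> (M / (2 * \<epsilon>) * h) * (C * h) * (M + \<sigma> + F / \<tau>)"
  proof (intro mult_mono c q q0)
    show "\<mu> h \<le> C * h" "0 \<le> \<mu> h" using mu by (simp_all add: h_def)
    then have "0 \<le> C * h" by linarith
    moreover show "0 \<le> M / (2 * \<epsilon>) * h" using M(1) eps h by simp
    ultimately show "0 \<le> M / (2 * \<epsilon>) * h * (C * h)" by (rule mult_nonneg_nonneg[rotated])
  qed
  then show "xi \<Omega> \<epsilon> \<beta> \<sigma> f \<tau> \<mu> T v \<le> M / (2 * \<epsilon>) * C * (M + \<sigma> + l2_norm \<Omega> f / \<tau>) * (diameter T)\<^sup>2"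
    unfolding xi F_def h_def by (simp add: power2_eq_square mult_ac)
qed

lemma Vhb0_diff_Vh0:
  assumes v: "v \<in> Vhb0 \<Omega> \<T>" and w: "w \<in> Vh0 \<Omega> \<T>"
  shows "(\<lambda>x. v x - w x) \<in> Vhb0 \<Omega> \<T>" "kappa \<Omega> \<T> (\<lambda>x. v x - w x) = (\<lambda>x. kappa \<Omega> \<T> v x - w x)"
proof -
  obtain v1 v2 where d: "v1 \<in> Vh0 \<Omega> \<T>" "v2 \<in> Vb \<T>" "v = (\<lambda>x. v1 x + v2 x)" "kappa \<Omega> \<T> v = v1"
    by (rule Vhb0_cases[OF v])
  have e: "(\<lambda>x. v x - w x) = (\<lambda>x. (v1 x - w x) + v2 x)" using d(3) by (simp add: fun_eq_iff)
  show "(\<lambda>x. v x - w x) \<in> Vhb0 \<Omega> \<T>"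
    unfolding Vhb0_def
    by (rule CollectI, rule bexI[OF _ Vh0_diff[OF d(1) w]], rule bexI[OF _ d(2)], rule e)
  show "kappa \<Omega> \<T> (\<lambda>x. v x - w x) = (\<lambda>x. kappa \<Omega> \<T> v x - w x)"
    using kappa_eq[OF Vh0_diff[OF d(1) w] d(2) e] d(4) by simp
qed

text \<open>Young's inequality, element by element. In the application the weights are \<open>\<xi>\<^sub>T\<close>, \<open>v\<close> is the
discrete solution and \<open>w\<close> the interpolant; half of the artificial dissipation survives.\<close>

lemma weighted_diffusion_young:
  assumes v: "in_H1 \<Omega> v" and w: "in_H1 \<Omega> w" and xi: "\<And>T. T \<in> \<T> \<Longrightarrow> 0 \<le> k T \<and> k T \<le> X"
  shows "(\<Sum>T\<in>\<T>. k T * l2_inner T (wgrad \<Omega> v) (wgrad \<Omega> (\<lambda>x. v x - w x)))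
    \<ge> (\<Sum>T\<in>\<T>. k T * l2_inner T (wgrad \<Omega> v) (wgrad \<Omega> v)) / 2 - X * (h1_seminorm \<Omega> \<Omega> w)\<^sup>2 / 2"
proof -
  note V = in_H1D(2)[OF open_domain v] and W = in_H1D(2)[OF open_domain w]
  have loc: "k T * l2_inner T (wgrad \<Omega> v) (wgrad \<Omega> (\<lambda>x. v x - w x))
      \<ge> k T * l2_inner T (wgrad \<Omega> v) (wgrad \<Omega> v) / 2 - X * l2_inner T (wgrad \<Omega> w) (wgrad \<Omega> w) / 2"
    if T: "T \<in> \<T>" for T
  proof -
    note VT = square_integrable_on_element[OF T V] and WT = square_integrable_on_element[OF T W]
    note I = in_H1_diff[OF open_domain v w]
    have "l2_inner T (wgrad \<Omega> v) (wgrad \<Omega> (\<lambda>x. v x - w x))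
        = l2_inner T (wgrad \<Omega> v) (\<lambda>x. 1 *\<^sub>R wgrad \<Omega> v x + (-1) *\<^sub>R wgrad \<Omega> w x)"
      using AE_on_element[OF T I(2)] square_integrable_on_element[OF T in_H1D(2)[OF open_domain I(1)]]
        square_integrable_diff[OF VT WT] VT
      by (intro l2_inner_cong_AE) (auto intro: square_integrable_measurable)
    also have "\<dots> = l2_inner T (wgrad \<Omega> v) (wgrad \<Omega> v) - l2_inner T (wgrad \<Omega> v) (wgrad \<Omega> w)"
      by (simp only: l2_inner_lincomb_right[OF VT WT VT])
    finally have e: "l2_inner T (wgrad \<Omega> v) (wgrad \<Omega> (\<lambda>x. v x - w x))
        = l2_inner T (wgrad \<Omega> v) (wgrad \<Omega> v) - l2_inner T (wgrad \<Omega> v) (wgrad \<Omega> w)" .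
    define a b where "a = l2_norm T (wgrad \<Omega> v)" and "b = l2_norm T (wgrad \<Omega> w)"
    have "l2_inner T (wgrad \<Omega> v) (wgrad \<Omega> w) \<le> a * b"
      using l2_Cauchy_Schwarz[OF VT WT] by (simp add: a_def b_def)
    also have "\<dots> \<le> (a\<^sup>2 + b\<^sup>2) / 2" using sum_squares_bound[of a b] by simp
    finally have "l2_inner T (wgrad \<Omega> v) (wgrad \<Omega> (\<lambda>x. v x - w x)) \<ge> a\<^sup>2 / 2 - b\<^sup>2 / 2"
      unfolding e by (simp add: a_def l2_norm_power2 add_divide_distrib)
    then have "k T * l2_inner T (wgrad \<Omega> v) (wgrad \<Omega> (\<lambda>x. v x - w x)) \<ge> k T * (a\<^sup>2 / 2 - b\<^sup>2 / 2)"
      using xi[OF T] by (intro mult_left_mono) auto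
    moreover have "k T * b\<^sup>2 \<le> X * b\<^sup>2" using xi[OF T] by (intro mult_right_mono) auto
    ultimately show ?thesis by (simp add: a_def b_def l2_norm_power2 right_diff_distrib)
  qed
  have "(\<Sum>T\<in>\<T>. k T * l2_inner T (wgrad \<Omega> v) (wgrad \<Omega> v)) / 2 - X * (h1_seminorm \<Omega> \<Omega> w)\<^sup>2 / 2
      = (\<Sum>T\<in>\<T>. k T * l2_inner T (wgrad \<Omega> v) (wgrad \<Omega> v) / 2 - X * l2_inner T (wgrad \<Omega> w) (wgrad \<Omega> w) / 2)"
    unfolding h1_seminorm_def l2_norm_power2 l2_inner_decomposition[OF W W]
    by (simp add: sum_subtractf sum_divide_distrib sum_distrib_left)
  also have "\<dots> \<le> (\<Sum>T\<in>\<T>. k T * l2_inner T (wgrad \<Omega> v) (wgrad \<Omega> (\<lambda>x. v x - w x)))"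
    by (rule sum_mono) (rule loc)
  finally show ?thesis .
qed

text \<open>The convection term is rewritten as \<open>- (\<eta>, \<beta> \<bullet> \<nabla>e)\<close>: the factor \<open>|e|\<^sub>1\<close> is absorbed by the diffusive part of the
energy norm, also when \<open>\<sigma> = 0\<close>.\<close>

lemma B_form_young:
  assumes M: "M \<ge> 0" "\<beta> \<in> borel_measurable (lebesgue_on \<Omega>)" "AE x in lebesgue_on \<Omega>. norm (\<beta> x) \<le> M"
    and beta: "\<forall>i\<in>Basis. in_W1inf \<Omega> (\<lambda>x. \<beta> x \<bullet> i)" and div: "AE x in lebesgue_on \<Omega>. wdiv \<Omega> \<beta> x = 0"
    and eps: "\<epsilon> > 0" and sigma: "\<sigma> \<ge> 0" and g: "in_H10 \<Omega> \<eta>" and e: "in_H10 \<Omega> e"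
  shows "B_form \<Omega> \<epsilon> \<beta> \<sigma> \<eta> e \<le> \<epsilon> * (h1_seminorm \<Omega> \<Omega> \<eta>)\<^sup>2 + (M\<^sup>2 / \<epsilon> + \<sigma>) * (l2_norm \<Omega> \<eta>)\<^sup>2
      + (energy_norm \<Omega> \<epsilon> \<sigma> e)\<^sup>2 / 2"
proof -
  have H: "in_H1 \<Omega> \<eta>" "in_H1 \<Omega> e" using g e by (auto simp: in_H10_def)
  note G = in_H1D(1,2)[OF open_domain H(1)] and E = in_H1D(1,2)[OF open_domain H(2)]
  define p q a b where "p = h1_seminorm \<Omega> \<Omega> \<eta>" and "q = l2_norm \<Omega> \<eta>"
    and "a = h1_seminorm \<Omega> \<Omega> e" and "b = l2_norm \<Omega> e"
  have nn: "0 \<le> p" "0 \<le> q" "0 \<le> a" "0 \<le> b"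
    by (auto simp: p_def q_def a_def b_def h1_seminorm_nonneg l2_norm_nonneg)
  have 1: "l2_inner \<Omega> (wgrad \<Omega> \<eta>) (wgrad \<Omega> e) \<le> p * a"
    using l2_Cauchy_Schwarz[OF G(2) E(2)] by (simp add: p_def a_def h1_seminorm_def)
  have 2: "l2_inner \<Omega> (\<lambda>x. \<beta> x \<bullet> wgrad \<Omega> \<eta> x) e \<le> q * (M * a)"
  proof -
    have "l2_inner \<Omega> (\<lambda>x. \<beta> x \<bullet> wgrad \<Omega> \<eta> x) e \<le> \<bar>l2_inner \<Omega> \<eta> (\<lambda>x. \<beta> x \<bullet> wgrad \<Omega> e x)\<bar>"
      using convection_skew_symmetric[OF open_domain beta div g e] by simp
    also have "\<dots> \<le> q * l2_norm \<Omega> (\<lambda>x. \<beta> x \<bullet> wgrad \<Omega> e x)"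
      unfolding q_def by (rule l2_Cauchy_Schwarz[OF G(1) bounded_field_inner(1)[OF M E(2)]])
    also have "\<dots> \<le> q * (M * a)"
      using bounded_field_inner(2)[OF M E(2)] nn by (intro mult_left_mono) (auto simp: a_def h1_seminorm_def)
    finally show ?thesis .
  qed
  have 3: "l2_inner \<Omega> \<eta> e \<le> q * b"
    using l2_Cauchy_Schwarz[OF G(1) E(1)] by (simp add: q_def b_def)
  have y1: "p * a \<le> p\<^sup>2 + a\<^sup>2 / 4"
    using zero_le_power2[of "p - a / 2"] by (simp add: power2_eq_square algebra_simps)
  have y2: "q * (M * a) \<le> M\<^sup>2 / \<epsilon> * q\<^sup>2 + \<epsilon> * (a\<^sup>2 / 4)"
  proof -
    have "M\<^sup>2 / \<epsilon> * q\<^sup>2 + \<epsilon> * (a\<^sup>2 / 4) - q * (M * a) = (1 / \<epsilon>) * (M * q - \<epsilon> * a / 2)\<^sup>2"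
      using eps by (simp add: power2_eq_square field_simps)
    then show ?thesis using eps by (smt (verit) zero_le_power2 mult_nonneg_nonneg divide_nonneg_pos)
  qed
  have y3: "q * b \<le> q\<^sup>2 + b\<^sup>2 / 2"
  proof -
    have "q * b \<le> q\<^sup>2 + b\<^sup>2 / 4"
      using zero_le_power2[of "q - b / 2"] by (simp add: power2_eq_square algebra_simps)
    then show ?thesis using zero_le_power2[of b] by linarith
  qed
  have "B_form \<Omega> \<epsilon> \<beta> \<sigma> \<eta> e \<le> \<epsilon> * (p * a) + q * (M * a) + \<sigma> * (q * b)"
    unfolding B_form_def using 1 2 3 eps sigma by (intro add_mono mult_left_mono) auto
  also have "\<dots> \<le> \<epsilon> * (p\<^sup>2 + a\<^sup>2 / 4) + (M\<^sup>2 / \<epsilon> * q\<^sup>2 + \<epsilon> * (a\<^sup>2 / 4)) + \<sigma> * (q\<^sup>2 + b\<^sup>2 / 2)"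
    using y1 y2 y3 eps sigma by (intro add_mono mult_left_mono) auto
  also have "\<dots> = \<epsilon> * p\<^sup>2 + (M\<^sup>2 / \<epsilon> + \<sigma>) * q\<^sup>2 + (\<epsilon> * a\<^sup>2 + \<sigma> * b\<^sup>2) / 2"
    by (simp add: algebra_simps)
  finally show ?thesis
    using eps sigma by (simp add: energy_norm_power2 p_def q_def a_def b_def)
qed

text \<open>Subtracting the two problems tested with \<open>e = U - w\<close> gives \<open>\<parallel>e\<parallel>\<^sub>E\<^sup>2 + D(U; U, e) = B(u - w, e)\<close>; both terms that
depend on \<open>e\<close> are then estimated by Young's inequality.\<close>

lemma dd_energy_estimate:
  assumes M: "M \<ge> 0" "\<beta> \<in> borel_measurable (lebesgue_on \<Omega>)" "AE x in lebesgue_on \<Omega>. norm (\<beta> x) \<le> M"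
    and beta: "\<forall>i\<in>Basis. in_W1inf \<Omega> (\<lambda>x. \<beta> x \<bullet> i)" and div: "AE x in lebesgue_on \<Omega>. wdiv \<Omega> \<beta> x = 0"
    and eps: "\<epsilon> > 0" and sigma: "\<sigma> \<ge> 0" and f: "square_integrable \<Omega> f"
    and u: "in_H2 \<Omega> u" "in_H10 \<Omega> u"
    and pde: "AE x in lebesgue_on \<Omega>. - \<epsilon> * wlaplace \<Omega> u x + \<beta> x \<bullet> wgrad \<Omega> u x + \<sigma> * u x = f x"
    and w: "w \<in> Vh0 \<Omega> \<T>" and sol: "dd_solution \<Omega> \<epsilon> \<beta> \<sigma> f \<tau> \<mu> \<T> U"
    and xi: "\<And>T. T \<in> \<T> \<Longrightarrow> 0 \<le> xi \<Omega> \<epsilon> \<beta> \<sigma> f \<tau> \<mu> T (kappa \<Omega> \<T> U) \<and> xi \<Omega> \<epsilon> \<beta> \<sigma> f \<tau> \<mu> T (kappa \<Omega> \<T> U) \<le> X"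
  shows "(energy_norm \<Omega> \<epsilon> \<sigma> (\<lambda>x. U x - w x))\<^sup>2 + D_form \<Omega> \<epsilon> \<beta> \<sigma> f \<tau> \<mu> \<T> U U U
    \<le> 2 * \<epsilon> * (h1_seminorm \<Omega> \<Omega> (\<lambda>x. u x - w x))\<^sup>2 + 2 * (M\<^sup>2 / \<epsilon> + \<sigma>) * (l2_norm \<Omega> (\<lambda>x. u x - w x))\<^sup>2
      + X * (h1_seminorm \<Omega> \<Omega> w)\<^sup>2"
proof -
  define e where "e x = U x - w x" for x
  define \<eta> where "\<eta> x = u x - w x" for x
  have Uv: "U \<in> Vhb0 \<Omega> \<T>" using sol by (simp add: dd_solution_def)
  have ev: "e \<in> Vhb0 \<Omega> \<T>" using Vhb0_diff_Vh0(1)[OF Uv w] by (simp add: e_def[abs_def])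
  have e10: "in_H10 \<Omega> e" by (rule Vhb0_H10(1)[OF ev])
  have w10: "in_H10 \<Omega> w" by (rule Vh0_H10[OF w])
  have \<eta>10: "in_H10 \<Omega> \<eta>" using in_H10_lincomb[OF open_domain u(2) w10, of 1 "-1"] by (simp add: \<eta>_def[abs_def])
  have U10: "in_H10 \<Omega> U" by (rule Vhb0_H10(1)[OF Uv])
  have H: "in_H1 \<Omega> e" "in_H1 \<Omega> w" "in_H1 \<Omega> \<eta>" "in_H1 \<Omega> U" "in_H1 \<Omega> u"
    using e10 w10 \<eta>10 U10 u(2) by (auto simp: in_H10_def)
  let ?B = "B_form \<Omega> \<epsilon> \<beta> \<sigma>" and ?D = "D_form \<Omega> \<epsilon> \<beta> \<sigma> f \<tau> \<mu> \<T> U U"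
  have "?B U e + ?D e = l2_inner \<Omega> f e" using sol ev by (simp add: dd_solution_def)
  moreover have "?B u e = l2_inner \<Omega> f e" by (rule strong_solution_weak_form[OF open_domain M u(1) f e10 pde])
  moreover have "?B U e = ?B e e + ?B w e"
    using B_form_lincomb_left[OF open_domain M H(1,2,1), of \<epsilon> \<sigma> 1 1] by (simp add: e_def)
  moreover have "?B u e = ?B \<eta> e + ?B w e"
    using B_form_lincomb_left[OF open_domain M H(3,2,1), of \<epsilon> \<sigma> 1 1] by (simp add: \<eta>_def)
  moreover have "?B e e = (energy_norm \<Omega> \<epsilon> \<sigma> e)\<^sup>2"
    using eps sigma by (intro B_form_coercive[OF open_domain beta div e10]) auto
  ultimately have id: "(energy_norm \<Omega> \<epsilon> \<sigma> e)\<^sup>2 + ?D e = ?B \<eta> e" by simp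
  have "?D e \<ge> ?D U / 2 - X * (h1_seminorm \<Omega> \<Omega> w)\<^sup>2 / 2"
    unfolding D_form_def e_def[abs_def] by (rule weighted_diffusion_young[OF H(4,2) xi])
  moreover note B_form_young[OF M beta div eps sigma \<eta>10 e10]
  ultimately show ?thesis using id by (simp add: e_def[abs_def] \<eta>_def[abs_def] algebra_simps)
qed

text \<open>The projection fixes \<open>w\<close>, so \<open>u - \<kappa>(U) = (u - w) - \<kappa>(U - w)\<close>, and \<open>\<kappa>\<close> is stable in the energy norm.\<close>

lemma kappa_error_le:
  assumes C: "C \<ge> 0" and p: "0 \<le> \<epsilon>" "0 \<le> \<sigma>" and u: "in_H1 \<Omega> u" and w: "w \<in> Vh0 \<Omega> \<T>" and U: "U \<in> Vhb0 \<Omega> \<T>"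
    and stable: "\<And>v T. v \<in> Vhb0 \<Omega> \<T> \<Longrightarrow> T \<in> \<T> \<Longrightarrow> l2_norm T (kappa \<Omega> \<T> v) \<le> C * l2_norm T v"
  shows "energy_norm \<Omega> \<epsilon> \<sigma> (\<lambda>x. u x - kappa \<Omega> \<T> U x)
    \<le> (1 + max 1 C) * energy_norm \<Omega> \<epsilon> \<sigma> (\<lambda>x. u x - w x) + max 1 C * energy_norm \<Omega> \<epsilon> \<sigma> (\<lambda>x. u x - U x)"
proof -
  let ?E = "energy_norm \<Omega> \<epsilon> \<sigma>"
  have H: "in_H1 \<Omega> w" "in_H1 \<Omega> U" "in_H1 \<Omega> (kappa \<Omega> \<T> U)"
    using Vh0_H10 Vhb0_H10[OF U] w by (auto simp: in_H10_def)
  note Hd = in_H1_diff(1)[OF open_domain u H(1)] in_H1_diff(1)[OF open_domain u H(2)] in_H1_diff(1)[OF open_domain H(3,1)]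
  note e = Vhb0_diff_Vh0[OF U w]
  have "?E (\<lambda>x. U x - w x) \<le> ?E (\<lambda>x. u x - w x) + ?E (\<lambda>x. u x - U x)"
    using energy_norm_lincomb[OF open_domain Hd(1,2) p, of 1 "-1"] by simp
  then have "max 1 C * ?E (\<lambda>x. U x - w x) \<le> max 1 C * (?E (\<lambda>x. u x - w x) + ?E (\<lambda>x. u x - U x))"
    by (intro mult_left_mono) auto
  moreover have "?E (\<lambda>x. kappa \<Omega> \<T> U x - w x) \<le> max 1 C * ?E (\<lambda>x. U x - w x)"
    using kappa_energy_stable[OF e(1) C p stable[OF e(1)]] by (simp add: e(2))
  moreover have "?E (\<lambda>x. u x - kappa \<Omega> \<T> U x) \<le> ?E (\<lambda>x. u x - w x) + ?E (\<lambda>x. kappa \<Omega> \<T> U x - w x)"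
    using energy_norm_lincomb[OF open_domain Hd(1,3) p, of 1 "-1"] by simp
  ultimately show ?thesis by (simp add: algebra_simps)
qed

lemma mesh_size_bounds:
  "T \<in> \<T> \<Longrightarrow> diameter T \<le> mesh_size \<T>" "0 \<le> mesh_size \<T>" "mesh_size \<T> \<le> diameter (closure \<Omega>)"
  "T \<in> \<T> \<Longrightarrow> 0 \<le> diameter T"
proof -
  have b: "bounded T" if "T \<in> \<T>" for T using meshD(4)[OF that] by (rule compact_imp_bounded)
  have bc: "bounded (closure \<Omega>)" using domain(1) by (auto simp: polyhedral_domain_def)
  show le: "diameter T \<le> mesh_size \<T>" if "T \<in> \<T>" for T
    unfolding mesh_size_def using that meshD(1) by (intro Max_ge) auto
  show nn: "0 \<le> diameter T" if "T \<in> \<T>" for T using diameter_ge_0[OF b[OF that]] .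
  have ne: "\<T> \<noteq> {}"
  proof
    assume "\<T> = {}"
    then have "\<Omega> = {}" using meshD(2) closure_subset[of \<Omega>] by simp
    then show False using domain(1) by (simp add: polyhedral_domain_def)
  qed
  then show "0 \<le> mesh_size \<T>" using le nn by (meson all_not_in_conv order_trans)
  show "mesh_size \<T> \<le> diameter (closure \<Omega>)"
    unfolding mesh_size_def using ne meshD(1) diameter_subset[OF meshD(6) bc] by (intro Max.boundedI) auto
qed

end

theorem corollary5p9:
  fixes \<Omega> :: "'a::euclidean_space set"
    and \<epsilon> \<sigma> \<tau> C\<^sub>\<kappa> C\<^sub>I C\<^sub>\<mu> :: real
    and \<beta> :: "'a \<Rightarrow> 'a"
    and f u :: "'a \<Rightarrow> real"
    and \<mu> :: "real \<Rightarrow> real"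
    and \<M> :: "'a set set set"
    and I\<^sub>h :: "'a set set \<Rightarrow> 'a \<Rightarrow> real"
  assumes dim: "DIM('a) \<in> {2, 3}"
    and domain: "polyhedral_domain \<Omega>" "lipschitz_boundary \<Omega>"
    and eps: "\<epsilon> > 0"
    and beta: "\<forall>i\<in>Basis. in_W1inf \<Omega> (\<lambda>x. \<beta> x \<bullet> i)"
    and div_beta: "AE x in lebesgue_on \<Omega>. wdiv \<Omega> \<beta> x = 0"
    and sigma: "\<sigma> \<ge> 0"
    and f: "in_L2 \<Omega> f"
    and meshes: "\<forall>\<T>\<in>\<M>. conforming_mesh \<Omega> \<T>" "shape_regular \<M>"
    and kappa_stable: "C\<^sub>\<kappa> > 0"
      "\<forall>\<T>\<in>\<M>. \<forall>v\<in>Vhb0 \<Omega> \<T>. \<forall>T\<in>\<T>. l2_norm T (kappa \<Omega> \<T> v) \<le> C\<^sub>\<kappa> * l2_norm T v"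
    and tau: "\<tau> > 0"
    and mu: "\<forall>\<T>\<in>\<M>. \<forall>T\<in>\<T>. 0 < \<mu> (diameter T) \<and> \<mu> (diameter T) \<le> C\<^sub>\<mu> * diameter T"
    and u_reg: "in_H2 \<Omega> u" "in_H10 \<Omega> u"
    and u_pde: "AE x in lebesgue_on \<Omega>. - \<epsilon> * wlaplace \<Omega> u x + \<beta> x \<bullet> wgrad \<Omega> u x + \<sigma> * u x = f x"
    and interp: "\<forall>\<T>\<in>\<M>. nodal_interpolant \<Omega> \<T> u (I\<^sub>h \<T>)"
      "\<forall>\<T>\<in>\<M>. l2_norm \<Omega> (\<lambda>x. u x - I\<^sub>h \<T> x) \<le> C\<^sub>I * (mesh_size \<T>)\<^sup>2 * h2_seminorm \<Omega> u"
      "\<forall>\<T>\<in>\<M>. h1_seminorm \<Omega> \<Omega> (\<lambda>x. u x - I\<^sub>h \<T> x) \<le> C\<^sub>I * mesh_size \<T> * h2_seminorm \<Omega> u"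
  shows "(\<forall>\<T>\<in>\<M>. \<forall>u\<^sub>h\<^sub>b. dd_solution \<Omega> \<epsilon> \<beta> \<sigma> f \<tau> \<mu> \<T> u\<^sub>h\<^sub>b \<longrightarrow>
            energy_norm \<Omega> \<epsilon> \<sigma> (\<lambda>x. u x - kappa \<Omega> \<T> u\<^sub>h\<^sub>b x)
              \<le> (1 + max 1 C\<^sub>\<kappa>) * energy_norm \<Omega> \<epsilon> \<sigma> (\<lambda>x. u x - I\<^sub>h \<T> x)
                + max 1 C\<^sub>\<kappa> * energy_norm \<Omega> \<epsilon> \<sigma> (\<lambda>x. u x - u\<^sub>h\<^sub>b x))
       \<and> (\<exists>C>0. \<forall>\<T>\<in>\<M>. \<forall>u\<^sub>h\<^sub>b. dd_solution \<Omega> \<epsilon> \<beta> \<sigma> f \<tau> \<mu> \<T> u\<^sub>h\<^sub>b \<longrightarrow>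
            energy_norm \<Omega> \<epsilon> \<sigma> (\<lambda>x. u x - kappa \<Omega> \<T> u\<^sub>h\<^sub>b x) \<le> C * mesh_size \<T> \<and>
            sqrt ((energy_norm \<Omega> \<epsilon> \<sigma> (\<lambda>x. u x - kappa \<Omega> \<T> u\<^sub>h\<^sub>b x))\<^sup>2
                  + D_form \<Omega> \<epsilon> \<beta> \<sigma> f \<tau> \<mu> \<T> u\<^sub>h\<^sub>b u\<^sub>h\<^sub>b u\<^sub>h\<^sub>b) \<le> C * mesh_size \<T>)"
proof -
  have op: "open \<Omega>" using domain by (simp add: polyhedral_domain_def)
  have f2: "square_integrable \<Omega> f" using f by (simp add: in_L2_iff)
  obtain M where M: "M \<ge> 0" "\<beta> \<in> borel_measurable (lebesgue_on \<Omega>)" "AE x in lebesgue_on \<Omega>. norm (\<beta> x) \<le> M"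
    by (rule W1inf_field_bounded[OF beta])
  have uH: "in_H1 \<Omega> u" using u_reg by (simp add: in_H10_def)
  let ?E = "energy_norm \<Omega> \<epsilon> \<sigma>"
  define m where "m = max 1 C\<^sub>\<kappa>"
  define d where "d = diameter (closure \<Omega>)"
  define c where "c = \<bar>C\<^sub>I\<bar> * h2_seminorm \<Omega> u"
  define X where "X = M / (2 * \<epsilon>) * \<bar>C\<^sub>\<mu>\<bar> * (M + \<sigma> + l2_norm \<Omega> f / \<tau>)"
  \<comment> \<open>Here \<open>c h\<close> and \<open>c d h\<close> bound the interpolation errors in \<open>H\<^sup>1\<close> and \<open>L\<^sup>2\<close>, as \<open>h\<^sup>2 \<le> d h\<close>; \<open>X h\<^sup>2\<close> bounds
    every \<open>\<xi>\<^sub>T\<close>, and \<open>K h\<^sup>2\<close> bounds \<open>\<parallel>u\<^sub>h\<^sub>b - \<Pi>\<^sub>h u\<parallel>\<^sub>E\<^sup>2 + A\<^sub>h\<close>.\<close>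
  define K where "K = 2 * \<epsilon> * c\<^sup>2 + 2 * (M\<^sup>2 / \<epsilon> + \<sigma>) * (c * d)\<^sup>2 + X * (h1_seminorm \<Omega> \<Omega> u + c * d)\<^sup>2"
  define k where "k = sqrt (\<epsilon> * c\<^sup>2 + \<sigma> * (c * d)\<^sup>2)"
  define L where "L = (1 + m) * k + m * (k + sqrt K)"
  have p: "0 \<le> \<epsilon>" using eps by simp
  have d0: "d \<ge> 0"
    using domain(1) by (auto simp: d_def polyhedral_domain_def intro: diameter_ge_0)
  have c0: "c \<ge> 0" by (simp add: c_def h2_seminorm_def sum_nonneg)
  have X0: "X \<ge> 0" using M(1) eps sigma tau by (auto simp: X_def l2_norm_nonneg)
  have K0: "K \<ge> 0" unfolding K_def using eps sigma X0 by (intro add_nonneg_nonneg mult_nonneg_nonneg) auto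
  have k0: "k \<ge> 0" using eps sigma by (simp add: k_def)
  have m0: "m \<ge> 1" by (simp add: m_def)
  have L0: "L \<ge> 0" using m0 k0 K0 by (simp add: L_def)
  have first: "?E (\<lambda>x. u x - kappa \<Omega> \<T> U x)
      \<le> (1 + m) * ?E (\<lambda>x. u x - I\<^sub>h \<T> x) + m * ?E (\<lambda>x. u x - U x)"
    if T: "\<T> \<in> \<M>" and sol: "dd_solution \<Omega> \<epsilon> \<beta> \<sigma> f \<tau> \<mu> \<T> U" for \<T> U
  proof -
    interpret mesh \<Omega> \<T> using domain meshes(1) T by unfold_locales auto
    have w: "I\<^sub>h \<T> \<in> Vh0 \<Omega> \<T>" using interp(1) T by (simp add: nodal_interpolant_def)
    have U: "U \<in> Vhb0 \<Omega> \<T>" using sol by (simp add: dd_solution_def)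
    show ?thesis
      unfolding m_def using kappa_stable T by (intro kappa_error_le[OF _ p sigma uH w U]) auto
  qed
  have second: "?E (\<lambda>x. u x - kappa \<Omega> \<T> U x) \<le> L * mesh_size \<T>
      \<and> D_form \<Omega> \<epsilon> \<beta> \<sigma> f \<tau> \<mu> \<T> U U U \<le> K * (mesh_size \<T>)\<^sup>2"
    if T: "\<T> \<in> \<M>" and sol: "dd_solution \<Omega> \<epsilon> \<beta> \<sigma> f \<tau> \<mu> \<T> U" for \<T> U
  proof -
    interpret mesh \<Omega> \<T> using domain meshes(1) T by unfold_locales auto
    define h where "h = mesh_size \<T>"
    define w where "w = I\<^sub>h \<T>"
    have h: "0 \<le> h" "h \<le> d" using mesh_size_bounds(2,3) by (auto simp: h_def d_def)
    have w: "w \<in> Vh0 \<Omega> \<T>" using interp(1) T by (simp add: nodal_interpolant_def w_def)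
    have U: "U \<in> Vhb0 \<Omega> \<T>" using sol by (simp add: dd_solution_def)
    have H: "in_H1 \<Omega> w" "in_H1 \<Omega> U" "in_H1 \<Omega> (kappa \<Omega> \<T> U)"
      using Vh0_H10 Vhb0_H10[OF U] w by (auto simp: in_H10_def)
    have s0: "0 \<le> h2_seminorm \<Omega> u" by (simp add: h2_seminorm_def sum_nonneg)
    have g1: "h1_seminorm \<Omega> \<Omega> (\<lambda>x. u x - w x) \<le> c * h"
    proof -
      have "h1_seminorm \<Omega> \<Omega> (\<lambda>x. u x - w x) \<le> C\<^sub>I * (h * h2_seminorm \<Omega> u)"
        using interp(3) T by (simp add: w_def h_def mult.assoc)
      also have "\<dots> \<le> \<bar>C\<^sub>I\<bar> * (h * h2_seminorm \<Omega> u)" using h s0 by (intro mult_right_mono) auto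
      finally show ?thesis by (simp add: c_def mult_ac)
    qed
    have g0: "l2_norm \<Omega> (\<lambda>x. u x - w x) \<le> c * d * h"
    proof -
      have "l2_norm \<Omega> (\<lambda>x. u x - w x) \<le> C\<^sub>I * (h\<^sup>2 * h2_seminorm \<Omega> u)"
        using interp(2) T by (simp add: w_def h_def mult.assoc)
      also have "\<dots> \<le> \<bar>C\<^sub>I\<bar> * (h\<^sup>2 * h2_seminorm \<Omega> u)" using s0 by (intro mult_right_mono) auto
      also have "\<dots> = c * (h * h)" by (simp add: c_def power2_eq_square mult_ac)
      also have "\<dots> \<le> c * (d * h)" using c0 h by (intro mult_left_mono mult_right_mono) auto
      finally show ?thesis by (simp add: mult_ac)
    qed
    have gw: "h1_seminorm \<Omega> \<Omega> w \<le> h1_seminorm \<Omega> \<Omega> u + c * d"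
    proof -
      have "h1_seminorm \<Omega> \<Omega> w \<le> h1_seminorm \<Omega> \<Omega> u + h1_seminorm \<Omega> \<Omega> (\<lambda>x. u x - w x)"
        using wgrad_lincomb_norms(2)[OF op uH in_H1_diff(1)[OF op uH H(1)], of 1 "-1"] by simp
      moreover have "c * h \<le> c * d" using c0 h by (intro mult_left_mono) auto
      ultimately show ?thesis using g1 by linarith
    qed
    have xi: "0 \<le> xi \<Omega> \<epsilon> \<beta> \<sigma> f \<tau> \<mu> S (kappa \<Omega> \<T> U) \<and> xi \<Omega> \<epsilon> \<beta> \<sigma> f \<tau> \<mu> S (kappa \<Omega> \<T> U) \<le> X * h\<^sup>2"
      if S: "S \<in> \<T>" for S
    proof
      have mu1: "0 < \<mu> (diameter S)" and mu2: "\<mu> (diameter S) \<le> C\<^sub>\<mu> * diameter S" using mu T S by auto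
      have "C\<^sub>\<mu> * diameter S \<le> \<bar>C\<^sub>\<mu>\<bar> * diameter S" using mesh_size_bounds(4)[OF S] by (intro mult_right_mono) auto
      with mu2 have mu3: "\<mu> (diameter S) \<le> \<bar>C\<^sub>\<mu>\<bar> * diameter S" by linarith
      note b = xi_bounds[OF S M eps sigma tau f2 H(3), of \<mu>, OF mu1 mu3]
      show "0 \<le> xi \<Omega> \<epsilon> \<beta> \<sigma> f \<tau> \<mu> S (kappa \<Omega> \<T> U)" by (rule b(1))
      have "xi \<Omega> \<epsilon> \<beta> \<sigma> f \<tau> \<mu> S (kappa \<Omega> \<T> U) \<le> X * (diameter S)\<^sup>2" using b(2) by (simp add: X_def)
      also have "\<dots> \<le> X * h\<^sup>2"
        using X0 mesh_size_bounds(1,4)[OF S] by (intro mult_left_mono power_mono) (auto simp: h_def)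
      finally show "xi \<Omega> \<epsilon> \<beta> \<sigma> f \<tau> \<mu> S (kappa \<Omega> \<T> U) \<le> X * h\<^sup>2" .
    qed
    let ?A = "D_form \<Omega> \<epsilon> \<beta> \<sigma> f \<tau> \<mu> \<T> U U U"
    have A0: "0 \<le> ?A"
      unfolding D_form_def using xi by (intro sum_nonneg mult_nonneg_nonneg) (auto simp: l2_inner_self_nonneg)
    have "(?E (\<lambda>x. U x - w x))\<^sup>2 + ?A
        \<le> 2 * \<epsilon> * (h1_seminorm \<Omega> \<Omega> (\<lambda>x. u x - w x))\<^sup>2 + 2 * (M\<^sup>2 / \<epsilon> + \<sigma>) * (l2_norm \<Omega> (\<lambda>x. u x - w x))\<^sup>2
          + X * h\<^sup>2 * (h1_seminorm \<Omega> \<Omega> w)\<^sup>2"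
      by (rule dd_energy_estimate[OF M beta div_beta eps sigma f2 u_reg u_pde w sol xi])
    also have "\<dots> \<le> 2 * \<epsilon> * (c * h)\<^sup>2 + 2 * (M\<^sup>2 / \<epsilon> + \<sigma>) * (c * d * h)\<^sup>2
          + X * h\<^sup>2 * (h1_seminorm \<Omega> \<Omega> u + c * d)\<^sup>2"
      using g0 g1 gw eps sigma X0
      by (intro add_mono mult_left_mono power_mono) (auto simp: h1_seminorm_nonneg l2_norm_nonneg)
    also have "\<dots> = K * h\<^sup>2"
      by (simp add: K_def power_mult_distrib algebra_simps)
    finally have est: "(?E (\<lambda>x. U x - w x))\<^sup>2 + ?A \<le> K * h\<^sup>2" .
    have Ee: "?E (\<lambda>x. U x - w x) \<le> sqrt K * h"
    proof (rule power2_le_imp_le)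
      show "(?E (\<lambda>x. U x - w x))\<^sup>2 \<le> (sqrt K * h)\<^sup>2" using est A0 K0 by (simp add: power_mult_distrib)
    qed (use K0 h in simp)
    have Eg: "?E (\<lambda>x. u x - w x) \<le> k * h"
    proof -
      have "?E (\<lambda>x. u x - w x) \<le> sqrt (\<epsilon> * (c * h)\<^sup>2 + \<sigma> * (c * d * h)\<^sup>2)"
        by (rule energy_norm_le[OF p sigma g1 g0])
      also have "\<dots> = sqrt ((\<epsilon> * c\<^sup>2 + \<sigma> * (c * d)\<^sup>2) * h\<^sup>2)" by (simp add: power_mult_distrib algebra_simps)
      also have "\<dots> = k * h" using h by (simp add: k_def real_sqrt_mult)
      finally show ?thesis .
    qed
    have EU: "?E (\<lambda>x. u x - U x) \<le> (k + sqrt K) * h"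
      using energy_norm_lincomb[OF op in_H1_diff(1)[OF op uH H(1)] in_H1_diff(1)[OF op H(2,1)] p sigma, of 1 "-1"] Eg Ee
      by (simp add: algebra_simps)
    have "?E (\<lambda>x. u x - kappa \<Omega> \<T> U x) \<le> (1 + m) * ?E (\<lambda>x. u x - w x) + m * ?E (\<lambda>x. u x - U x)"
      using first[OF T sol] by (simp add: w_def)
    also have "\<dots> \<le> (1 + m) * (k * h) + m * ((k + sqrt K) * h)"
      using Eg EU m0 by (intro add_mono mult_left_mono) auto
    also have "\<dots> = L * h" by (simp add: L_def algebra_simps)
    finally have "?E (\<lambda>x. u x - kappa \<Omega> \<T> U x) \<le> L * h" .
    moreover have "?A \<le> K * h\<^sup>2" using est zero_le_power2[of "?E (\<lambda>x. U x - w x)"] by linarith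
    ultimately show ?thesis by (simp add: h_def)
  qed
  define C where "C = sqrt (L\<^sup>2 + K) + 1"
  have LC: "L \<le> C"
    using real_le_rsqrt[of L "L\<^sup>2 + K"] K0 by (simp add: C_def)
  have "C > 0" using K0 by (simp add: C_def add_nonneg_pos)
  moreover have "?E (\<lambda>x. u x - kappa \<Omega> \<T> U x) \<le> C * mesh_size \<T> \<and>
      sqrt ((?E (\<lambda>x. u x - kappa \<Omega> \<T> U x))\<^sup>2 + D_form \<Omega> \<epsilon> \<beta> \<sigma> f \<tau> \<mu> \<T> U U U) \<le> C * mesh_size \<T>"
    if T: "\<T> \<in> \<M>" and sol: "dd_solution \<Omega> \<epsilon> \<beta> \<sigma> f \<tau> \<mu> \<T> U" for \<T> U
  proof
    interpret mesh \<Omega> \<T> using domain meshes(1) T by unfold_locales auto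
    note s = second[OF T sol]
    note h = mesh_size_bounds(2)
    have "L * mesh_size \<T> \<le> C * mesh_size \<T>" using LC h by (rule mult_right_mono)
    with s show "?E (\<lambda>x. u x - kappa \<Omega> \<T> U x) \<le> C * mesh_size \<T>" by linarith
    have "(?E (\<lambda>x. u x - kappa \<Omega> \<T> U x))\<^sup>2 \<le> (L * mesh_size \<T>)\<^sup>2"
      using s by (intro power_mono energy_norm_nonneg p sigma) auto
    then have "(?E (\<lambda>x. u x - kappa \<Omega> \<T> U x))\<^sup>2 + D_form \<Omega> \<epsilon> \<beta> \<sigma> f \<tau> \<mu> \<T> U U U \<le> (L\<^sup>2 + K) * (mesh_size \<T>)\<^sup>2"
      using s by (simp add: power_mult_distrib algebra_simps)
    then have "sqrt ((?E (\<lambda>x. u x - kappa \<Omega> \<T> U x))\<^sup>2 + D_form \<Omega> \<epsilon> \<beta> \<sigma> f \<tau> \<mu> \<T> U U U)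
        \<le> sqrt ((L\<^sup>2 + K) * (mesh_size \<T>)\<^sup>2)" by (rule real_sqrt_le_mono)
    also have "\<dots> = sqrt (L\<^sup>2 + K) * mesh_size \<T>" using h by (simp add: real_sqrt_mult)
    also have "\<dots> \<le> C * mesh_size \<T>" using h by (intro mult_right_mono) (auto simp: C_def)
    finally show "sqrt ((?E (\<lambda>x. u x - kappa \<Omega> \<T> U x))\<^sup>2 + D_form \<Omega> \<epsilon> \<beta> \<sigma> f \<tau> \<mu> \<T> U U U) \<le> C * mesh_size \<T>" .
  qed
  ultimately show ?thesis using first unfolding m_def by blast
qed

end
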